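(* Suppose $a_{jk}$, $j,k=1,\dots,n$, satisfy conditions (D1)–(D5) listed in the context, and let $h(x,\xi)=\sum_{j,k=1}^na_{jk}(x)\xi_j\xi_k\in S^2_{1,0}$. Then for each $\mu\in\mathbb{Z}^n$ there exists a symbol $p_\mu\in S^0_{1,0}$ such that $$H_hp_\mu(x,\xi)\ \ge\ C_1\frac{|\xi|}{\langle x-x_\mu\rangle^2}-C_2\qquad\text{for all }x,\xi\in\mathbb{R}^n,$$ where the constants $C_1>0$, $C_2$ and (bounds for) the seminorms of $p_\mu$ can be taken independent of $\mu$.
   Context: Notation: $\langle x\rangle=(1+|x|^2)^{1/2}$; repeated indices are summed. $S^m_{1,0}$ is the standard symbol class on $\mathbb{R}^n\times\mathbb{R}^n$. $H_hp=\{h,p\}=\sum_{i=1}^n\frac{\partial h}{\partial\xi_i}\frac{\partial p}{\partial x_i}-\frac{\partial h}{\partial x_i}\frac{\partial p}{\partial\xi_i}$. Write $\mathbb{R}^n=\bigcup_{\mu\in\mathbb{Z}^n}Q_\mu$ with $Q_\mu$ unit cubes with vertices in $\mathbb{Z}^n$ (indexed by a corner); $x_\mu$ is the center of $Q_\mu$. Let $A(x)=(a_{jk}(x))_{j,k=1}^n$. (D1) For an integer $N=N(n)$ (depending only on $n$) and a constant $C>0$, $a_{jk}\in C_b^N(\mathbb{R}^n)$ for all $j,k$, with norm controlled by $C$. (D2) The $a_{jk}$ are real valued and $A(x)$ is symmetric. (D3) $C^{-1}|\xi|^2\le\sum_{j,k}a_{jk}(x)\xi_j\xi_k\le C|\xi|^2$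 for all $x,\xi\in\mathbb{R}^n$. (D4) $|I-A(x)|\le C/\langle x\rangle^2$ and $|\nabla_xa_{jk}(x)|\le C/\langle x\rangle^2$. (D5) Let $X(s,x,\xi),\Xi(s,x,\xi)$ be the Hamiltonian flow of $h$: $\frac{d}{ds}X_j=2a_{jk}(X)\Xi_k$, $\frac{d}{ds}\Xi_j=-\frac{\partial a_{lk}}{\partial x_j}(X)\Xi_l\Xi_k$, $X(0,x,\xi)=x$, $\Xi(0,x,\xi)=\xi$. For each $(x,\xi)$ with $\xi\ne0$ the sets $\{X(s,x,\xi):s>0\}$ and $\{X(s,x,\xi):s<0\}$ are unbounded. *)

theory Defs
  imports "HOL-Analysis.Analysis"
begin

definition jb :: "real ^ 'n \<Rightarrow> real"
  where "jb x = sqrt (1 + (norm x)\<^sup>2)"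

definition dir_deriv :: "'a::real_normed_vector \<Rightarrow> ('a \<Rightarrow> real) \<Rightarrow> 'a \<Rightarrow> real"
  where "dir_deriv v f x = frechet_derivative f (at x) v"

text \<open>
  Higher partial derivatives are indexed by lists of directions instead of multi-indices: the list
  \<open>[v\<^sub>1, \<dots>, v\<^sub>k]\<close> stands for \<open>\<partial>\<^bsub>v\<^sub>1\<^esub> \<dots> \<partial>\<^bsub>v\<^sub>k\<^esub>\<close>.  For functions of class \<open>C\<^sup>k\<close> the order of the entries is
  irrelevant, and a list of basis vectors in which the \<open>i\<close>-th one occurs \<open>\<alpha>\<^sub>i\<close> times gives \<open>\<partial>\<^sup>\<alpha>\<close>.
\<close>

definition dir_derivs :: "'a::real_normed_vector list \<Rightarrow> ('a \<Rightarrow> real) \<Rightarrow> 'a \<Rightarrow> real"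
  where "dir_derivs vs f = foldr dir_deriv vs f"

definition C_class :: "nat \<Rightarrow> ('a::euclidean_space \<Rightarrow> real) \<Rightarrow> bool"
  where "C_class k f \<longleftrightarrow>
    (\<forall>vs. set vs \<subseteq> Basis \<longrightarrow>
      (length vs < k \<longrightarrow> (\<forall>x. dir_derivs vs f differentiable (at x))) \<and>
      (length vs \<le> k \<longrightarrow> continuous_on UNIV (dir_derivs vs f)))"

text \<open>
  \<open>Cb_bounded N C f\<close>: \<open>f \<in> C\<^sub>b\<^sup>N\<close> with norm at most \<open>C\<close>, the norm being the maximum of
  \<open>sup\<^sub>x \<bar>\<partial>\<^sup>\<alpha> f(x)\<bar>\<close> over all \<open>\<alpha>\<close> of order at most \<open>N\<close>.
\<close>

definition Cb_bounded :: "nat \<Rightarrow> real \<Rightarrow> ('a::euclidean_space \<Rightarrow> real) \<Rightarrow> bool"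
  where "Cb_bounded N C f \<longleftrightarrow> C_class N f \<and>
    (\<forall>vs x. set vs \<subseteq> Basis \<longrightarrow> length vs \<le> N \<longrightarrow> \<bar>dir_derivs vs f x\<bar> \<le> C)"

text \<open>Functions on phase space take the pair \<open>(x, \<xi>)\<close> as argument.\<close>

type_synonym 'n phase = "(real ^ 'n) \<times> (real ^ 'n)"

definition ex :: "'n::finite \<Rightarrow> 'n phase"
  where "ex i = (axis i 1, 0)"

definition e\<xi> :: "'n::finite \<Rightarrow> 'n phase"
  where "e\<xi> i = (0, axis i 1)"

definition symbol_quotient ::
    "real \<Rightarrow> 'n::finite list \<Rightarrow> 'n list \<Rightarrow> ('n phase \<Rightarrow> real) \<Rightarrow> 'n phase \<Rightarrow> real"
  where "symbol_quotient m \<alpha> \<beta> p z =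
    \<bar>dir_derivs (map ex \<alpha> @ map e\<xi> \<beta>) p z\<bar> / jb (snd z) powr (m - real (length \<beta>))"

text \<open>The class \<open>S\<^sup>m\<^bsub>1,0\<^esub>\<close> (real-valued symbols) and its seminorms.\<close>

definition symbol_class :: "real \<Rightarrow> ('n::finite phase \<Rightarrow> real) set"
  where "symbol_class m =
    {p. (\<forall>k. C_class k p) \<and> (\<forall>\<alpha> \<beta>. bdd_above (range (symbol_quotient m \<alpha> \<beta> p)))}"

definition symbol_seminorm :: "real \<Rightarrow> 'n::finite list \<Rightarrow> 'n list \<Rightarrow> ('n phase \<Rightarrow> real) \<Rightarrow> real"
  where "symbol_seminorm m \<alpha> \<beta> p = (SUP z. symbol_quotient m \<alpha> \<beta> p z)"

text \<open>\<open>poisson h p = H\<^sub>h p = {h, p}\<close>\<close>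

definition poisson ::
    "('n::finite phase \<Rightarrow> real) \<Rightarrow> ('n phase \<Rightarrow> real) \<Rightarrow> 'n phase \<Rightarrow> real"
  where "poisson h p z =
    (\<Sum>i\<in>UNIV. dir_deriv (e\<xi> i) h z * dir_deriv (ex i) p z
             - dir_deriv (ex i) h z * dir_deriv (e\<xi> i) p z)"

definition ham :: "(real ^ 'n \<Rightarrow> real ^ 'n ^ 'n) \<Rightarrow> 'n::finite phase \<Rightarrow> real"
  where "ham a = (\<lambda>(x, \<xi>). \<Sum>j\<in>UNIV. \<Sum>k\<in>UNIV. a x $ j $ k * \<xi> $ j * \<xi> $ k)"

definition coeffs_regular :: "nat \<Rightarrow> real \<Rightarrow> (real ^ 'n \<Rightarrow> real ^ 'n ^ 'n) \<Rightarrow> bool"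
  where "coeffs_regular N C a \<longleftrightarrow> (\<forall>j k. Cb_bounded N C (\<lambda>x. a x $ j $ k))"

definition coeffs_symmetric :: "(real ^ 'n \<Rightarrow> real ^ 'n ^ 'n) \<Rightarrow> bool"
  where "coeffs_symmetric a \<longleftrightarrow> (\<forall>x. transpose (a x) = a x)"

definition coeffs_elliptic :: "real \<Rightarrow> (real ^ 'n \<Rightarrow> real ^ 'n ^ 'n) \<Rightarrow> bool"
  where "coeffs_elliptic C a \<longleftrightarrow>
    (\<forall>x \<xi>. inverse C * (norm \<xi>)\<^sup>2 \<le> (\<Sum>j\<in>UNIV. \<Sum>k\<in>UNIV. a x $ j $ k * \<xi> $ j * \<xi> $ k) \<and>
            (\<Sum>j\<in>UNIV. \<Sum>k\<in>UNIV. a x $ j $ k * \<xi> $ j * \<xi> $ k) \<le> C * (norm \<xi>)\<^sup>2)"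

definition coeffs_asymp_flat :: "real \<Rightarrow> (real ^ 'n \<Rightarrow> real ^ 'n ^ 'n) \<Rightarrow> bool"
  where "coeffs_asymp_flat C a \<longleftrightarrow>
    (\<forall>x. norm (mat 1 - a x) \<le> C / (jb x)\<^sup>2 \<and>
         (\<forall>j k. norm (\<chi> i. dir_deriv (axis i 1) (\<lambda>y. a y $ j $ k) x) \<le> C / (jb x)\<^sup>2))"

definition hamiltonian_flow ::
    "(real ^ 'n \<Rightarrow> real ^ 'n ^ 'n) \<Rightarrow>
     (real \<Rightarrow> real ^ 'n \<Rightarrow> real ^ 'n \<Rightarrow> real ^ 'n) \<Rightarrow>
     (real \<Rightarrow> real ^ 'n \<Rightarrow> real ^ 'n \<Rightarrow> real ^ 'n) \<Rightarrow> bool"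
  where "hamiltonian_flow a X \<Xi> \<longleftrightarrow>
    (\<forall>x \<xi>. X 0 x \<xi> = x \<and> \<Xi> 0 x \<xi> = \<xi> \<and>
      (\<forall>s j.
        ((\<lambda>s. X s x \<xi> $ j) has_real_derivative
           2 * (\<Sum>k\<in>UNIV. a (X s x \<xi>) $ j $ k * \<Xi> s x \<xi> $ k)) (at s) \<and>
        ((\<lambda>s. \<Xi> s x \<xi> $ j) has_real_derivative
           - (\<Sum>l\<in>UNIV. \<Sum>k\<in>UNIV. dir_deriv (axis j 1) (\<lambda>y. a y $ l $ k) (X s x \<xi>)
                * \<Xi> s x \<xi> $ l * \<Xi> s x \<xi> $ k)) (at s)))"

definition nontrapping :: "(real \<Rightarrow> real ^ 'n \<Rightarrow> real ^ 'n \<Rightarrow> real ^ 'n) \<Rightarrow> bool"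
  where "nontrapping X \<longleftrightarrow>
    (\<forall>x \<xi>. \<xi> \<noteq> 0 \<longrightarrow> \<not> bounded {X s x \<xi> | s. s > 0} \<and> \<not> bounded {X s x \<xi> | s. s < 0})"

text \<open>The center of the unit cube \<open>Q\<^sub>\<mu> = \<Prod>\<^sub>i [\<mu>\<^sub>i, \<mu>\<^sub>i + 1]\<close>.\<close>

definition cube_center :: "int ^ 'n \<Rightarrow> real ^ 'n"
  where "cube_center \<mu> = (\<chi> i. of_int (\<mu> $ i) + 1 / 2)"

end

theory Submission
  imports Defs
begin

text \<open>
  Write \<open>\<eta> = \<xi> / \<langle>\<xi>\<rangle>\<close>.  For a function \<open>P\<close> on \<open>\<real>\<^sup>n\<close> times the closed unit ball, \<open>p(x, \<xi>) = P(x, \<eta>)\<close>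
  satisfies \<open>H\<^sub>h p = \<langle>\<xi>\<rangle> D P(x, \<eta>)\<close>, where \<open>D\<close> is the derivative along one fixed vector field, here
  \<open>sphere_field\<close> (lemma \<open>poisson_compactify\<close>).  If \<open>P\<close> is smooth with bounded derivatives, then \<open>p\<close> is
  a symbol of order \<open>0\<close>.  As everything is bounded for bounded \<open>\<xi>\<close>, it suffices to find, with uniform
  bounds, functions \<open>P\<^sub>\<mu>\<close> with \<open>D P\<^sub>\<mu> \<ge> c \<langle>x - x\<^sub>\<mu>\<rangle>\<^sup>-\<^sup>2\<close> for \<open>\<bar>\<eta>\<bar>\<close> near \<open>1\<close>.

  For the flat metric the explicit function \<open>radial\<close>, namely \<open>\<theta> (1 - 1 / (2 \<langle>y\<rangle>))\<close> with
  \<open>\<theta> = y \<bullet> \<eta> / \<langle>y\<rangle>\<close> and \<open>y = x - x\<^sub>\<mu>\<close>, has this property: \<open>\<theta>\<close> grows along rays that are not radial,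
  the second factor takes care of radial ones.  For the given metric, the decay of \<open>I - A\<close> and \<open>\<nabla>a\<close>
  leaves an error \<open>C \<langle>x\<rangle>\<^sup>-\<^sup>2\<close> that does not depend on \<open>\<mu>\<close> (\<open>radial_growth_unit\<close>).  So one single function
  \<open>P\<close> with \<open>D P \<ge> c \<langle>x\<rangle>\<^sup>-\<^sup>2\<close> (\<open>global_escape_function\<close>) is enough: add a large multiple of it to each
  of the translated radial functions.

  That \<open>P\<close> has two parts.  The radial function stretched to the scale \<open>\<rho>\<close> has derivative at least
  \<open>1 / (4 \<rho> (1 + \<bar>x\<bar>\<^sup>2 / \<rho>\<^sup>2))\<close> outside a ball of fixed radius \<open>R\<close>, and its loss inside that ball is only
  \<open>O(1 / \<rho>)\<close> (\<open>radial_growth_wide\<close>).  Inside the ball the nontrapping hypothesis is used: minus the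
  time integral of a cutoff of the ball along the future ray, weighted by the momentum, increases along the
  flow at unit rate there, and compactness bounds it by a constant \<open>B\<close> (\<open>escape_time\<close>,
  \<open>passage_bounded\<close>, \<open>escape_function\<close>).  Cutting it off between \<open>\<bar>x\<bar> = \<rho>\<close> and \<open>\<bar>x\<bar> = 2 \<rho>\<close> costs
  \<open>O(B / \<rho>)\<close>.  This is the order of the gain of the stretched radial function, so a multiple \<open>A\<close> of
  the latter with \<open>A\<close> of the size of \<open>B\<close> pays for the cutoff; as \<open>B\<close> does not depend on \<open>\<rho>\<close>, \<open>A\<close> can be
  fixed first, and a large \<open>\<rho>\<close> then makes the loss \<open>O(A / \<rho>)\<close> inside the ball harmless.

  Coefficients of class \<open>C\<^sup>2\<close> make the Hamiltonian field Lipschitz, and the time integral is then only a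
  Lipschitz function.  Its convolution with a narrow bump is smooth, and the lower bounds
  survive because they are bounds for difference quotients along the flow, and the flow directions at
  nearby points differ little (\<open>mollification\<close>, \<open>smooth_escape_function\<close>).
\<close>

section \<open>Families of functions with uniform symbol bounds\<close>

lemma dir_deriv_eq: "(f has_derivative f') (at x) \<Longrightarrow> dir_deriv v f x = f' v"
  unfolding dir_deriv_def by (metis frechet_derivative_at)

lemma has_derivative_dir_deriv:
  "f differentiable (at x) \<Longrightarrow> (f has_derivative (\<lambda>v. dir_deriv v f x)) (at x)"
  unfolding dir_deriv_def using frechet_derivative_works by (metis eta_contract_eq)

lemma dir_deriv_linear: "f differentiable (at x) \<Longrightarrow> linear (\<lambda>v. dir_deriv v f x)"
  using has_derivative_dir_deriv has_derivative_linear by blast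

lemma dir_deriv_expand:
  fixes f :: "'a::euclidean_space \<Rightarrow> real"
  assumes "f differentiable (at x)"
  shows "dir_deriv v f x = (\<Sum>b\<in>Basis. (v \<bullet> b) * dir_deriv b f x)"
proof -
  have "dir_deriv (\<Sum>b\<in>Basis. (v \<bullet> b) *\<^sub>R b) f x = (\<Sum>b\<in>Basis. (v \<bullet> b) *\<^sub>R dir_deriv b f x)"
    by (simp only: linear_sum[OF dir_deriv_linear[OF assms]] linear_scale[OF dir_deriv_linear[OF assms]])
  then show ?thesis by (simp add: euclidean_representation)
qed

text \<open>
  The bounds of a symbol class up to \<open>k\<close> derivatives, uniformly over a family indexed by \<open>'i\<close>.
  Sizes are measured by powers of the weight \<open>w\<close>, and a derivative in the basis direction \<open>b\<close> lowers the
  order by \<open>d b\<close>: for \<open>w (x, \<xi>) = \<langle>\<xi>\<rangle>\<close> and \<open>d\<close> equal to \<open>0\<close> on the \<open>x\<close> directions and \<open>1\<close> on the \<open>\<xi>\<close>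
  directions this is \<open>S\<^sup>m\<^bsub>1,0\<^esub>\<close>, and for \<open>w = 1\<close>, \<open>d = 0\<close> these are functions with bounded derivatives.
  The recursion over one derivative at a time is the form in which product and chain rules are
  proved by a plain induction on \<open>k\<close>.
\<close>

fun symbols_upto ::
  "('a::euclidean_space \<Rightarrow> real) \<Rightarrow> ('a \<Rightarrow> real) \<Rightarrow> nat \<Rightarrow> real \<Rightarrow> ('i \<Rightarrow> 'a \<Rightarrow> real) \<Rightarrow> bool" where
  "symbols_upto w d 0 m p \<longleftrightarrow>
     (\<exists>K. \<forall>i z. \<bar>p i z\<bar> \<le> K * w z powr m) \<and> (\<forall>i. continuous_on UNIV (p i))"
| "symbols_upto w d (Suc k) m p \<longleftrightarrow>
     (\<exists>K. \<forall>i z. \<bar>p i z\<bar> \<le> K * w z powr m) \<and> (\<forall>i z. p i differentiable (at z)) \<and>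
     (\<forall>b\<in>Basis. symbols_upto w d k (m - d b) (\<lambda>i. dir_deriv b (p i)))"

abbreviation bounded_Ck :: "nat \<Rightarrow> ('a::euclidean_space \<Rightarrow> real) \<Rightarrow> bool" where
  "bounded_Ck k f \<equiv> symbols_upto (\<lambda>_. 1) (\<lambda>_. 0) k 0 (\<lambda>_::unit. f)"

lemma symbols_bound: "symbols_upto w d k m p \<Longrightarrow> \<exists>K\<ge>0. \<forall>i z. \<bar>p i z\<bar> \<le> K * w z powr m"
proof -
  assume "symbols_upto w d k m p"
  then obtain K where K: "\<forall>i z. \<bar>p i z\<bar> \<le> K * w z powr m" by (cases k) auto
  have "\<bar>p i z\<bar> \<le> max K 0 * w z powr m" for i z
    by (rule order_trans[OF K[rule_format]]) (auto intro!: mult_right_mono)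
  then show ?thesis by (intro exI[of _ "max K 0"]) auto
qed

lemma symbols_continuous: "symbols_upto w d k m p \<Longrightarrow> continuous_on UNIV (p i)"
  by (cases k) (auto simp: continuous_on_eq_continuous_at differentiable_imp_continuous_within)

lemma symbols_SucD: "symbols_upto w d (Suc k) m p \<Longrightarrow> symbols_upto w d k m p"
proof (induction k arbitrary: m p)
  case 0
  then show ?case using symbols_continuous[OF 0] by simp
next
  case (Suc k)
  then show ?case by (metis symbols_upto.simps(2))
qed

lemma symbols_mono: "symbols_upto w d k m p \<Longrightarrow> j \<le> k \<Longrightarrow> symbols_upto w d j m p"
proof (induction k)
  case (Suc k)
  then show ?case using symbols_SucD[OF Suc(2)] by (cases "j = Suc k") auto
qed simp

lemma symbols_SucI:
  assumes "\<And>i z. \<bar>p i z\<bar> \<le> K * w z powr m"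
    and "\<And>i z. (p i has_derivative p' i z) (at z)"
    and "\<And>b. b \<in> Basis \<Longrightarrow> symbols_upto w d k (m - d b) (\<lambda>i z. p' i z b)"
  shows "symbols_upto w d (Suc k) m p"
proof -
  have "dir_deriv b (p i) = (\<lambda>z. p' i z b)" for b i
    using assms(2) by (auto simp: dir_deriv_eq)
  moreover have "p i differentiable (at z)" for i z
    using assms(2) unfolding differentiable_def by blast
  ultimately show ?thesis using assms(1,3) by auto
qed

lemma symbols_differentiable: "symbols_upto w d (Suc k) m p \<Longrightarrow> p i differentiable (at z)"
  by simp

lemma symbols_dir_deriv:
  "symbols_upto w d (Suc k) m p \<Longrightarrow> b \<in> Basis \<Longrightarrow> symbols_upto w d k (m - d b) (\<lambda>i. dir_deriv b (p i))"
  by simp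

lemma symbols_reindex: "symbols_upto w d k m p \<Longrightarrow> symbols_upto w d k m (\<lambda>i. p (f i))"
proof (induction k arbitrary: m p)
  case 0
  then show ?case by auto
next
  case (Suc k)
  obtain K where K: "\<forall>i z. \<bar>p i z\<bar> \<le> K * w z powr m" using symbols_bound[OF Suc.prems] by blast
  show ?case
  proof (rule symbols_SucI[where K=K and p'="\<lambda>i z v. dir_deriv v (p (f i)) z"])
    show "\<bar>p (f i) z\<bar> \<le> K * w z powr m" for i z using K by blast
    show "(p (f i) has_derivative (\<lambda>v. dir_deriv v (p (f i)) z)) (at z)" for i z
      by (rule has_derivative_dir_deriv[OF symbols_differentiable[OF Suc.prems]])
    show "b \<in> Basis \<Longrightarrow> symbols_upto w d k (m - d b) (\<lambda>i. dir_deriv b (p (f i)))" for b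
      by (rule Suc.IH[of "m - d b" "\<lambda>i. dir_deriv b (p i)"]) (use Suc.prems in simp)
  qed
qed

text \<open>
  Links the recursive description to the iterated partial derivatives in the definition of symbol classes.
\<close>

lemma symbols_dir_derivs:
  assumes "set vs \<subseteq> Basis" "symbols_upto w d (length vs + k) m p"
  shows "symbols_upto w d k (m - sum_list (map d vs)) (\<lambda>i. dir_derivs vs (p i))"
  using assms
proof (induction vs arbitrary: k)
  case Nil
  then show ?case by (simp add: dir_derivs_def)
next
  case (Cons v vs)
  have "symbols_upto w d (Suc k) (m - sum_list (map d vs)) (\<lambda>i. dir_derivs vs (p i))"
    by (rule Cons.IH) (use Cons.prems in auto)
  then have "symbols_upto w d k (m - sum_list (map d vs) - d v) (\<lambda>i. dir_deriv v (dir_derivs vs (p i)))"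
    using Cons.prems(1) by simp
  then show ?case by (simp add: dir_derivs_def algebra_simps)
qed

lemma symbols_dir_deriv_bound:
  fixes p :: "'i \<Rightarrow> 'a::euclidean_space \<Rightarrow> real"
  assumes "symbols_upto w d (Suc 0) m p"
  shows "\<exists>K\<ge>0. \<forall>b\<in>Basis. \<forall>i z. \<bar>dir_deriv b (p i) z\<bar> \<le> K * w z powr (m - d b)"
proof -
  have "\<forall>b\<in>Basis. \<exists>K. \<forall>i z. \<bar>dir_deriv b (p i) z\<bar> \<le> K * w z powr (m - d b)"
    using symbols_bound[OF symbols_dir_deriv[OF assms]] by blast
  then obtain K where K: "\<And>b i z. b \<in> Basis \<Longrightarrow> \<bar>dir_deriv b (p i) z\<bar> \<le> K b * w z powr (m - d b)" by metis
  have "\<bar>dir_deriv b (p i) z\<bar> \<le> Max (insert 0 (K ` Basis)) * w z powr (m - d b)" if "b \<in> Basis" for b i z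
  proof -
    have "K b \<le> Max (insert 0 (K ` Basis))" by (rule Max_ge) (use that in auto)
    then show ?thesis by (intro order_trans[OF K[OF that] mult_right_mono]) auto
  qed
  then show ?thesis by (intro exI[of _ "Max (insert 0 (K ` Basis))"]) auto
qed

lemma symbols_zero: "symbols_upto w d k m (\<lambda>i z. 0)"
proof (induction k arbitrary: m)
  case (Suc k)
  show ?case by (rule symbols_SucI[where K=0 and p' = "\<lambda>_ _ _. 0"]) (use Suc in auto)
qed (auto intro!: exI[of _ 0])

lemma symbols_const:
  assumes "\<And>i. \<bar>c i\<bar> \<le> K" "\<And>z. w z > 0"
  shows "symbols_upto w d k 0 (\<lambda>i z. c i)"
proof (cases k)
  case 0
  have "\<bar>c i\<bar> \<le> K * w z powr 0" for i z using assms(1)[of i] assms(2)[of z] by simp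
  then have "\<exists>K. \<forall>i z. \<bar>c i\<bar> \<le> K * w z powr 0" by blast
  then show ?thesis using 0 by (simp del: powr_zero_eq_one)
next
  case (Suc j)
  show ?thesis unfolding Suc
    by (rule symbols_SucI[where K=K and p' = "\<lambda>_ _ _. 0"])
      (use assms in \<open>auto intro: symbols_zero simp: less_imp_neq[symmetric]\<close>)
qed

lemma symbols_add:
  assumes "symbols_upto w d k m p" "symbols_upto w d k m q"
  shows "symbols_upto w d k m (\<lambda>i z. p i z + q i z)"
  using assms
proof (induction k arbitrary: m p q)
  case 0
  then obtain K L where "\<forall>i z. \<bar>p i z\<bar> \<le> K * w z powr m" "\<forall>i z. \<bar>q i z\<bar> \<le> L * w z powr m" by auto
  then have "\<bar>p i z + q i z\<bar> \<le> (K + L) * w z powr m" for i z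
    unfolding distrib_right by (intro order_trans[OF abs_triangle_ineq] add_mono) auto
  then show ?case using 0 by (auto intro!: continuous_intros)
next
  case (Suc k)
  then obtain K L where "\<forall>i z. \<bar>p i z\<bar> \<le> K * w z powr m" "\<forall>i z. \<bar>q i z\<bar> \<le> L * w z powr m" by auto
  then have "\<bar>p i z + q i z\<bar> \<le> (K + L) * w z powr m" for i z
    unfolding distrib_right by (intro order_trans[OF abs_triangle_ineq] add_mono) auto
  then show ?case
    by (rule symbols_SucI[where p' = "\<lambda>i z b. dir_deriv b (p i) z + dir_deriv b (q i) z"])
      (use Suc in \<open>auto intro!: has_derivative_add has_derivative_dir_deriv\<close>)
qed

lemma symbols_mult:
  assumes "symbols_upto w d k m p" "symbols_upto w d k m' q"
  shows "symbols_upto w d k (m + m') (\<lambda>i z. p i z * q i z)"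
  using assms
proof (induction k arbitrary: m m' p q)
  case 0
  obtain K L where KL: "\<forall>i z. \<bar>p i z\<bar> \<le> K * w z powr m" "\<forall>i z. \<bar>q i z\<bar> \<le> L * w z powr m'"
    "K \<ge> 0" "L \<ge> 0" using symbols_bound[OF 0(1)] symbols_bound[OF 0(2)] by auto
  have "\<bar>p i z * q i z\<bar> \<le> (K * L) * w z powr (m + m')" for i z
    using mult_mono[OF KL(1)[rule_format, of i z] KL(2)[rule_format, of i z]] KL(3)
    by (simp add: abs_mult powr_add mult_ac)
  then show ?case using 0 by (auto intro!: continuous_intros)
next
  case (Suc k)
  obtain K L where KL: "\<forall>i z. \<bar>p i z\<bar> \<le> K * w z powr m" "\<forall>i z. \<bar>q i z\<bar> \<le> L * w z powr m'"
    "K \<ge> 0" "L \<ge> 0" using symbols_bound[OF Suc(2)] symbols_bound[OF Suc(3)] by auto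
  have "\<bar>p i z * q i z\<bar> \<le> (K * L) * w z powr (m + m')" for i z
    using mult_mono[OF KL(1)[rule_format, of i z] KL(2)[rule_format, of i z]] KL(3)
    by (simp add: abs_mult powr_add mult_ac)
  then show ?case
  proof (rule symbols_SucI[where p' = "\<lambda>i z b. p i z * dir_deriv b (q i) z + dir_deriv b (p i) z * q i z"])
    show "((\<lambda>z. p i z * q i z) has_derivative
        (\<lambda>b. p i z * dir_deriv b (q i) z + dir_deriv b (p i) z * q i z)) (at z)" for i z
      using Suc by (auto intro!: has_derivative_mult has_derivative_dir_deriv)
    fix b :: 'a assume b: "b \<in> Basis"
    have "symbols_upto w d k (m + (m' - d b)) (\<lambda>i z. p i z * dir_deriv b (q i) z)"
      by (rule Suc.IH) (use symbols_SucD[OF Suc(2)] Suc(3) b in auto)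
    moreover have "symbols_upto w d k ((m - d b) + m') (\<lambda>i z. dir_deriv b (p i) z * q i z)"
      by (rule Suc.IH) (use symbols_SucD[OF Suc(3)] Suc(2) b in auto)
    ultimately show "symbols_upto w d k (m + m' - d b)
        (\<lambda>i z. p i z * dir_deriv b (q i) z + dir_deriv b (p i) z * q i z)"
      by (intro symbols_add) (simp_all add: algebra_simps)
  qed
qed

lemma symbols_cmult:
  assumes "symbols_upto w d k m p" "\<And>z. w z > 0"
  shows "symbols_upto w d k m (\<lambda>i z. c * p i z)"
proof -
  have "symbols_upto w d k 0 (\<lambda>i z. c)"
    by (rule symbols_const[where K="\<bar>c\<bar>"]) (use assms(2) in auto)
  from symbols_mult[OF this assms(1)] show ?thesis by simp
qed

lemma symbols_sum:
  "(\<And>j. j \<in> J \<Longrightarrow> symbols_upto w d k m (p j)) \<Longrightarrow> symbols_upto w d k m (\<lambda>i z. \<Sum>j\<in>J. p j i z)"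
  by (induction J rule: infinite_finite_induct) (auto intro!: symbols_add symbols_zero)

lemma symbols_prod:
  assumes w: "\<And>z. w z > 0"
  shows "(\<And>j. j \<in> J \<Longrightarrow> symbols_upto w d k 0 (p j)) \<Longrightarrow> symbols_upto w d k 0 (\<lambda>i z. \<Prod>j\<in>J. p j i z)"
proof (induction J rule: infinite_finite_induct)
  case (insert x F)
  have "symbols_upto w d k (0 + 0) (\<lambda>i z. p x i z * (\<Prod>j\<in>F. p j i z))"
    by (rule symbols_mult) (use insert in auto)
  then show ?case using insert by simp
next
  case empty
  show ?case by (simp only: prod.empty) (rule symbols_const[where K=1], use w in auto)
next
  case (infinite A)
  show ?case by (simp only: prod.infinite[OF infinite(1)]) (rule symbols_const[where K=1], use w in auto)
qed

text \<open>
  By the chain rule the derivatives of the composition are sums of products of the same kind, so the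
  induction closes without formulas for higher derivatives.  Only the derivatives of \<open>g\<close> have to be
  symbols; \<open>g\<close> itself may be unbounded.
\<close>

lemma symbols_compose:
  fixes F :: "'b::euclidean_space \<Rightarrow> real" and g :: "'i \<Rightarrow> 'a::euclidean_space \<Rightarrow> 'b"
  assumes F: "bounded_Ck k F"
    and w: "\<And>z. w z > 0"
    and g: "\<And>i z. (g i has_derivative g' i z) (at z)"
    and g': "\<And>b e. b \<in> Basis \<Longrightarrow> e \<in> Basis \<Longrightarrow> symbols_upto w d k (- d b) (\<lambda>i z. g' i z b \<bullet> e)"
  shows "symbols_upto w d k 0 (\<lambda>i z. F (g i z))"
  using F g'
proof (induction k arbitrary: F)
  case 0
  have cont: "continuous_on UNIV (g i)" for i
    by (rule has_derivative_continuous_on[OF has_derivative_at_withinI[OF g]])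
  have F: "continuous_on UNIV F" using symbols_continuous[OF 0(1)] by simp
  obtain K where K: "\<forall>z. \<bar>F z\<bar> \<le> K" using 0(1) by auto
  have "\<bar>F (g i z)\<bar> \<le> K * w z powr 0" for i z using K w[of z] by simp
  then have "\<exists>K. \<forall>i z. \<bar>F (g i z)\<bar> \<le> K * w z powr 0" by blast
  moreover have "continuous_on UNIV (\<lambda>z. F (g i z))" for i
    by (rule continuous_on_compose2[OF F cont]) simp
  ultimately show ?case by (simp del: powr_zero_eq_one)
next
  case (Suc k)
  obtain K where K: "\<forall>z. \<bar>F z\<bar> \<le> K" using Suc(2) by auto
  have dF: "(F has_derivative (\<lambda>v. dir_deriv v F z)) (at z)" for z
    using Suc(2) has_derivative_dir_deriv by auto
  show ?case
  proof (rule symbols_SucI[where p' = "\<lambda>i z b. \<Sum>e\<in>Basis. (g' i z b \<bullet> e) * dir_deriv e F (g i z)"])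
    show "\<bar>F (g i z)\<bar> \<le> K * w z powr 0" for i z using K w[of z] by simp
    show "((\<lambda>z. F (g i z)) has_derivative
          (\<lambda>b. \<Sum>e\<in>Basis. (g' i z b \<bullet> e) * dir_deriv e F (g i z))) (at z)" for i z
    proof -
      have "F differentiable at (g i z)" using Suc(2) by simp
      then have "dir_deriv (g' i z b) F (g i z) = (\<Sum>e\<in>Basis. (g' i z b \<bullet> e) * dir_deriv e F (g i z))" for b
        by (rule dir_deriv_expand)
      then show ?thesis using has_derivative_compose[OF g dF, of i z] by simp
    qed
    fix b :: 'a assume b: "b \<in> Basis"
    have "symbols_upto w d k (- d b + 0) (\<lambda>i z. (g' i z b \<bullet> e) * dir_deriv e F (g i z))" if "e \<in> Basis" for e
    proof (rule symbols_mult)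
      show "symbols_upto w d k (- d b) (\<lambda>i z. g' i z b \<bullet> e)"
        by (rule symbols_SucD[OF Suc(3)[OF b that]])
      show "symbols_upto w d k 0 (\<lambda>i z. dir_deriv e F (g i z))"
      proof (rule Suc.IH)
        show "bounded_Ck k (dir_deriv e F)" using Suc(2) that by auto
      qed (rule symbols_SucD[OF Suc(3)])
    qed
    then show "symbols_upto w d k (0 - d b) (\<lambda>i z. \<Sum>e\<in>Basis. (g' i z b \<bullet> e) * dir_deriv e F (g i z))"
      by (simp only: diff_0 add_0_right symbols_sum)
  qed
qed

section \<open>Smooth bumps and mollification\<close>

lemma has_derivative_of_quadratic_remainder:
  fixes f :: "'a::real_normed_vector \<Rightarrow> real"
  assumes D: "bounded_linear D" and r: "\<And>h. \<bar>f (x + h) - f x - D h\<bar> \<le> K * (norm h)\<^sup>2"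
  shows "(f has_derivative D) (at x)"
  unfolding has_derivative_at
proof (intro conjI D)
  have "((\<lambda>h::'a. K * norm h) \<longlongrightarrow> K * norm (0::'a)) (at 0)"
    by (rule tendsto_mult_left[OF tendsto_norm[OF tendsto_ident_at]])
  then have lim: "((\<lambda>h::'a. K * norm h) \<longlongrightarrow> 0) (at 0)" by simp
  show "((\<lambda>h. norm (f (x + h) - f x - D h) / norm h) \<longlongrightarrow> 0) (at 0)"
  proof (rule tendsto_sandwich[OF _ _ tendsto_const lim])
    show "\<forall>\<^sub>F h in at 0. norm (f (x + h) - f x - D h) / norm h \<le> K * norm h"
      unfolding eventually_at_filter
    proof (intro always_eventually allI impI)
      fix h :: 'a assume "h \<noteq> 0"
      then show "norm (f (x + h) - f x - D h) / norm h \<le> K * norm h"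
        using r[of h] by (simp add: divide_le_eq power2_eq_square mult.assoc)
    qed
  qed auto
qed

text \<open>
  The functions \<open>t\<^sup>-\<^sup>k exp (- 1 / t)\<close>, extended by \<open>0\<close>, are bounded, and their derivatives are
  linear combinations of functions of the same kind.  So each of them is smooth with bounded derivatives.
\<close>

definition exp_flat :: "nat \<Rightarrow> real \<Rightarrow> real" where
  "exp_flat k t = (if t > 0 then (1 / t) ^ k * exp (- 1 / t) else 0)"

text \<open>
  With \<open>s = 1 / t\<close> this is \<open>(s / k)\<^sup>k \<le> exp s\<close>, the \<open>k\<close>-th power of \<open>s / k \<le> exp (s / k)\<close>.
\<close>

lemma exp_flat_bound: "\<bar>exp_flat k t\<bar> \<le> real k ^ k"
proof (cases "t > 0")
  case True
  define s where "s = 1 / t"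
  have s: "s > 0" using True by (simp add: s_def)
  have "s ^ k \<le> real k ^ k * exp s"
  proof (cases "k = 0")
    case False
    have "s / k \<le> exp (s / k)" using exp_ge_add_one_self[of "s / k"] by linarith
    then have "(s / k) ^ k \<le> exp (s / k) ^ k" using s by (intro power_mono) auto
    also have "\<dots> = exp s" using False by (simp add: exp_of_nat_mult[symmetric])
    finally show ?thesis using False by (simp add: power_divide field_simps)
  qed (use s in auto)
  then have "s ^ k * exp (- s) \<le> real k ^ k * exp s * exp (- s)" by (intro mult_right_mono) auto
  then show ?thesis using True s by (simp add: exp_flat_def s_def mult.assoc exp_minus_inverse exp_minus)
qed (simp add: exp_flat_def)

lemma exp_flat_nonneg: "exp_flat k t \<ge> 0"
  by (simp add: exp_flat_def)

text \<open>
  At \<open>t = 0\<close> the identity \<open>exp_flat k h = h\<^sup>2 exp_flat (k + 2) h\<close> and the boundedness of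
  \<open>exp_flat (k + 2)\<close> show that the function is \<open>O(h\<^sup>2)\<close>.
\<close>

lemma exp_flat_has_derivative:
  "(exp_flat k has_derivative (\<lambda>h. h * (exp_flat (k + 2) t - k * exp_flat (k + 1) t))) (at t)"
proof (cases "t = 0")
  case True
  have "\<bar>exp_flat k h\<bar> \<le> real (k + 2) ^ (k + 2) * h\<^sup>2" for h
  proof (cases "h > 0")
    case True
    then have "exp_flat k h = h\<^sup>2 * exp_flat (k + 2) h"
      by (simp add: exp_flat_def power_divide field_simps power2_eq_square)
    then show ?thesis using exp_flat_bound[of "k + 2" h]
      by (simp only: abs_mult power2_abs abs_power2 mult.commute[of "h\<^sup>2"] mult_right_mono zero_le_power2)
  qed (simp add: exp_flat_def)
  then have "(exp_flat k has_derivative (\<lambda>h. 0)) (at 0)"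
    by (intro has_derivative_of_quadratic_remainder[where K = "real (k + 2) ^ (k + 2)"])
      (auto simp: exp_flat_def)
  then show ?thesis using True by (simp add: exp_flat_def)
next
  case False
  show ?thesis
  proof (cases "t > 0")
    case True
    have "((\<lambda>t. (1 / t) ^ k * exp (- 1 / t)) has_derivative
        (\<lambda>h. h * (exp_flat (k + 2) t - k * exp_flat (k + 1) t))) (at t)"
      using True
      by (auto intro!: derivative_eq_intros simp: exp_flat_def fun_eq_iff)
        (cases k; simp add: field_simps power2_eq_square)
    then show ?thesis
      by (rule has_derivative_transform_within_open[of _ _ _ _ "{0<..}"])
        (use True in \<open>auto simp: exp_flat_def\<close>)
  next
    case neg: False
    have "((\<lambda>t. 0) has_derivative (\<lambda>h. h * (exp_flat (k + 2) t - k * exp_flat (k + 1) t))) (at t)"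
      using neg by (simp add: exp_flat_def)
    then show ?thesis
      by (rule has_derivative_transform_within_open[of _ _ _ _ "{..<0}"])
        (use neg False in \<open>auto simp: exp_flat_def\<close>)
  qed
qed

lemma exp_flat_smooth: "bounded_Ck k (exp_flat m)"
proof (induction k arbitrary: m)
  case 0
  have "continuous_on UNIV (exp_flat m)"
    using exp_flat_has_derivative[of m] by (auto simp: continuous_on_eq_continuous_at intro: has_derivative_continuous)
  then show ?case using exp_flat_bound by auto
next
  case (Suc k)
  show ?case
  proof (rule symbols_SucI)
    show "\<bar>exp_flat m z\<bar> \<le> real m ^ m * 1 powr 0" for z using exp_flat_bound by simp
    show "(exp_flat m has_derivative (\<lambda>h. h * (exp_flat (m + 2) z - m * exp_flat (m + 1) z))) (at z)" for z
      by (rule exp_flat_has_derivative)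
    have "bounded_Ck k (\<lambda>z. exp_flat (m + 2) z + (- m) * exp_flat (m + 1) z)"
      by (intro symbols_add symbols_cmult Suc) auto
    then show "b \<in> Basis \<Longrightarrow> symbols_upto (\<lambda>_. 1) (\<lambda>_. 0) k (0 - 0)
        (\<lambda>_::unit. \<lambda>z. b * (exp_flat (m + 2) z - m * exp_flat (m + 1) z))" for b by simp
  qed
qed

definition bump :: "real \<Rightarrow> 'a::euclidean_space \<Rightarrow> real" where
  "bump \<epsilon> z = (\<Prod>e\<in>Basis. exp_flat 0 (1 + z \<bullet> e / \<epsilon>) * exp_flat 0 (1 - z \<bullet> e / \<epsilon>))"

lemma bump_smooth: "bounded_Ck k (bump \<epsilon> :: 'a::euclidean_space \<Rightarrow> real)"
proof -
  have aff: "bounded_Ck k (\<lambda>z::'a. exp_flat 0 (1 + c * (z \<bullet> e)))" for c e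
    by (rule symbols_compose[OF exp_flat_smooth, where g' = "\<lambda>_ _ v. c * (v \<bullet> e)"])
      (auto intro!: derivative_eq_intros symbols_const[where K="\<bar>c * (_ \<bullet> e)\<bar>"])
  have "bounded_Ck k (\<lambda>z::'a. exp_flat 0 (1 + (1/\<epsilon>) * (z \<bullet> e)) * exp_flat 0 (1 + (- 1 / \<epsilon>) * (z \<bullet> e)))" for e
    using symbols_mult[OF aff aff, of "1/\<epsilon>" e "-1/\<epsilon>" e] by simp
  then have "bounded_Ck k (\<lambda>z::'a. \<Prod>e\<in>Basis.
     exp_flat 0 (1 + (1/\<epsilon>) * (z \<bullet> e)) * exp_flat 0 (1 + (- 1 / \<epsilon>) * (z \<bullet> e)))"
    by (intro symbols_prod) auto
  then show ?thesis by (simp add: bump_def[abs_def])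
qed

lemma bump_nonneg: "bump \<epsilon> z \<ge> 0"
  unfolding bump_def by (intro prod_nonneg ballI mult_nonneg_nonneg) (auto simp: exp_flat_nonneg)

lemma bump_support:
  fixes z :: "'a::euclidean_space"
  assumes "bump \<epsilon> z \<noteq> 0" "\<epsilon> > 0"
  shows "norm z \<le> real DIM('a) * \<epsilon>"
proof -
  have "\<bar>z \<bullet> e\<bar> \<le> \<epsilon>" if "e \<in> Basis" for e
  proof (rule ccontr)
    assume "\<not> ?thesis"
    then have "1 + z \<bullet> e / \<epsilon> \<le> 0 \<or> 1 - z \<bullet> e / \<epsilon> \<le> 0" using assms(2) by (auto simp: field_simps abs_if split: if_splits)
    then have "exp_flat 0 (1 + z \<bullet> e / \<epsilon>) * exp_flat 0 (1 - z \<bullet> e / \<epsilon>) = 0" by (auto simp: exp_flat_def)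
    then show False using assms(1) that by (auto simp: bump_def)
  qed
  then have "(\<Sum>e\<in>Basis. \<bar>z \<bullet> e\<bar>) \<le> (\<Sum>e\<in>(Basis::'a set). \<epsilon>)" by (intro sum_mono)
  then show ?thesis using norm_le_l1[of z] by simp
qed

lemma bump_pos: "\<exists>c>0. \<forall>z::'a::euclidean_space. norm z \<le> \<epsilon> / 2 \<longrightarrow> bump \<epsilon> z \<ge> c" if "\<epsilon> > 0"
proof (intro exI[of _ "\<Prod>e\<in>(Basis::'a set). exp (- 2) * exp (- 2)"] conjI allI impI prod_pos)
  fix z :: 'a assume z: "norm z \<le> \<epsilon> / 2"
  have ge: "exp (- 2) \<le> exp_flat 0 t" if "t \<ge> 1/2" for t
    using that by (simp add: exp_flat_def field_simps)
  have "1/2 \<le> 1 + z \<bullet> e / \<epsilon>" "1/2 \<le> 1 - z \<bullet> e / \<epsilon>" if "e \<in> Basis" for e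
  proof -
    have "\<bar>z \<bullet> e / \<epsilon>\<bar> \<le> 1 / 2"
      using Basis_le_norm[OF that, of z] z \<open>\<epsilon> > 0\<close> by (simp add: field_simps)
    then show "1/2 \<le> 1 + z \<bullet> e / \<epsilon>" "1/2 \<le> 1 - z \<bullet> e / \<epsilon>" by linarith+
  qed
  then show "bump \<epsilon> z \<ge> (\<Prod>e\<in>(Basis::'a set). exp (- 2) * exp (- 2))"
    unfolding bump_def by (intro prod_mono conjI mult_mono ge) (auto simp: exp_flat_nonneg)
qed auto

lemma abs_dir_deriv_le:
  fixes f :: "'a::euclidean_space \<Rightarrow> real"
  assumes d: "f differentiable (at x)" and b: "\<And>e. e \<in> Basis \<Longrightarrow> \<bar>dir_deriv e f x\<bar> \<le> K"
  shows "\<bar>dir_deriv v f x\<bar> \<le> real DIM('a) * K * norm v"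
proof -
  have "\<bar>dir_deriv v f x\<bar> \<le> (\<Sum>e\<in>Basis. \<bar>(v \<bullet> e) * dir_deriv e f x\<bar>)"
    by (subst dir_deriv_expand[OF d]) (rule sum_abs)
  also have "\<dots> \<le> (\<Sum>e\<in>(Basis::'a set). norm v * K)"
    by (intro sum_mono) (auto simp: abs_mult intro!: mult_mono Basis_le_norm b)
  finally show ?thesis by (simp add: mult_ac)
qed

lemma bounded_Ck_lipschitz:
  fixes f :: "'a::euclidean_space \<Rightarrow> real"
  assumes d: "\<And>x. f differentiable (at x)" and b: "\<And>e x. e \<in> Basis \<Longrightarrow> \<bar>dir_deriv e f x\<bar> \<le> K"
  shows "\<bar>f x - f y\<bar> \<le> (real DIM('a) * K) * norm (x - y)"
proof -
  have "norm (f x - f y) \<le> (real DIM('a) * K) * norm (x - y)"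
  proof (rule differentiable_bound[OF convex_UNIV])
    show "(f has_derivative (\<lambda>v. dir_deriv v f z)) (at z within UNIV)" for z
      using has_derivative_dir_deriv[OF d] by simp
    show "onorm (\<lambda>v. dir_deriv v f z) \<le> real DIM('a) * K" for z
    proof (rule onorm_bound)
      have "0 \<le> K" using b[OF SOME_Basis, of z] by linarith
      then show "0 \<le> real DIM('a) * K" by simp
      show "norm (dir_deriv v f z) \<le> real DIM('a) * K * norm v" for v
        using abs_dir_deriv_le[OF d b] by simp
    qed
  qed auto
  then show ?thesis by simp
qed

lemma bounded_C2_taylor:
  fixes f :: "'a::euclidean_space \<Rightarrow> real"
  assumes "bounded_Ck 2 f"
  shows "\<exists>K. \<forall>y h. \<bar>f (y + h) - f y - (\<Sum>b\<in>Basis. (h \<bullet> b) * dir_deriv b f y)\<bar> \<le> K * (norm h)\<^sup>2"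
proof -
  have d: "f differentiable (at x)" for x using assms by (simp add: numeral_2_eq_2)
  have "\<exists>K\<ge>0. \<forall>e\<in>Basis. \<forall>x. \<bar>dir_deriv e (dir_deriv b f) x\<bar> \<le> K" if "b \<in> Basis" for b
    using symbols_dir_deriv_bound[of "\<lambda>_. 1" "\<lambda>_. 0" 0 "\<lambda>_::unit. dir_deriv b f"] assms that
    by (simp add: numeral_2_eq_2)
  then have "\<forall>b. \<exists>K. b \<in> Basis \<longrightarrow> K \<ge> 0 \<and> (\<forall>e\<in>Basis. \<forall>x. \<bar>dir_deriv e (dir_deriv b f) x\<bar> \<le> K)" by blast
  then obtain K where K: "\<And>b. b \<in> Basis \<Longrightarrow> K b \<ge> 0 \<and> (\<forall>e\<in>Basis. \<forall>x. \<bar>dir_deriv e (dir_deriv b f) x\<bar> \<le> K b)" by metis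
  have dd: "b \<in> Basis \<Longrightarrow> dir_deriv b f differentiable (at x)" for b x using assms by (simp add: numeral_2_eq_2)
  have lip: "\<bar>dir_deriv b f x - dir_deriv b f y\<bar> \<le> (real DIM('a) * K b) * norm (x - y)" if "b \<in> Basis" for b x y
    by (rule bounded_Ck_lipschitz) (use dd K[OF that] that in auto)
  define M where "M = (\<Sum>b\<in>(Basis::'a set). real DIM('a) * K b)"
  have M: "0 \<le> real DIM('a) * K b" if "b \<in> Basis" for b using K[OF that] by simp
  show ?thesis
  proof (intro exI[of _ M] allI)
    fix y h
    let ?g = "\<lambda>x. f x - (\<Sum>b\<in>Basis. (x \<bullet> b) * dir_deriv b f y)"
    have "norm (?g (y + h) - ?g y) \<le> (M * norm h) * norm (y + h - y)"
    proof (rule differentiable_bound[OF convex_cball[of y "norm h"]])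
      fix x assume x: "x \<in> cball y (norm h)"
      have "(?g has_derivative (\<lambda>v. dir_deriv v f x - (\<Sum>b\<in>Basis. (v \<bullet> b) * dir_deriv b f y)))
          (at x within cball y (norm h))"
        by (intro derivative_intros has_derivative_at_withinI[OF has_derivative_dir_deriv[OF d]])
      moreover have "dir_deriv v f x - (\<Sum>b\<in>Basis. (v \<bullet> b) * dir_deriv b f y)
          = (\<Sum>b\<in>Basis. (v \<bullet> b) * (dir_deriv b f x - dir_deriv b f y))" for v
        by (subst dir_deriv_expand[OF d]) (simp add: right_diff_distrib sum_subtractf)
      ultimately show "(?g has_derivative (\<lambda>v. \<Sum>b\<in>Basis. (v \<bullet> b) * (dir_deriv b f x - dir_deriv b f y)))
          (at x within cball y (norm h))" by simp
      show "onorm (\<lambda>v. \<Sum>b\<in>Basis. (v \<bullet> b) * (dir_deriv b f x - dir_deriv b f y)) \<le> M * norm h"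
      proof (rule onorm_bound)
        show "0 \<le> M * norm h" unfolding M_def using M by (intro mult_nonneg_nonneg[OF sum_nonneg]) auto
        fix v :: 'a
        have "norm (\<Sum>b\<in>Basis. (v \<bullet> b) * (dir_deriv b f x - dir_deriv b f y))
            \<le> (\<Sum>b\<in>Basis. \<bar>(v \<bullet> b) * (dir_deriv b f x - dir_deriv b f y)\<bar>)"
          by (simp add: sum_abs)
        also have "\<dots> \<le> (\<Sum>b\<in>Basis. norm v * ((real DIM('a) * K b) * norm h))"
        proof (intro sum_mono)
          fix b :: 'a assume b: "b \<in> Basis"
          have "\<bar>dir_deriv b f x - dir_deriv b f y\<bar> \<le> (real DIM('a) * K b) * norm h"
            by (rule order_trans[OF lip[OF b] mult_left_mono])
              (use x M[OF b] in \<open>auto simp: dist_norm norm_minus_commute\<close>)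
          then show "\<bar>(v \<bullet> b) * (dir_deriv b f x - dir_deriv b f y)\<bar> \<le> norm v * ((real DIM('a) * K b) * norm h)"
            unfolding abs_mult by (intro mult_mono Basis_le_norm b) auto
        qed
        also have "\<dots> = M * norm h * norm v" by (simp add: M_def sum_distrib_right sum_distrib_left mult_ac)
        finally show "norm (\<Sum>b\<in>Basis. (v \<bullet> b) * (dir_deriv b f x - dir_deriv b f y)) \<le> M * norm h * norm v" .
      qed
    qed (auto simp: dist_norm)
    then show "\<bar>f (y + h) - f y - (\<Sum>b\<in>Basis. (h \<bullet> b) * dir_deriv b f y)\<bar> \<le> M * (norm h)\<^sup>2"
      by (simp add: inner_add_left distrib_right sum.distrib power2_eq_square algebra_simps)
  qed
qed

definition convolution :: "('a::euclidean_space \<Rightarrow> real) \<Rightarrow> ('a \<Rightarrow> real) \<Rightarrow> 'a \<Rightarrow> real" where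
  "convolution f \<phi> z = (LINT w|lborel. f w * \<phi> (z - w))"

lemma convolution_integrable:
  assumes f: "integrable lborel f" and \<phi>: "bounded_Ck k \<phi>"
  shows "integrable lborel (\<lambda>w. f w * \<phi> (z - w))"
proof -
  obtain K where K: "\<forall>x. \<bar>\<phi> x\<bar> \<le> K" using symbols_bound[OF \<phi>] by auto
  have c: "continuous_on UNIV (\<lambda>w. \<phi> (z - w))"
    by (rule continuous_on_compose2[OF symbols_continuous[OF \<phi>]]) (auto intro!: continuous_intros)
  have [measurable]: "(\<lambda>w. \<phi> (z - w)) \<in> borel_measurable borel"
    by (rule borel_measurable_continuous_onI[OF c])
  show ?thesis
  proof (rule Bochner_Integration.integrable_bound[where f = "\<lambda>w. K * f w"])
    show "integrable lborel (\<lambda>w. K * f w)" using f by simp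
    show "(\<lambda>w. f w * \<phi> (z - w)) \<in> borel_measurable lborel" using f by measurable
    show "AE w in lborel. norm (f w * \<phi> (z - w)) \<le> norm (K * f w)"
    proof (intro AE_I2)
      fix w
      have "\<bar>\<phi> (z - w)\<bar> \<le> \<bar>K\<bar>" using K[rule_format, of "z - w"] by linarith
      then show "norm (f w * \<phi> (z - w)) \<le> norm (K * f w)"
        by (simp add: abs_mult mult.commute[of "\<bar>K\<bar>"] mult_left_mono)
    qed
  qed
qed

lemma convolution_bounded:
  assumes f: "integrable lborel f" and \<phi>: "bounded_Ck k \<phi>"
  shows "\<exists>K. \<forall>z. \<bar>convolution f \<phi> z\<bar> \<le> K"
proof -
  obtain K where K: "\<forall>x. \<bar>\<phi> x\<bar> \<le> K" using symbols_bound[OF \<phi>] by auto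
  have "\<bar>convolution f \<phi> z\<bar> \<le> (LINT w|lborel. \<bar>f w\<bar> * K)" for z
    unfolding convolution_def
  proof (rule integral_abs_bound[THEN order_trans], rule integral_mono)
    show "\<bar>f w * \<phi> (z - w)\<bar> \<le> \<bar>f w\<bar> * K" for w using K by (simp add: abs_mult mult_left_mono)
  qed (use f convolution_integrable[OF f \<phi>] in auto)
  then show ?thesis by blast
qed

text \<open>
  The second order Taylor remainder of \<open>\<phi>\<close> is bounded uniformly in the base point, so it can be integrated
  against \<open>f\<close>; no regularity of \<open>f\<close> is involved.
\<close>

lemma convolution_has_derivative:
  assumes f: "integrable lborel f" and \<phi>: "bounded_Ck 2 \<phi>"
  shows "(convolution f \<phi> has_derivative
     (\<lambda>v. \<Sum>b\<in>Basis. (v \<bullet> b) * convolution f (dir_deriv b \<phi>) z)) (at z)"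
proof -
  obtain K where K: "\<And>y h. \<bar>\<phi> (y + h) - \<phi> y - (\<Sum>b\<in>Basis. (h \<bullet> b) * dir_deriv b \<phi> y)\<bar> \<le> K * (norm h)\<^sup>2"
    using bounded_C2_taylor[OF \<phi>] by blast
  have d: "bounded_Ck 1 (dir_deriv b \<phi>)" if "b \<in> Basis" for b
    using \<phi> that by (simp add: numeral_2_eq_2)
  have I0: "integrable lborel (\<lambda>w. f w * \<phi> (y - w))" for y
    by (rule convolution_integrable[OF f \<phi>])
  have I1: "integrable lborel (\<lambda>w. (h \<bullet> b) * (f w * dir_deriv b \<phi> (y - w)))" if "b \<in> Basis" for b h y
    by (intro integrable_mult_right convolution_integrable[OF f d[OF that]])
  have Is: "integrable lborel (\<lambda>w. \<Sum>b\<in>Basis. (h \<bullet> b) * (f w * dir_deriv b \<phi> (y - w)))" for h y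
    by (rule Bochner_Integration.integrable_sum[OF I1])
  show ?thesis
  proof (rule has_derivative_of_quadratic_remainder[where K = "K * (LINT w|lborel. \<bar>f w\<bar>)"])
    show "bounded_linear (\<lambda>v. \<Sum>b\<in>Basis. (v \<bullet> b) * convolution f (dir_deriv b \<phi>) z)"
      by (intro bounded_linear_intros)
    fix h
    have "convolution f \<phi> (z + h) - convolution f \<phi> z -
        (\<Sum>b\<in>Basis. (h \<bullet> b) * convolution f (dir_deriv b \<phi>) z)
      = (LINT w|lborel. f w * \<phi> (z + h - w) - f w * \<phi> (z - w) -
          (\<Sum>b\<in>Basis. (h \<bullet> b) * (f w * dir_deriv b \<phi> (z - w))))"
    proof -
      have "(LINT w|lborel. (\<Sum>b\<in>Basis. (h \<bullet> b) * (f w * dir_deriv b \<phi> (z - w))))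
          = (\<Sum>b\<in>Basis. (h \<bullet> b) * convolution f (dir_deriv b \<phi>) z)"
        unfolding convolution_def by (subst Bochner_Integration.integral_sum[OF I1]) auto
      then show ?thesis
        unfolding convolution_def[of f \<phi>]
          Bochner_Integration.integral_diff[OF Bochner_Integration.integrable_diff[OF I0 I0] Is]
          Bochner_Integration.integral_diff[OF I0 I0] by simp
    qed
    also have "\<bar>\<dots>\<bar> \<le> (LINT w|lborel. \<bar>f w\<bar> * (K * (norm h)\<^sup>2))"
    proof (rule integral_abs_bound[THEN order_trans], rule integral_mono)
      show "integrable lborel (\<lambda>w. \<bar>f w * \<phi> (z + h - w) - f w * \<phi> (z - w) -
          (\<Sum>b\<in>Basis. (h \<bullet> b) * (f w * dir_deriv b \<phi> (z - w)))\<bar>)"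
        by (intro integrable_abs Bochner_Integration.integrable_diff I0 Is)
      show "integrable lborel (\<lambda>w. \<bar>f w\<bar> * (K * (norm h)\<^sup>2))" using f by simp
      fix w
      have "f w * \<phi> (z + h - w) - f w * \<phi> (z - w) - (\<Sum>b\<in>Basis. (h \<bullet> b) * (f w * dir_deriv b \<phi> (z - w)))
         = f w * (\<phi> ((z - w) + h) - \<phi> (z - w) - (\<Sum>b\<in>Basis. (h \<bullet> b) * dir_deriv b \<phi> (z - w)))"
        by (simp add: algebra_simps sum_distrib_left)
      then show "\<bar>f w * \<phi> (z + h - w) - f w * \<phi> (z - w) - (\<Sum>b\<in>Basis. (h \<bullet> b) * (f w * dir_deriv b \<phi> (z - w)))\<bar>
          \<le> \<bar>f w\<bar> * (K * (norm h)\<^sup>2)"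
        using K[of "z - w" h] by (simp add: abs_mult mult_left_mono)
    qed
    also have "\<dots> = K * (LINT w|lborel. \<bar>f w\<bar>) * (norm h)\<^sup>2" by simp
    finally show "\<bar>convolution f \<phi> (z + h) - convolution f \<phi> z -
        (\<Sum>b\<in>Basis. (h \<bullet> b) * convolution f (dir_deriv b \<phi>) z)\<bar> \<le> K * (LINT w|lborel. \<bar>f w\<bar>) * (norm h)\<^sup>2" .
  qed
qed

lemma convolution_smooth:
  assumes f: "integrable lborel f"
  shows "bounded_Ck (k + 2) \<phi> \<Longrightarrow> bounded_Ck k (convolution f \<phi>)"
proof (induction k arbitrary: \<phi>)
  case 0
  have "continuous_on UNIV (convolution f \<phi>)"
    using convolution_has_derivative[OF f, of \<phi>] 0
    by (auto simp: continuous_on_eq_continuous_at numeral_2_eq_2 intro!: has_derivative_continuous)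
  then show ?case using convolution_bounded[OF f 0] by simp
next
  case (Suc k)
  have 2: "bounded_Ck 2 \<phi>" by (rule symbols_mono[OF Suc.prems]) simp
  obtain K where K: "\<forall>z. \<bar>convolution f \<phi> z\<bar> \<le> K" using convolution_bounded[OF f 2] by blast
  show ?case
  proof (rule symbols_SucI[OF _ convolution_has_derivative[OF f 2]])
    show "\<bar>convolution f \<phi> z\<bar> \<le> K * 1 powr 0" for z using K by simp
    fix b :: 'a assume b: "b \<in> Basis"
    have "(\<Sum>e\<in>Basis. (b \<bullet> e) * convolution f (dir_deriv e \<phi>) z) = convolution f (dir_deriv b \<phi>) z" for z
    proof -
      have "(b \<bullet> e) * convolution f (dir_deriv e \<phi>) z = (if b = e then convolution f (dir_deriv b \<phi>) z else 0)"
        if "e \<in> Basis" for e using b that by (simp add: inner_Basis)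
      then show ?thesis using b by (simp cong: sum.cong)
    qed
    moreover have "bounded_Ck k (convolution f (dir_deriv b \<phi>))"
      by (rule Suc.IH) (use Suc.prems b in simp)
    ultimately show "symbols_upto (\<lambda>_. 1) (\<lambda>_. 0) k (0 - 0) (\<lambda>_::unit. \<lambda>z. \<Sum>e\<in>Basis. (b \<bullet> e) * convolution f (dir_deriv e \<phi>) z)"
      by simp
  qed
qed

lemma lborel_integral_reflect:
  fixes g :: "'a::euclidean_space \<Rightarrow> real"
  assumes [measurable]: "g \<in> borel_measurable borel"
  shows "(LINT w|lborel. g w) = (LINT u|lborel. g (z - u))"
proof -
  have "(LINT w|lborel. g w) = (LINT w|distr lborel borel (\<lambda>x. z + (-1) *\<^sub>R x). g w)"
    by (subst lborel_affine[of "-1" z]) (auto simp: density_1)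
  also have "\<dots> = (LINT u|lborel. g (z - u))" by (subst integral_distr) auto
  finally show ?thesis .
qed

lemma lborel_integrable_reflect:
  fixes g :: "'a::euclidean_space \<Rightarrow> real"
  assumes "integrable lborel g"
  shows "integrable lborel (\<lambda>u. g (z - u))"
proof -
  have [measurable]: "g \<in> borel_measurable borel" using assms by auto
  have "integrable (distr lborel borel (\<lambda>x. z + (-1) *\<^sub>R x)) g"
    using assms by (subst (asm) lborel_affine[of "-1" z]) (auto simp: density_1)
  then show ?thesis by (subst (asm) integrable_distr_eq) auto
qed

text \<open>
  Convolution with a bump of total mass \<open>1\<close> supported in the ball of radius \<open>\<epsilon>\<close> averages difference
  quotients.  A lower bound \<open>G - K h\<close> for those of \<open>f\<close>, in one common direction \<open>v\<close> at all points of
  that ball around \<open>z\<close>, is therefore inherited, and gives a lower bound for the derivative as \<open>h\<close> tends to \<open>0\<close>.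
\<close>

lemma mollification:
  fixes f :: "'a::euclidean_space \<Rightarrow> real"
  assumes f: "integrable lborel f" and \<epsilon>: "\<epsilon> > 0"
  obtains F where "\<And>k. bounded_Ck k F"
    "\<And>z v G K h\<^sub>0. h\<^sub>0 > 0 \<Longrightarrow>
      (\<And>h u. 0 < h \<Longrightarrow> h < h\<^sub>0 \<Longrightarrow> norm u \<le> \<epsilon> \<Longrightarrow>
         f (z + h *\<^sub>R v - u) - f (z - u) \<ge> h * G - K * h\<^sup>2) \<Longrightarrow>
      dir_deriv v F z \<ge> G"
proof -
  \<comment> \<open>The support of the bump is a cube, which has to fit into the ball of radius \<open>\<epsilon>\<close>.\<close>
  define \<delta> where "\<delta> = \<epsilon> / DIM('a)"
  have \<delta>: "\<delta> > 0" using \<epsilon> by (simp add: \<delta>_def)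
  let ?\<phi> = "bump \<delta> :: 'a \<Rightarrow> real"
  have supp: "norm u \<le> \<epsilon>" if "?\<phi> u \<noteq> 0" for u
    using bump_support[OF that \<delta>] by (simp add: \<delta>_def)
  have [measurable]: "?\<phi> \<in> borel_measurable borel" "f \<in> borel_measurable borel"
    using borel_measurable_continuous_onI[OF symbols_continuous[OF bump_smooth]] f by auto
  have I\<phi>: "integrable lborel ?\<phi>"
  proof -
    have "integrable lborel (\<lambda>u::'a. indicator (cball 0 \<epsilon>) u *\<^sub>R ?\<phi> u)"
      by (rule borel_integrable_compact[OF compact_cball
            continuous_on_subset[OF symbols_continuous[OF bump_smooth]]]) simp
    moreover have "(\<lambda>u::'a. indicator (cball 0 \<epsilon>) u *\<^sub>R ?\<phi> u) = ?\<phi>"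
      using supp by (auto simp: fun_eq_iff indicator_def)
    ultimately show ?thesis by simp
  qed
  define J where "J = (LINT u|lborel. ?\<phi> u)"
  have J: "J > 0"
  proof -
    obtain c where c: "c > 0" "\<And>z::'a. norm z \<le> \<delta> / 2 \<Longrightarrow> ?\<phi> z \<ge> c" using bump_pos[OF \<delta>] by auto
    have "c * measure lborel (ball (0::'a) (\<delta>/2)) = (LINT u|lborel. c * indicator (ball (0::'a) (\<delta>/2)) u)"
      by simp
    also have "\<dots> \<le> J" unfolding J_def
    proof (rule integral_mono[OF _ I\<phi>])
      show "integrable lborel (\<lambda>u::'a. c * indicator (ball 0 (\<delta>/2)) u)"
        by (intro integrable_mult_right integrable_real_indicator emeasure_bounded_finite[OF bounded_ball]) simp
    qed (use c(2) bump_nonneg in \<open>auto simp: indicator_def\<close>)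
    finally have "c * measure lborel (ball (0::'a) (\<delta>/2)) \<le> J" .
    moreover have "0 < c * measure lborel (ball (0::'a) (\<delta>/2))"
      using content_ball_pos[of "\<delta>/2" "0::'a"] c(1) \<delta> by simp
    ultimately show ?thesis by linarith
  qed
  define F where "F = (\<lambda>z. (1 / J) * convolution f ?\<phi> z)"
  have smooth: "bounded_Ck k F" for k
    unfolding F_def by (rule symbols_cmult[OF convolution_smooth[OF f bump_smooth]]) simp
  have conv: "convolution f ?\<phi> z = (LINT u|lborel. f (z - u) * ?\<phi> u)" for z
    using lborel_integral_reflect[of "\<lambda>w. f w * ?\<phi> (z - w)" z] by (simp add: convolution_def)
  have Iconv: "integrable lborel (\<lambda>u. f (z - u) * ?\<phi> u)" for z
  proof -
    have "integrable lborel (\<lambda>w. f w * ?\<phi> (z - w))" by (rule convolution_integrable[OF f bump_smooth])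
    from lborel_integrable_reflect[OF this, of z] show ?thesis by simp
  qed
  show ?thesis
  proof (rule that[OF smooth])
    fix z v G K h\<^sub>0
    assume h0: "(0::real) < h\<^sub>0" and lower: "\<And>h u. 0 < h \<Longrightarrow> h < h\<^sub>0 \<Longrightarrow> norm u \<le> \<epsilon> \<Longrightarrow>
         f (z + h *\<^sub>R v - u) - f (z - u) \<ge> h * G - K * h\<^sup>2"
    have quot: "G - K * h \<le> (F (z + h *\<^sub>R v) - F z) / h" if h: "0 < h" "h < h\<^sub>0" for h
    proof -
      have "(h * G - K * h\<^sup>2) * J = (LINT u|lborel. (h * G - K * h\<^sup>2) * ?\<phi> u)"
        by (simp add: J_def)
      also have "\<dots> \<le> (LINT u|lborel. f (z + h *\<^sub>R v - u) * ?\<phi> u - f (z - u) * ?\<phi> u)"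
      proof (rule integral_mono)
        fix u
        show "(h * G - K * h\<^sup>2) * ?\<phi> u \<le> f (z + h *\<^sub>R v - u) * ?\<phi> u - f (z - u) * ?\<phi> u"
        proof (cases "?\<phi> u = 0")
          case False
          then show ?thesis using mult_right_mono[OF lower[OF h supp] bump_nonneg[of \<delta> u]]
            by (simp add: left_diff_distrib)
        qed simp
      qed (use I\<phi> Iconv in auto)
      also have "\<dots> = J * (F (z + h *\<^sub>R v) - F z)"
        using J Iconv by (simp add: F_def conv right_diff_distrib)
      finally have "h * G - K * h\<^sup>2 \<le> F (z + h *\<^sub>R v) - F z" using J by (simp add: mult.commute)
      then show ?thesis using h by (simp add: field_simps power2_eq_square)
    qed
    have dF: "(F has_derivative (\<lambda>v. dir_deriv v F z)) (at z)"
      using smooth[of 1] by (intro has_derivative_dir_deriv) simp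
    have "((\<lambda>h. z + h *\<^sub>R v) has_derivative (\<lambda>h. h *\<^sub>R v)) (at 0)"
      by (auto intro!: derivative_eq_intros)
    from has_derivative_compose[OF this, of F "\<lambda>v. dir_deriv v F z"] dF
    have "((\<lambda>h. F (z + h *\<^sub>R v)) has_derivative (\<lambda>h. dir_deriv (h *\<^sub>R v) F z)) (at 0)" by simp
    moreover have "(\<lambda>h. dir_deriv (h *\<^sub>R v) F z) = (\<lambda>h. h * dir_deriv v F z)"
      using linear_scale[OF has_derivative_linear[OF dF]] by auto
    ultimately have "((\<lambda>h. F (z + h *\<^sub>R v)) has_real_derivative dir_deriv v F z) (at 0)"
      by (simp add: has_field_derivative_def mult_commute_abs)
    then have "((\<lambda>h. (F (z + h *\<^sub>R v) - F z) / h) \<longlongrightarrow> dir_deriv v F z) (at 0)"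
      by (simp add: DERIV_def)
    then have "((\<lambda>h. (F (z + h *\<^sub>R v) - F z) / h) \<longlongrightarrow> dir_deriv v F z) (at_right 0)"
      by (rule tendsto_mono[OF at_le[OF subset_UNIV]])
    moreover have "((\<lambda>h. G - K * h) \<longlongrightarrow> G - K * 0) (at_right (0::real))" by (intro tendsto_intros)
    moreover have "\<forall>\<^sub>F h in at_right 0. G - K * h \<le> (F (z + h *\<^sub>R v) - F z) / h"
      unfolding eventually_at_right_field using h0 quot by auto
    ultimately show "G \<le> dir_deriv v F z"
      by (auto dest: tendsto_le[OF trivial_limit_at_right_real])
  qed
qed

section \<open>Japanese brackets and symbols on phase space\<close>

lemma jb_ge1: "jb x \<ge> 1"
  by (simp add: jb_def)

lemma jb_gt0: "jb x > 0"
  using jb_ge1[of x] by linarith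

lemma jb_square: "(jb x)\<^sup>2 = 1 + (norm x)\<^sup>2"
  by (simp add: jb_def add_nonneg_nonneg)

lemma norm_le_jb: "norm x \<le> jb x"
  unfolding jb_def by (rule real_le_rsqrt) simp

lemma norm_div_jb: "norm x / jb x \<le> 1"
  using norm_le_jb[of x] jb_gt0[of x] by simp

subsection \<open>phase space symbols\<close>

abbreviation phase_symbols :: "nat \<Rightarrow> real \<Rightarrow> ('i \<Rightarrow> 'n::finite phase \<Rightarrow> real) \<Rightarrow> bool" where
  "phase_symbols \<equiv> symbols_upto (\<lambda>z. jb (snd z)) (\<lambda>b. norm (snd b))"

lemma Basis_phase: "(Basis :: 'n::finite phase set) = range ex \<union> range e\<xi>"
  by (auto simp: Basis_prod_def Basis_vec_def ex_def e\<xi>_def)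

text \<open>
  The uniform bounds over the family become bounds for the seminorms that do not depend on the index.
\<close>

lemma symbol_classI:
  fixes p :: "'i \<Rightarrow> 'n::finite phase \<Rightarrow> real"
  assumes "\<And>k. phase_symbols k 0 p"
  shows "p i \<in> symbol_class 0"
    and "\<exists>K. \<forall>i. symbol_seminorm 0 \<alpha> \<beta> (p i) \<le> K"
proof -
  have "\<exists>K. \<forall>i z. symbol_quotient 0 \<alpha> \<beta> (p i) z \<le> K" for \<alpha> \<beta>
  proof -
    let ?vs = "map ex \<alpha> @ map e\<xi> \<beta> :: 'n phase list"
    have vs: "set ?vs \<subseteq> Basis" unfolding Basis_phase by auto
    have "sum_list (map (\<lambda>b. norm (snd b)) ?vs) = real (length \<beta>)"
      by (simp add: ex_def e\<xi>_def comp_def sum_list_triv)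
    then have "phase_symbols 0 (0 - real (length \<beta>)) (\<lambda>i. dir_derivs ?vs (p i))"
      using symbols_dir_derivs[OF vs assms] by metis
    from symbols_bound[OF this] obtain K where
      K: "\<forall>i z. \<bar>dir_derivs ?vs (p i) z\<bar> \<le> K * jb (snd z) powr (0 - real (length \<beta>))" by blast
    have "symbol_quotient 0 \<alpha> \<beta> (p i) z \<le> K" for i z
      unfolding symbol_quotient_def
      using K[rule_format, of i z] jb_gt0[of "snd z"] by (subst pos_divide_le_eq) auto
    then show ?thesis by blast
  qed
  note bound = this
  have "C_class k (p i)" for k i
    unfolding C_class_def
  proof (intro allI impI conjI)
    fix vs :: "'n phase list" and x
    assume vs: "set vs \<subseteq> Basis"
    show "dir_derivs vs (p i) differentiable (at x)"
      by (rule symbols_differentiable[OF symbols_dir_derivs[OF vs assms]])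
    show "continuous_on UNIV (dir_derivs vs (p i))"
      using symbols_continuous[OF symbols_dir_derivs[OF vs assms, of 0]] .
  qed
  moreover have "bdd_above (range (symbol_quotient 0 \<alpha> \<beta> (p i)))" for \<alpha> \<beta> i
    using bound[of \<alpha> \<beta>] by (auto simp: bdd_above_def)
  ultimately show "p i \<in> symbol_class 0" by (simp add: symbol_class_def)
  obtain K where "\<forall>i z. symbol_quotient 0 \<alpha> \<beta> (p i) z \<le> K" using bound by blast
  then have "symbol_seminorm 0 \<alpha> \<beta> (p i) \<le> K" for i
    unfolding symbol_seminorm_def by (intro cSUP_least) auto
  then show "\<exists>K. \<forall>i. symbol_seminorm 0 \<alpha> \<beta> (p i) \<le> K" by blast
qed

lemma jb_has_derivative:
  assumes "(g has_derivative g') (at z)"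
  shows "((\<lambda>z. jb (g z)) has_derivative (\<lambda>v. (g z \<bullet> g' v) / jb (g z))) (at z)"
proof -
  have A: "((\<lambda>z. 1 + g z \<bullet> g z) has_derivative (\<lambda>v. 2 * (g z \<bullet> g' v))) (at z)"
    using assms by (auto intro!: derivative_eq_intros simp: inner_commute)
  have "1 + g z \<bullet> g z > 0" by (simp add: add_pos_nonneg)
  note D = DERIV_real_sqrt[OF this, unfolded has_field_derivative_def]
  have "((\<lambda>z. sqrt (1 + g z \<bullet> g z)) has_derivative
      (\<lambda>v. inverse (sqrt (1 + g z \<bullet> g z)) / 2 * (2 * (g z \<bullet> g' v)))) (at z)"
    using has_derivative_compose[OF A D] .
  moreover have "inverse S / 2 * (2 * t) = t / S" for S t :: real by (simp add: field_simps)
  ultimately have "((\<lambda>z. sqrt (1 + g z \<bullet> g z)) has_derivative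
      (\<lambda>v. (g z \<bullet> g' v) / sqrt (1 + g z \<bullet> g z))) (at z)" by (simp only:)
  then show ?thesis unfolding jb_def power2_norm_eq_inner .
qed

lemma inverse_jb_has_derivative:
  assumes "(g has_derivative g') (at z)"
  shows "((\<lambda>z. 1 / jb (g z)) has_derivative (\<lambda>v. - (g z \<bullet> g' v) / (jb (g z)) ^ 3)) (at z)"
  using jb_gt0[of "g z"]
  by (auto intro!: derivative_eq_intros jb_has_derivative[OF assms] simp: fun_eq_iff field_simps power2_eq_square power3_eq_cube)

text \<open>
  With \<open>u = g / \<langle>g\<rangle>\<close> and \<open>s = 1 / \<langle>g\<rangle>\<close>, the derivatives of \<open>u\<close> and \<open>s\<close> are \<open>s\<close> times polynomials in
  \<open>u\<close> and \<open>s\<close> with bounded coefficients, as \<open>g\<close> is affine.  So the two assertions are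
  proved together by induction on the number of derivatives.
  The case \<open>g (x, \<xi>) = \<xi>\<close> with \<open>e = 1\<close> gives symbols that improve under \<open>\<xi>\<close>-derivatives; the case
  \<open>g (x, \<xi>) = r (x - c)\<close> with \<open>e = 0\<close> gives bounds that are uniform in the center \<open>c\<close>.
\<close>

lemma bracket_symbols:
  fixes g :: "'i \<Rightarrow> 'a::euclidean_space \<Rightarrow> real ^ 'n"
  assumes g: "\<And>i z. (g i has_derivative L i) (at z)"
    and K: "\<And>i b. b \<in> Basis \<Longrightarrow> norm (L i b) \<le> K"
    and ord: "\<And>b. b \<in> Basis \<Longrightarrow> (\<forall>i. L i b = 0) \<or> d b = e"
    and w: "\<And>z. w z > 0"
    and inv: "\<And>i z. 1 / jb (g i z) \<le> K' * w z powr (- e)"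
  shows "symbols_upto w d k 0 (\<lambda>i z. g i z $ j / jb (g i z))"
    and "symbols_upto w d k (- e) (\<lambda>i z. 1 / jb (g i z))"
proof -
  let ?u = "\<lambda>j i z. g i z $ j / jb (g i z)" and ?s = "\<lambda>i z. 1 / jb (g i z)"
  have u_le: "\<bar>?u j i z\<bar> \<le> 1 * w z powr 0" for j i z
  proof -
    have "\<bar>g i z $ j\<bar> \<le> norm (g i z)" by (rule component_le_norm_cart)
    also have "\<dots> \<le> jb (g i z)" unfolding jb_def by (rule real_le_rsqrt) simp
    finally show ?thesis using jb_gt0[of "g i z"] w[of z] by (simp add: field_simps abs_le_iff)
  qed
  have s_le: "\<bar>?s i z\<bar> \<le> K' * w z powr (- e)" for i z
    using inv[of i z] jb_gt0[of "g i z"] by simp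
  have ds: "(?s i has_derivative (\<lambda>v. - ?s i z * (?s i z * (\<Sum>k\<in>UNIV. ?u k i z * L i v $ k)))) (at z)" for i z
  proof -
    have "- (g i z \<bullet> L i v) / (jb (g i z)) ^ 3 = - ?s i z * (?s i z * (\<Sum>k\<in>UNIV. ?u k i z * L i v $ k))" for v
      using jb_gt0[of "g i z"]
      by (simp add: inner_vec_def sum_divide_distrib[symmetric] power3_eq_cube)
    then show ?thesis using inverse_jb_has_derivative[OF g, of i z] by simp
  qed
  have du: "(?u j i has_derivative (\<lambda>v. ?s i z * (L i v $ j + (-1) * (?u j i z * (\<Sum>k\<in>UNIV. ?u k i z * L i v $ k))))) (at z)" for j i z
  proof -
    have "((\<lambda>z. g i z $ j) has_derivative (\<lambda>v. L i v $ j)) (at z)"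
      by (rule bounded_linear.has_derivative[OF bounded_linear_vec_nth g])
    from has_derivative_mult[OF this ds, of i]
    have "((\<lambda>z. g i z $ j * ?s i z) has_derivative
       (\<lambda>v. g i z $ j * (- ?s i z * (?s i z * (\<Sum>k\<in>UNIV. ?u k i z * L i v $ k))) + L i v $ j * ?s i z)) (at z)" .
    moreover have "g i z $ j * (- ?s i z * (?s i z * S)) + l * ?s i z = ?s i z * (l + (-1) * (?u j i z * S))" for S l
      by (simp add: algebra_simps)
    ultimately show ?thesis by simp
  qed
  have "symbols_upto w d k (- e) ?s \<and> (\<forall>j. symbols_upto w d k 0 (?u j))"
  proof (induction k)
    case 0
    have "continuous_on UNIV (?s i)" for i
      by (rule has_derivative_continuous_on[OF has_derivative_at_withinI[OF ds]])
    moreover have "continuous_on UNIV (?u j i)" for i j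
      by (rule has_derivative_continuous_on[OF has_derivative_at_withinI[OF du]])
    ultimately show ?case using s_le u_le unfolding symbols_upto.simps(1) by blast
  next
    case (Suc k)
    have L: "symbols_upto w d k 0 (\<lambda>i z. L i b $ j)" if "b \<in> Basis" for b j
      by (rule symbols_const[where K=K]) (use K[OF that] w in \<open>auto intro: order_trans[OF component_le_norm_cart]\<close>)
    have S: "symbols_upto w d k 0 (\<lambda>i z. \<Sum>l\<in>UNIV. ?u l i z * L i b $ l)" if "b \<in> Basis" for b
    proof (rule symbols_sum)
      fix l
      have "symbols_upto w d k (0 + 0) (\<lambda>i z. ?u l i z * L i b $ l)"
        by (rule symbols_mult[OF _ L[OF that]]) (use Suc in blast)
      then show "symbols_upto w d k 0 (\<lambda>i z. ?u l i z * L i b $ l)" by (simp only: add_0_right)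
    qed
    show ?case
    proof (intro conjI allI)
      show "symbols_upto w d (Suc k) (- e) ?s"
      proof (rule symbols_SucI[OF s_le ds])
        fix b :: 'a assume b: "b \<in> Basis"
        show "symbols_upto w d k (- e - d b) (\<lambda>i z. - ?s i z * (?s i z * (\<Sum>l\<in>UNIV. ?u l i z * L i b $ l)))"
        proof (cases "\<forall>i. L i b = 0")
          case True
          then show ?thesis by (simp add: symbols_zero)
        next
          case False
          have "symbols_upto w d k (- e + (- e + 0)) (\<lambda>i z. ((-1) * ?s i z) * (?s i z * (\<Sum>l\<in>UNIV. ?u l i z * L i b $ l)))"
            by (intro symbols_mult symbols_cmult S[OF b]) (use Suc w in auto)
          then show ?thesis using ord[OF b] False by simp
        qed
      qed
      fix j
      show "symbols_upto w d (Suc k) 0 (?u j)"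
      proof (rule symbols_SucI[OF u_le du])
        fix b :: 'a assume b: "b \<in> Basis"
        show "symbols_upto w d k (0 - d b) (\<lambda>i z. ?s i z * (L i b $ j + (-1) * (?u j i z * (\<Sum>l\<in>UNIV. ?u l i z * L i b $ l))))"
        proof (cases "\<forall>i. L i b = 0")
          case True
          then show ?thesis by (simp add: symbols_zero)
        next
          case False
          have "symbols_upto w d k (0 + 0) (\<lambda>i z. ?u j i z * (\<Sum>l\<in>UNIV. ?u l i z * L i b $ l))"
            by (intro symbols_mult S[OF b]) (use Suc in auto)
          then have "symbols_upto w d k (- e + 0) (\<lambda>i z. ?s i z * (L i b $ j + (-1) * (?u j i z * (\<Sum>l\<in>UNIV. ?u l i z * L i b $ l))))"
            by (intro symbols_mult symbols_add L[OF b] symbols_cmult) (use Suc w in auto)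
          then show ?thesis using ord[OF b] False by simp
        qed
      qed
    qed
  qed
  then show "symbols_upto w d k 0 (?u j)" "symbols_upto w d k (- e) ?s" by auto
qed

lemma momentum_symbols:
  shows "phase_symbols k 0 (\<lambda>i z. snd z $ j / jb (snd z))"
proof (rule bracket_symbols(1)[where e=1 and K=1 and K'=1 and L="\<lambda>_. snd"])
  show "(snd has_derivative snd) (at z)" for z :: "'a phase"
    by (rule has_derivative_snd[OF has_derivative_ident])
  show "norm (snd b) \<le> 1" if "b \<in> Basis" for b :: "'a phase"
    using that unfolding Basis_phase by (auto simp: ex_def e\<xi>_def)
  show "(\<forall>i. snd b = 0) \<or> norm (snd b) = 1" if "b \<in> Basis" for b :: "'a phase"
    using that unfolding Basis_phase by (auto simp: ex_def e\<xi>_def)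
  show "1 / jb (snd z) \<le> 1 * jb (snd z) powr - 1" for z :: "'a phase"
    using jb_gt0[of "snd z"] by (simp add: powr_minus_divide)
qed (rule jb_gt0)

lemma position_symbols:
  fixes r :: real and j :: "'n::finite"
  shows "phase_symbols k 0 (\<lambda>(c::real^'n) z. (r *\<^sub>R (fst z - c)) $ j / jb (r *\<^sub>R (fst z - c)))"
    and "phase_symbols k 0 (\<lambda>(c::real^'n) z. 1 / jb (r *\<^sub>R (fst z - c)))"
proof -
  let ?g = "\<lambda>(c::real^'n) z. r *\<^sub>R (fst z - c)"
  have 1: "(?g c has_derivative (\<lambda>v. r *\<^sub>R fst v)) (at z)" for c :: "real ^ 'n" and z
    by (auto intro!: derivative_eq_intros)
  have 2: "norm (r *\<^sub>R fst b) \<le> \<bar>r\<bar>" if "b \<in> Basis" for b :: "'n phase"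
    using that unfolding Basis_phase by (auto simp: ex_def e\<xi>_def)
  have 3: "(\<forall>i. r *\<^sub>R fst b = 0) \<or> norm (snd b) = 0" if "b \<in> Basis" for b :: "'n phase"
    using that unfolding Basis_phase by (auto simp: ex_def e\<xi>_def)
  have 4: "1 / jb (?g c z) \<le> 1 * jb (snd z) powr - 0" for c and z :: "'n phase"
    using jb_ge1[of "?g c z"] jb_gt0[of "snd z"] by simp
  note * = bracket_symbols[where g="?g" and L="\<lambda>_ v. r *\<^sub>R fst v" and w="\<lambda>z. jb (snd z)" and d="\<lambda>b. norm (snd b)",
      OF 1 2 3 jb_gt0 4]
  show "phase_symbols k 0 (\<lambda>(c::real^'n) z. (r *\<^sub>R (fst z - c)) $ j / jb (r *\<^sub>R (fst z - c)))" by (rule *(1))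
  show "phase_symbols k 0 (\<lambda>(c::real^'n) z. 1 / jb (r *\<^sub>R (fst z - c)))" by (rule *(2)[unfolded minus_zero])
qed

text \<open>
  Identifies the fibre \<open>\<real>\<^sup>n\<close> with the open unit ball.  It replaces the usual \<open>\<xi> / \<bar>\<xi>\<bar>\<close>, from which it
  differs little for large \<open>\<xi>\<close>, and is smooth at \<open>\<xi> = 0\<close>.
\<close>

definition compactify :: "'n::finite phase \<Rightarrow> 'n phase" where
  "compactify z = (fst z, (1 / jb (snd z)) *\<^sub>R snd z)"

definition d_compactify :: "'n::finite phase \<Rightarrow> 'n phase \<Rightarrow> 'n phase" where
  "d_compactify z v = (fst v, (1 / jb (snd z)) *\<^sub>R (snd v - (snd (compactify z) \<bullet> snd v) *\<^sub>R snd (compactify z)))"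

lemma compactify_has_derivative: "(compactify has_derivative d_compactify z) (at z)"
proof -
  have "((\<lambda>z. 1 / jb (snd z)) has_derivative (\<lambda>v. - (snd z \<bullet> snd v) / (jb (snd z)) ^ 3)) (at z)"
    by (rule inverse_jb_has_derivative[OF has_derivative_snd[OF has_derivative_ident]])
  then have "((\<lambda>z. (fst z, (1 / jb (snd z)) *\<^sub>R snd z)) has_derivative
     (\<lambda>v. (fst v, (1 / jb (snd z)) *\<^sub>R snd v + (- (snd z \<bullet> snd v) / (jb (snd z)) ^ 3) *\<^sub>R snd z))) (at z)"
    by (intro has_derivative_Pair has_derivative_scaleR has_derivative_fst[OF has_derivative_ident]
        has_derivative_snd[OF has_derivative_ident])
  moreover have "(fst v, (1 / jb (snd z)) *\<^sub>R snd v + (- (snd z \<bullet> snd v) / (jb (snd z)) ^ 3) *\<^sub>R snd z) = d_compactify z v" for v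
    by (simp add: d_compactify_def compactify_def power3_eq_cube algebra_simps)
  ultimately show ?thesis by (simp add: compactify_def[abs_def])
qed

text \<open>
  The components of \<open>compactify\<close> are the coordinates of \<open>x\<close> and the symbols \<open>\<xi>\<^sub>j / \<langle>\<xi>\<rangle>\<close> of order \<open>0\<close>;
  the chain rule does the rest.
\<close>

lemma compactify_symbols:
  fixes F :: "'n::finite phase \<Rightarrow> real"
  assumes F: "\<And>k. bounded_Ck k F"
  shows "phase_symbols k 0 (\<lambda>i z. F (compactify z))"
proof (rule symbols_compose[OF F jb_gt0 compactify_has_derivative])
  fix b e :: "'n phase" assume b: "b \<in> Basis" and e: "e \<in> Basis"
  from e consider j where "e = ex j" | j where "e = e\<xi> j" unfolding Basis_phase by blast
  then show "phase_symbols k (- norm (snd b)) (\<lambda>i z. d_compactify z b \<bullet> e)"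
  proof cases
    case (1 j)
    then have eq: "d_compactify z b \<bullet> e = fst b $ j" for z :: "'n phase"
      by (simp add: d_compactify_def ex_def inner_axis)
    show ?thesis
    proof (cases "snd b = 0")
      case True
      have "phase_symbols k 0 (\<lambda>i z. fst b $ j)"
        by (rule symbols_const[OF order_refl jb_gt0])
      then show ?thesis unfolding eq using True by simp
    next
      case False
      then have "fst b = 0" using b unfolding Basis_phase by (auto simp: ex_def e\<xi>_def)
      then show ?thesis unfolding eq by (simp add: symbols_zero)
    qed
  next
    case (2 j)
    let ?u = "\<lambda>z::'n phase. snd z $ j / jb (snd z)"
    have eq: "d_compactify z b \<bullet> e = dir_deriv b ?u z" for z :: "'n phase"
    proof -
      have "((\<lambda>z. compactify z \<bullet> e) has_derivative (\<lambda>v. d_compactify z v \<bullet> e)) (at z)"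
        by (rule has_derivative_inner_left[OF compactify_has_derivative])
      moreover have "(\<lambda>z. compactify z \<bullet> e) = ?u"
        by (simp add: fun_eq_iff 2 compactify_def e\<xi>_def inner_axis)
      ultimately have "(?u has_derivative (\<lambda>v. d_compactify z v \<bullet> e)) (at z)" by (simp only:)
      then show ?thesis by (rule dir_deriv_eq[symmetric])
    qed
    show ?thesis unfolding eq by (rule symbols_dir_deriv[OF momentum_symbols b, unfolded diff_0])
  qed
qed

section \<open>An escape function for straight rays\<close>

text \<open>
  With \<open>y = r (x - c)\<close> and \<open>\<theta> = y \<bullet> \<eta> / \<langle>y\<rangle>\<close> this is \<open>\<theta> (1 - 1 / (2 \<langle>y\<rangle>))\<close>.  The first factor compares
  the direction of motion with the outward direction.  The second one makes the product grow also on
  radial rays, where \<open>\<theta>\<close> is almost constant.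
\<close>

definition radial :: "real \<Rightarrow> real ^ 'n::finite \<Rightarrow> 'n phase \<Rightarrow> real" where
  "radial r c z = (r *\<^sub>R (fst z - c)) \<bullet> snd z * (1 / jb (r *\<^sub>R (fst z - c))) *
     (1 - (1/2) * (1 / jb (r *\<^sub>R (fst z - c))))"

lemma radial_symbols: "phase_symbols k 0 (\<lambda>(c::real^'n::finite) z. radial r c (compactify z))"
proof -
  let ?y = "\<lambda>(c::real^'n) z. r *\<^sub>R (fst z - c)"
  have "phase_symbols k (0 + 0) (\<lambda>c z. (\<Sum>j\<in>UNIV. (?y c z $ j / jb (?y c z)) * (snd z $ j / jb (snd z))) *
      (1 + (-1/2) * (1 / jb (?y c z))))"
  proof (intro symbols_mult symbols_add symbols_sum symbols_cmult position_symbols(2))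
    show "phase_symbols k 0 (\<lambda>c z. (?y c z $ j / jb (?y c z)) * (snd z $ j / jb (snd z)))" for j
      using symbols_mult[OF position_symbols(1) momentum_symbols, of k r j j] by simp
    show "phase_symbols k 0 (\<lambda>c z. 1)" by (rule symbols_const[where K=1]) (auto simp: jb_gt0)
  qed (rule jb_gt0)
  note sym = this
  have "(\<Sum>j\<in>UNIV. (?y c z $ j / jb (?y c z)) * (snd z $ j / jb (snd z))) *
      (1 + (-1/2) * (1 / jb (?y c z))) = radial r c (compactify z)" for c :: "real ^ 'n" and z
    by (simp add: radial_def compactify_def inner_vec_def sum_divide_distrib[symmetric] sum_distrib_left mult_ac)
  with sym show ?thesis by (simp only: add_0_right)
qed

definition d_radial :: "real \<Rightarrow> real ^ 'n::finite \<Rightarrow> 'n phase \<Rightarrow> 'n phase \<Rightarrow> real" where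
  "d_radial r c z v = (let y = r *\<^sub>R (fst z - c); J = jb y in
     ((r *\<^sub>R fst v \<bullet> snd z + y \<bullet> snd v) / J - (y \<bullet> snd z) * (y \<bullet> r *\<^sub>R fst v) / J ^ 3) * (1 - 1 / (2 * J))
     + (y \<bullet> snd z) / J * ((y \<bullet> r *\<^sub>R fst v) / (2 * J ^ 3)))"

lemma radial_has_derivative: "(radial r c has_derivative d_radial r c z) (at z)"
proof -
  let ?y = "\<lambda>z. r *\<^sub>R (fst z - c)"
  have y: "(?y has_derivative (\<lambda>v. r *\<^sub>R fst v)) (at z)" by (auto intro!: derivative_eq_intros)
  note s = inverse_jb_has_derivative[OF y]
  have "((\<lambda>z. ?y z \<bullet> snd z * (1 / jb (?y z)) * (1 - (1/2) * (1 / jb (?y z)))) has_derivative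
    (\<lambda>v. ?y z \<bullet> snd z * (1 / jb (?y z)) * (0 - (1/2) * (- (?y z \<bullet> r *\<^sub>R fst v) / jb (?y z) ^ 3)) +
      (?y z \<bullet> snd z * (- (?y z \<bullet> r *\<^sub>R fst v) / jb (?y z) ^ 3) + (?y z \<bullet> snd v + r *\<^sub>R fst v \<bullet> snd z) * (1 / jb (?y z))) *
       (1 - (1/2) * (1 / jb (?y z))))) (at z)"
    by (intro has_derivative_mult has_derivative_diff has_derivative_const has_derivative_inner y s
        has_derivative_snd[OF has_derivative_ident] bounded_linear.has_derivative[OF bounded_linear_mult_right])
  moreover have "?y z \<bullet> snd z * (1 / jb (?y z)) * (0 - (1/2) * (- (?y z \<bullet> r *\<^sub>R fst v) / jb (?y z) ^ 3)) +
      (?y z \<bullet> snd z * (- (?y z \<bullet> r *\<^sub>R fst v) / jb (?y z) ^ 3) + (?y z \<bullet> snd v + r *\<^sub>R fst v \<bullet> snd z) * (1 / jb (?y z))) *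
       (1 - (1/2) * (1 / jb (?y z))) = d_radial r c z v" for v
  proof -
    have "q * (1 / J) * (0 - (1/2) * (- t / J ^ 3)) + (q * (- t / J ^ 3) + (n + m) * (1 / J)) * (1 - (1/2) * (1 / J))
        = ((m + n) / J - q * t / J ^ 3) * (1 - 1 / (2 * J)) + q / J * (t / (2 * J ^ 3))" for q t m n J :: real
      by (simp add: algebra_simps)
    then show ?thesis unfolding d_radial_def Let_def .
  qed
  ultimately show ?thesis by (simp add: radial_def[abs_def])
qed

lemma d_radial_linear: "linear (d_radial r c z)"
  using radial_has_derivative has_derivative_linear by blast

text \<open>
  Along straight rays \<open>\<theta>\<close> has derivative \<open>2 r (\<bar>\<eta>\<bar>\<^sup>2 - \<theta>\<^sup>2) / \<langle>y\<rangle>\<close>, which is nonnegative but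
  degenerates on radial rays, and the derivative of \<open>- 1 / (2 \<langle>y\<rangle>)\<close> contributes
  \<open>r \<theta>\<^sup>2 / \<langle>y\<rangle>\<^sup>2\<close>.  The sum controls \<open>r \<bar>\<eta>\<bar>\<^sup>2 / \<langle>y\<rangle>\<^sup>2\<close>.
\<close>

lemma d_radial_straight:
  assumes "r \<ge> 0"
  shows "d_radial r c z (2 *\<^sub>R snd z, 0) \<ge> r * (norm (snd z))\<^sup>2 / (jb (r *\<^sub>R (fst z - c)))\<^sup>2"
proof -
  define y where "y = r *\<^sub>R (fst z - c)"
  define J where "J = jb y"
  define N where "N = (norm (snd z))\<^sup>2"
  define \<theta> where "\<theta> = (y \<bullet> snd z) / J"
  have J: "J \<ge> 1" "J > 0" unfolding J_def by (rule jb_ge1, rule jb_gt0)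
  have "d_radial r c z (2 *\<^sub>R snd z, 0) = 2 * r * ((N - \<theta>\<^sup>2) / J * (1 - 1 / (2 * J)) + \<theta>\<^sup>2 / (2 * J\<^sup>2))"
    using J(2) unfolding d_radial_def Let_def y_def[symmetric] J_def[symmetric] \<theta>_def N_def power2_norm_eq_inner
    by (simp add: field_simps power2_eq_square power3_eq_cube)
  moreover have "\<theta>\<^sup>2 \<le> N"
  proof -
    have "\<bar>y \<bullet> snd z\<bar> \<le> norm y * norm (snd z)" by (rule Cauchy_Schwarz_ineq2)
    also have "\<dots> \<le> J * norm (snd z)"
      unfolding J_def jb_def by (intro mult_right_mono real_le_rsqrt) auto
    finally have "\<bar>\<theta>\<bar> \<le> norm (snd z)" using J by (simp add: \<theta>_def abs_div pos_divide_le_eq mult.commute)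
    then show ?thesis unfolding N_def by (metis abs_norm_cancel abs_le_square_iff)
  qed
  moreover have "N / (2 * J\<^sup>2) \<le> (N - \<theta>\<^sup>2) / J * (1 - 1 / (2 * J)) + \<theta>\<^sup>2 / (2 * J\<^sup>2)"
  proof -
    have "(N - \<theta>\<^sup>2) / (2 * J\<^sup>2) \<le> (N - \<theta>\<^sup>2) / J * (1 - 1 / (2 * J))"
    proof -
      have "1 / (2 * J) \<le> 1 - 1 / (2 * J)" using J by (simp add: field_simps)
      then have "(N - \<theta>\<^sup>2) / J * (1 / (2 * J)) \<le> (N - \<theta>\<^sup>2) / J * (1 - 1 / (2 * J))"
        using \<open>\<theta>\<^sup>2 \<le> N\<close> J by (intro mult_left_mono) auto
      then show ?thesis by (simp add: power2_eq_square mult_ac)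
    qed
    then show ?thesis by (simp add: diff_divide_distrib)
  qed
  then have "2 * r * (N / (2 * J\<^sup>2)) \<le> 2 * r * ((N - \<theta>\<^sup>2) / J * (1 - 1 / (2 * J)) + \<theta>\<^sup>2 / (2 * J\<^sup>2))"
    using assms by (intro mult_left_mono) auto
  ultimately show ?thesis by (simp add: N_def J_def y_def)
qed

text \<open>
  The derivative in \<open>x\<close> is \<open>O(r / \<langle>y\<rangle>)\<close> and the derivative in \<open>\<eta>\<close> is \<open>O(\<bar>y\<bar> / \<langle>y\<rangle>)\<close>.  The smallness of
  the first one is what keeps the perturbation errors below the gain at large scales.
\<close>

lemma abs_d_radial_le:
  assumes "r \<ge> 0" "norm (snd z) \<le> 1"
  shows "\<bar>d_radial r c z v\<bar> \<le> (3 * r * norm (fst v) + norm (r *\<^sub>R (fst z - c)) * norm (snd v)) / jb (r *\<^sub>R (fst z - c))"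
proof -
  define y where "y = r *\<^sub>R (fst z - c)"
  define J where "J = jb y"
  define P where "P = norm (fst v)"
  define Q where "Q = norm y * norm (snd v)"
  have J: "J \<ge> 1" "J > 0" unfolding J_def by (rule jb_ge1, rule jb_gt0)
  have yJ: "norm y \<le> J" unfolding J_def jb_def by (rule real_le_rsqrt) simp
  have P0: "P \<ge> 0" and Q0: "Q \<ge> 0" by (simp_all add: P_def Q_def)
  have t1: "\<bar>r *\<^sub>R fst v \<bullet> snd z\<bar> \<le> r * P"
    using order_trans[OF Cauchy_Schwarz_ineq2[of "fst v" "snd z"] mult_left_mono[OF assms(2)]] assms(1)
    by (simp add: P_def abs_mult mult_left_mono)
  have t2: "\<bar>y \<bullet> snd v\<bar> \<le> Q" unfolding Q_def by (rule Cauchy_Schwarz_ineq2)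
  have t3: "\<bar>y \<bullet> snd z\<bar> \<le> J"
    using order_trans[OF Cauchy_Schwarz_ineq2[of y "snd z"] mult_mono[OF yJ assms(2)]] J by simp
  have t4: "\<bar>y \<bullet> r *\<^sub>R fst v\<bar> \<le> J * (r * P)"
    using order_trans[OF Cauchy_Schwarz_ineq2[of y "r *\<^sub>R fst v"] mult_right_mono[OF yJ]] assms(1) by (simp add: P_def)
  define A where "A = (r *\<^sub>R fst v \<bullet> snd z + y \<bullet> snd v) / J"
  define B where "B = (y \<bullet> snd z) * (y \<bullet> r *\<^sub>R fst v) / J ^ 3"
  have A: "\<bar>A\<bar> \<le> (r * P + Q) / J"
    unfolding A_def abs_divide using t1 t2 J by (intro frac_le) (auto intro: order_trans[OF abs_triangle_ineq])
  have B: "\<bar>B\<bar> \<le> r * P / J"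
  proof -
    have "\<bar>y \<bullet> snd z\<bar> * \<bar>y \<bullet> r *\<^sub>R fst v\<bar> \<le> J * (J * (r * P))"
      by (intro mult_mono t3 t4) (use J in auto)
    then have "\<bar>B\<bar> \<le> J * (J * (r * P)) / J ^ 3"
      unfolding B_def abs_divide abs_mult using J assms(1) P0 by (intro frac_le) auto
    also have "\<dots> = r * P / J" using J by (simp add: power3_eq_cube)
    finally show ?thesis .
  qed
  have eq: "d_radial r c z v = (A - B) * (1 - 1 / (2 * J)) + B / (2 * J)"
    using J(2) unfolding d_radial_def Let_def y_def[symmetric] J_def[symmetric] A_def B_def
    by (simp add: field_simps)
  have h: "0 \<le> 1 / (2 * J)" "1 / (2 * J) \<le> 1 / 2" using J by (auto simp: field_simps)
  have "\<bar>d_radial r c z v\<bar> \<le> (\<bar>A\<bar> + \<bar>B\<bar>) * 1 + \<bar>B\<bar> * 1"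
    unfolding eq
  proof (rule order_trans[OF abs_triangle_ineq], intro add_mono)
    show "\<bar>(A - B) * (1 - 1 / (2 * J))\<bar> \<le> (\<bar>A\<bar> + \<bar>B\<bar>) * 1"
      unfolding abs_mult using h by (intro mult_mono) auto
    have "\<bar>B / (2 * J)\<bar> = \<bar>B\<bar> * (1 / (2 * J))" using J by simp
    also have "\<dots> \<le> \<bar>B\<bar> * 1" using h by (intro mult_left_mono) auto
    finally show "\<bar>B / (2 * J)\<bar> \<le> \<bar>B\<bar> * 1" .
  qed
  also have "\<dots> \<le> (r * P + Q) / J + r * P / J + r * P / J"
    using add_mono[OF add_mono[OF A B] B] by simp
  also have "\<dots> = (3 * r * P + Q) / J" by (simp add: add_divide_distrib)
  finally show ?thesis by (simp add: P_def Q_def J_def y_def)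
qed

section \<open>Bounded Lipschitz functions\<close>

lemma has_vector_derivative_vec:
  fixes f :: "real \<Rightarrow> real ^ 'n"
  assumes "\<And>i. ((\<lambda>s. f s $ i) has_real_derivative f' $ i) (at s)"
  shows "(f has_vector_derivative f') (at s)"
  unfolding has_vector_derivative_def
proof (subst has_derivative_componentwise_within, intro ballI)
  fix b :: "real ^ 'n" assume "b \<in> Basis"
  then obtain i where b: "b = axis i 1" by (auto simp: Basis_vec_def)
  show "((\<lambda>x. f x \<bullet> b) has_derivative (\<lambda>x. (x *\<^sub>R f') \<bullet> b)) (at s)"
    using assms[of i] unfolding has_field_derivative_def b
    by (simp add: inner_axis mult_commute_abs)
qed

lemma norm_matrix_vector_le:
  fixes M :: "real ^ 'n ^ 'n"
  assumes "\<And>j k. \<bar>M $ j $ k\<bar> \<le> m"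
  shows "norm (M *v v) \<le> (real CARD('n))\<^sup>2 * m * norm v"
proof -
  have "norm (M *v v) \<le> (\<Sum>j\<in>UNIV. \<bar>(M *v v) $ j\<bar>)" by (rule norm_le_l1_cart)
  also have "\<dots> \<le> (\<Sum>j\<in>(UNIV::'n set). \<Sum>k\<in>(UNIV::'n set). m * norm v)"
  proof (rule sum_mono)
    fix j
    have "\<bar>(M *v v) $ j\<bar> \<le> (\<Sum>k\<in>UNIV. \<bar>M $ j $ k * v $ k\<bar>)"
      by (simp add: matrix_vector_mult_def)
    also have "\<dots> \<le> (\<Sum>k\<in>(UNIV::'n set). m * norm v)"
      unfolding abs_mult by (intro sum_mono mult_mono assms component_le_norm_cart)
        (use assms[of j j] in auto)
    finally show "\<bar>(M *v v) $ j\<bar> \<le> (\<Sum>k\<in>(UNIV::'n set). m * norm v)" .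
  qed
  finally show ?thesis by (simp add: power2_eq_square mult.assoc)
qed

definition bounded_lipschitz :: "'a::metric_space set \<Rightarrow> ('a \<Rightarrow> real) \<Rightarrow> bool" where
  "bounded_lipschitz S f \<longleftrightarrow> (\<exists>K\<ge>0. (\<forall>x\<in>S. \<bar>f x\<bar> \<le> K) \<and> (\<forall>x\<in>S. \<forall>y\<in>S. \<bar>f x - f y\<bar> \<le> K * dist x y))"

lemma bounded_lipschitzI:
  assumes "\<And>x. x \<in> S \<Longrightarrow> \<bar>f x\<bar> \<le> B" "\<And>x y. x \<in> S \<Longrightarrow> y \<in> S \<Longrightarrow> \<bar>f x - f y\<bar> \<le> L * dist x y"
  shows "bounded_lipschitz S f"
  unfolding bounded_lipschitz_def
proof (intro exI[of _ "max 0 (max B L)"] conjI ballI)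
  fix x y assume xy: "x \<in> S" "y \<in> S"
  show "\<bar>f x\<bar> \<le> max 0 (max B L)" using assms(1)[OF xy(1)] by auto
  show "\<bar>f x - f y\<bar> \<le> max 0 (max B L) * dist x y"
    by (rule order_trans[OF assms(2)[OF xy]]) (auto intro!: mult_right_mono)
qed auto

lemma bounded_lipschitz_const: "bounded_lipschitz S (\<lambda>x. c)"
  by (rule bounded_lipschitzI[where B = "\<bar>c\<bar>" and L = 0]) auto

lemma bounded_lipschitz_add:
  assumes "bounded_lipschitz S f" "bounded_lipschitz S g"
  shows "bounded_lipschitz S (\<lambda>x. f x + g x)"
proof -
  obtain K L where K: "\<forall>x\<in>S. \<bar>f x\<bar> \<le> K" "\<forall>x\<in>S. \<forall>y\<in>S. \<bar>f x - f y\<bar> \<le> K * dist x y"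
    and L: "\<forall>x\<in>S. \<bar>g x\<bar> \<le> L" "\<forall>x\<in>S. \<forall>y\<in>S. \<bar>g x - g y\<bar> \<le> L * dist x y"
    using assms unfolding bounded_lipschitz_def by blast
  show ?thesis
  proof (rule bounded_lipschitzI)
    fix x y assume xy: "x \<in> S" "y \<in> S"
    have "\<bar>f x\<bar> \<le> K" "\<bar>g x\<bar> \<le> L" using K L xy by auto
    then show "\<bar>f x + g x\<bar> \<le> K + L" by linarith
    have "\<bar>f x - f y\<bar> \<le> K * dist x y" "\<bar>g x - g y\<bar> \<le> L * dist x y" using K L xy by auto
    then show "\<bar>f x + g x - (f y + g y)\<bar> \<le> (K + L) * dist x y" unfolding distrib_right by linarith
  qed
qed

lemma bounded_lipschitz_mult:
  assumes "bounded_lipschitz S f" "bounded_lipschitz S g"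
  shows "bounded_lipschitz S (\<lambda>x. f x * g x)"
proof -
  obtain K L where K: "\<forall>x\<in>S. \<bar>f x\<bar> \<le> K" "\<forall>x\<in>S. \<forall>y\<in>S. \<bar>f x - f y\<bar> \<le> K * dist x y" "K \<ge> 0"
    and L: "\<forall>x\<in>S. \<bar>g x\<bar> \<le> L" "\<forall>x\<in>S. \<forall>y\<in>S. \<bar>g x - g y\<bar> \<le> L * dist x y" "L \<ge> 0"
    using assms unfolding bounded_lipschitz_def by blast
  show ?thesis
  proof (rule bounded_lipschitzI)
    fix x y assume xy: "x \<in> S" "y \<in> S"
    show "\<bar>f x * g x\<bar> \<le> K * L" unfolding abs_mult by (intro mult_mono) (use K L xy in auto)
    have "\<bar>f x * g x - f y * g y\<bar> = \<bar>f x * (g x - g y) + (f x - f y) * g y\<bar>" by (simp add: algebra_simps)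
    also have "\<dots> \<le> \<bar>f x\<bar> * \<bar>g x - g y\<bar> + \<bar>f x - f y\<bar> * \<bar>g y\<bar>"
      by (rule order_trans[OF abs_triangle_ineq]) (simp add: abs_mult)
    also have "\<dots> \<le> K * (L * dist x y) + (K * dist x y) * L"
      by (intro add_mono mult_mono) (use K L xy in auto)
    finally show "\<bar>f x * g x - f y * g y\<bar> \<le> (2 * K * L) * dist x y" by (simp add: algebra_simps)
  qed
qed

lemma bounded_lipschitz_sum:
  "(\<And>i. i \<in> I \<Longrightarrow> bounded_lipschitz S (f i)) \<Longrightarrow> bounded_lipschitz S (\<lambda>x. \<Sum>i\<in>I. f i x)"
  by (induction I rule: infinite_finite_induct) (simp_all add: bounded_lipschitz_add bounded_lipschitz_const)

lemma bounded_lipschitz_fst: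
  assumes "bounded_lipschitz T g"
  shows "fst ` S \<subseteq> T \<Longrightarrow> bounded_lipschitz S (\<lambda>z. g (fst z))"
proof -
  assume S: "fst ` S \<subseteq> T"
  obtain K where K: "K \<ge> 0" "\<forall>x\<in>T. \<bar>g x\<bar> \<le> K" "\<forall>x\<in>T. \<forall>y\<in>T. \<bar>g x - g y\<bar> \<le> K * dist x y"
    using assms unfolding bounded_lipschitz_def by blast
  show ?thesis
  proof (rule bounded_lipschitzI)
    fix z w assume z: "z \<in> S" and w: "w \<in> S"
    then have T: "fst z \<in> T" "fst w \<in> T" using S by auto
    show "\<bar>g (fst z)\<bar> \<le> K" using K(2) T(1) by (rule bspec)
    have "\<bar>g (fst z) - g (fst w)\<bar> \<le> K * dist (fst z) (fst w)" using K(3) T by simp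
    also have "\<dots> \<le> K * dist z w" by (intro mult_left_mono dist_fst_le K(1))
    finally show "\<bar>g (fst z) - g (fst w)\<bar> \<le> K * dist z w" .
  qed
qed

lemma bounded_lipschitz_vec:
  fixes F :: "'a::metric_space \<Rightarrow> real ^ 'n"
  assumes "\<And>i. bounded_lipschitz S (\<lambda>z. F z $ i)"
  shows "\<exists>L\<ge>0. \<forall>x\<in>S. \<forall>y\<in>S. norm (F x - F y) \<le> L * dist x y"
proof -
  have "\<forall>i. \<exists>K\<ge>0. \<forall>x\<in>S. \<forall>y\<in>S. \<bar>F x $ i - F y $ i\<bar> \<le> K * dist x y"
    using assms unfolding bounded_lipschitz_def by blast
  then obtain K where K: "\<forall>i. K i \<ge> 0 \<and> (\<forall>x\<in>S. \<forall>y\<in>S. \<bar>F x $ i - F y $ i\<bar> \<le> K i * dist x y)"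
    by metis
  show ?thesis
  proof (intro exI[of _ "\<Sum>i\<in>UNIV. K i"] conjI ballI sum_nonneg)
    fix x y assume xy: "x \<in> S" "y \<in> S"
    have "norm (F x - F y) \<le> (\<Sum>i\<in>UNIV. \<bar>(F x - F y) $ i\<bar>)" by (rule norm_le_l1_cart)
    also have "\<dots> \<le> (\<Sum>i\<in>UNIV. K i * dist x y)" by (rule sum_mono) (use K xy in auto)
    finally show "norm (F x - F y) \<le> (\<Sum>i\<in>UNIV. K i) * dist x y" by (simp add: sum_distrib_right)
  qed (use K in auto)
qed

definition cutoff :: "real \<Rightarrow> real \<Rightarrow> real ^ 'n \<Rightarrow> real" where
  "cutoff R d x = max 0 (min 1 ((R + d - norm x) / d))"

lemma cutoff_range: "0 \<le> cutoff R d x" "cutoff R d x \<le> 1"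
  by (auto simp: cutoff_def)

lemma cutoff_inside: "d > 0 \<Longrightarrow> norm x \<le> R \<Longrightarrow> cutoff R d x = 1"
  by (simp add: cutoff_def min_absorb1 pos_le_divide_eq)

lemma cutoff_outside: "d > 0 \<Longrightarrow> norm x \<ge> R + d \<Longrightarrow> cutoff R d x = 0"
  by (simp add: cutoff_def max_absorb1 min.coboundedI2 pos_divide_le_eq)

lemma cutoff_lipschitz:
  assumes "d > 0"
  shows "\<bar>cutoff R d x - cutoff R d y\<bar> \<le> norm (x - y) / d"
proof -
  have "\<bar>cutoff R d x - cutoff R d y\<bar> \<le> \<bar>(R + d - norm x) / d - (R + d - norm y) / d\<bar>"
    by (simp add: cutoff_def)
  also have "\<dots> = \<bar>norm x - norm y\<bar> / d" using assms by (simp add: diff_divide_distrib[symmetric] abs_minus_commute)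
  also have "\<dots> \<le> norm (x - y) / d" using assms norm_triangle_ineq3 by (intro divide_right_mono) auto
  finally show ?thesis .
qed

lemma bounded_lipschitz_cutoff:
  assumes "d > 0"
  shows "bounded_lipschitz UNIV (cutoff R d)"
proof (rule bounded_lipschitzI)
  show "\<bar>cutoff R d x\<bar> \<le> 1" for x using cutoff_range[of R d x] by simp
  show "\<bar>cutoff R d x - cutoff R d y\<bar> \<le> 1 / d * dist x y" for x y
    using cutoff_lipschitz[OF assms, of R x y] by (simp add: dist_norm)
qed

lemma continuous_on_cutoff:
  assumes "d > 0" "continuous_on S g"
  shows "continuous_on S (\<lambda>z. cutoff R d (g z))"
  unfolding cutoff_def using assms by (intro continuous_intros) auto

section \<open>The Hamiltonian vector field\<close>

text \<open>
  Two bounded derivatives of the coefficients suffice: they make the Hamiltonian field locally Lipschitz.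
\<close>

locale nontrapping_metric =
  fixes a :: "real ^ 'n::finite \<Rightarrow> real ^ 'n ^ 'n" and C :: real
    and X \<Xi> :: "real \<Rightarrow> real ^ 'n \<Rightarrow> real ^ 'n \<Rightarrow> real ^ 'n"
  assumes C_pos: "C > 0"
    and regular: "coeffs_regular 2 C a"
    and symmetric: "coeffs_symmetric a"
    and elliptic: "coeffs_elliptic C a"
    and flat: "coeffs_asymp_flat C a"
    and flow: "hamiltonian_flow a X \<Xi>"
    and nontrapping: "nontrapping X"
begin

text \<open>
  The gradient of \<open>h\<close> in \<open>x\<close>.
\<close>

definition force :: "real ^ 'n \<Rightarrow> real ^ 'n \<Rightarrow> real ^ 'n" where
  "force x \<xi> = (\<chi> j. \<Sum>l\<in>UNIV. \<Sum>k\<in>UNIV.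
     dir_deriv (axis j 1) (\<lambda>y. a y $ l $ k) x * \<xi> $ l * \<xi> $ k)"

definition ham_field :: "'n phase \<Rightarrow> 'n phase" where
  "ham_field z = (2 *\<^sub>R (a (fst z) *v snd z), - force (fst z) (snd z))"

lemma coeff_C2:
  assumes "length vs \<le> 2" "set vs \<subseteq> Basis"
  shows "\<bar>dir_derivs vs (\<lambda>x. a x $ j $ k) x\<bar> \<le> C"
    and "length vs < 2 \<Longrightarrow> dir_derivs vs (\<lambda>x. a x $ j $ k) differentiable (at x)"
  using regular assms unfolding coeffs_regular_def Cb_bounded_def C_class_def by blast+

lemma coeff_bound: "\<bar>a x $ j $ k\<bar> \<le> C"
  using coeff_C2(1)[of "[]"] by (simp add: dir_derivs_def)

lemma coeff_differentiable: "(\<lambda>x. a x $ j $ k) differentiable (at x)"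
  using coeff_C2(2)[of "[]"] by (simp add: dir_derivs_def)

lemma coeff_lipschitz: "bounded_lipschitz UNIV (\<lambda>x. a x $ j $ k)"
proof (rule bounded_lipschitzI[OF coeff_bound])
  fix x y
  show "\<bar>a x $ j $ k - a y $ j $ k\<bar> \<le> (real DIM(real ^ 'n) * C) * dist x y"
    unfolding dist_norm
    by (rule bounded_Ck_lipschitz[OF coeff_differentiable])
      (use coeff_C2(1)[of "[e]" for e] in \<open>simp add: dir_derivs_def\<close>)
qed

lemma coeff_deriv_lipschitz: "bounded_lipschitz UNIV (dir_deriv (axis i 1) (\<lambda>x. a x $ j $ k))"
proof (rule bounded_lipschitzI)
  show "\<bar>dir_deriv (axis i 1) (\<lambda>x. a x $ j $ k) x\<bar> \<le> C" for x
    using coeff_C2(1)[of "[axis i 1]"] by (simp add: dir_derivs_def)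
  fix x y
  show "\<bar>dir_deriv (axis i 1) (\<lambda>x. a x $ j $ k) x - dir_deriv (axis i 1) (\<lambda>x. a x $ j $ k) y\<bar>
      \<le> (real DIM(real ^ 'n) * C) * dist x y"
    unfolding dist_norm
  proof (rule bounded_Ck_lipschitz)
    show "dir_deriv (axis i 1) (\<lambda>x. a x $ j $ k) differentiable (at x)" for x
      using coeff_C2(2)[of "[axis i 1]"] by (simp add: dir_derivs_def)
    show "\<bar>dir_deriv e (dir_deriv (axis i 1) (\<lambda>x. a x $ j $ k)) x\<bar> \<le> C" if "e \<in> Basis" for e x
      using coeff_C2(1)[of "[e, axis i 1]"] that by (simp add: dir_derivs_def)
  qed
qed

lemma coeff_dir_deriv:
  "dir_deriv v (\<lambda>x. a x $ j $ k) x = (\<Sum>i\<in>UNIV. v $ i * dir_deriv (axis i 1) (\<lambda>x. a x $ j $ k) x)"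
proof -
  let ?D = "\<lambda>v. dir_deriv v (\<lambda>x. a x $ j $ k) x"
  have lin: "linear ?D" by (rule dir_deriv_linear[OF coeff_differentiable])
  have "?D (\<Sum>i\<in>UNIV. v $ i *\<^sub>R axis i 1) = (\<Sum>i\<in>UNIV. v $ i *\<^sub>R ?D (axis i 1))"
    by (simp only: linear_sum[OF lin] linear_scale[OF lin])
  moreover have "(\<Sum>i\<in>UNIV. v $ i *\<^sub>R axis i 1) = v"
    using basis_expansion[of v] by (simp add: scalar_mult_eq_scaleR)
  ultimately show ?thesis by simp
qed

text \<open>
  One constant for all the bounds below.  The factor \<open>n\<^sup>3\<close> comes from summing over the indices of \<open>\<partial>\<^sub>j a\<^sub>l\<^sub>k\<close>.
\<close>

definition growth :: real where "growth = max 1 (max C ((real CARD('n)) ^ 3 * C))"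

lemma growth_bounds: "growth \<ge> 1" "growth \<ge> C" "(real CARD('n)) ^ 3 * C \<le> growth" "(real CARD('n))\<^sup>2 * C \<le> growth"
proof -
  show g: "growth \<ge> 1" "growth \<ge> C" "(real CARD('n)) ^ 3 * C \<le> growth" by (auto simp: growth_def)
  have "(real CARD('n))\<^sup>2 \<le> (real CARD('n)) ^ 3" by (rule power_increasing) auto
  then show "(real CARD('n))\<^sup>2 * C \<le> growth"
    using g C_pos by (meson less_imp_le mult_right_mono order_trans)
qed

lemma norm_metric_le: "norm (a x *v \<xi>) \<le> growth * norm \<xi>"
proof -
  have "norm (a x *v \<xi>) \<le> (real CARD('n))\<^sup>2 * C * norm \<xi>" by (rule norm_matrix_vector_le[OF coeff_bound])
  also have "\<dots> \<le> growth * norm \<xi>" by (intro mult_right_mono growth_bounds) auto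
  finally show ?thesis .
qed

lemma norm_metric_diff_le: "norm (a x *v \<xi> - \<xi>) \<le> growth / (jb x)\<^sup>2 * norm \<xi>"
proof -
  have "\<bar>(a x - mat 1) $ j $ k\<bar> \<le> C / (jb x)\<^sup>2" for j k
  proof -
    have "\<bar>(a x - mat 1) $ j $ k\<bar> \<le> norm (a x - mat 1)"
      by (rule order_trans[OF component_le_norm_cart Finite_Cartesian_Product.norm_nth_le])
    also have "\<dots> \<le> C / (jb x)\<^sup>2" using flat unfolding coeffs_asymp_flat_def by (metis norm_minus_commute)
    finally show ?thesis .
  qed
  from norm_matrix_vector_le[OF this, of \<xi>]
  have "norm (a x *v \<xi> - \<xi>) \<le> (real CARD('n))\<^sup>2 * (C / (jb x)\<^sup>2) * norm \<xi>"
    by (simp add: matrix_vector_mult_diff_rdistrib)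
  also have "\<dots> = ((real CARD('n))\<^sup>2 * C) / (jb x)\<^sup>2 * norm \<xi>" by simp
  also have "\<dots> \<le> growth / (jb x)\<^sup>2 * norm \<xi>"
    by (intro mult_right_mono divide_right_mono growth_bounds) auto
  finally show ?thesis .
qed

lemma norm_force_le: "norm (force x \<xi>) \<le> growth / (jb x)\<^sup>2 * (norm \<xi>)\<^sup>2"
proof -
  let ?n = "real CARD('n)"
  have d: "\<bar>dir_deriv (axis j 1) (\<lambda>y. a y $ l $ k) x\<bar> \<le> C / (jb x)\<^sup>2" for j l k
  proof -
    let ?g = "\<chi> i. dir_deriv (axis i 1) (\<lambda>y. a y $ l $ k) x"
    have "\<bar>?g $ j\<bar> \<le> norm ?g" by (rule component_le_norm_cart)
    also have "\<dots> \<le> C / (jb x)\<^sup>2" using flat unfolding coeffs_asymp_flat_def by blast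
    finally show ?thesis by simp
  qed
  have "norm (force x \<xi>) \<le> (\<Sum>j\<in>UNIV. \<bar>force x \<xi> $ j\<bar>)" by (rule norm_le_l1_cart)
  also have "\<dots> \<le> (\<Sum>j\<in>(UNIV::'n set). \<Sum>l\<in>(UNIV::'n set). \<Sum>k\<in>(UNIV::'n set). C / (jb x)\<^sup>2 * (norm \<xi>)\<^sup>2)"
  proof (rule sum_mono)
    fix j
    have "\<bar>force x \<xi> $ j\<bar> \<le> (\<Sum>l\<in>UNIV. \<bar>\<Sum>k\<in>UNIV. dir_deriv (axis j 1) (\<lambda>y. a y $ l $ k) x * \<xi> $ l * \<xi> $ k\<bar>)"
      by (simp add: force_def)
    also have "\<dots> \<le> (\<Sum>l\<in>UNIV. \<Sum>k\<in>UNIV. \<bar>dir_deriv (axis j 1) (\<lambda>y. a y $ l $ k) x * \<xi> $ l * \<xi> $ k\<bar>)"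
      by (intro sum_mono sum_abs)
    also have "\<dots> \<le> (\<Sum>l\<in>(UNIV::'n set). \<Sum>k\<in>(UNIV::'n set). C / (jb x)\<^sup>2 * (norm \<xi> * norm \<xi>))"
      unfolding abs_mult mult.assoc
      by (intro sum_mono mult_mono d component_le_norm_cart) (use C_pos in auto)
    finally show "\<bar>force x \<xi> $ j\<bar> \<le> (\<Sum>l\<in>(UNIV::'n set). \<Sum>k\<in>(UNIV::'n set). C / (jb x)\<^sup>2 * (norm \<xi>)\<^sup>2)"
      by (simp add: power2_eq_square)
  qed
  also have "\<dots> = (?n ^ 3 * C) / (jb x)\<^sup>2 * (norm \<xi>)\<^sup>2" by (simp add: power3_eq_cube)
  also have "\<dots> \<le> growth / (jb x)\<^sup>2 * (norm \<xi>)\<^sup>2"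
    by (intro mult_right_mono divide_right_mono growth_bounds) auto
  finally show ?thesis .
qed

lemma norm_force_le': "norm (force x \<xi>) \<le> growth * (norm \<xi>)\<^sup>2"
proof -
  have "growth / (jb x)\<^sup>2 \<le> growth"
    using growth_bounds(1) one_le_power[OF jb_ge1[of x], of 2] by (simp add: divide_le_eq mult_le_cancel_left1)
  then show ?thesis using norm_force_le[of x \<xi>] by (meson mult_right_mono order_trans zero_le_power2)
qed

lemma norm_ham_field_le: "norm (ham_field z) \<le> 2 * growth * norm (snd z) + growth * (norm (snd z))\<^sup>2"
proof -
  have "norm (ham_field z) \<le> norm (2 *\<^sub>R (a (fst z) *v snd z)) + norm (- force (fst z) (snd z))"
    unfolding ham_field_def by (rule norm_Pair_le)
  then show ?thesis using norm_metric_le[of "fst z" "snd z"] norm_force_le'[of "fst z" "snd z"] by simp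
qed

lemma ham_field_lipschitz:
  "\<exists>L\<ge>0. \<forall>z w. norm (snd z) \<le> M \<longrightarrow> norm (snd w) \<le> M \<longrightarrow>
     norm (ham_field z - ham_field w) \<le> L * norm (z - w)"
proof -
  define S :: "'n phase set" where "S = {z. norm (snd z) \<le> M}"
  have dist_snd: "dist (snd z) (snd w) \<le> dist z w" for z w :: "'n phase"
    by (rule dist_snd_le)
  have \<xi>: "bounded_lipschitz S (\<lambda>z. snd z $ i)" for i
  proof (rule bounded_lipschitzI)
    show "\<bar>snd z $ i\<bar> \<le> M" if "z \<in> S" for z
      by (rule norm_bound_component_le_cart) (use that in \<open>simp add: S_def\<close>)
    show "\<bar>snd z $ i - snd w $ i\<bar> \<le> 1 * dist z w" for z w :: "'n phase"
    proof -
      have "\<bar>(snd z - snd w) $ i\<bar> \<le> dist (snd z) (snd w)"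
        unfolding dist_norm by (rule component_le_norm_cart)
      then show ?thesis using dist_snd[of z w] by simp
    qed
  qed
  have "bounded_lipschitz S (\<lambda>z. (2 *\<^sub>R (a (fst z) *v snd z)) $ i)" for i
    unfolding matrix_vector_mult_def vector_scaleR_component vec_lambda_beta real_scaleR_def
    by (intro bounded_lipschitz_mult bounded_lipschitz_sum bounded_lipschitz_const \<xi> bounded_lipschitz_fst[OF coeff_lipschitz] subset_UNIV)
  from bounded_lipschitz_vec[of S "\<lambda>z. 2 *\<^sub>R (a (fst z) *v snd z)", OF this]
  obtain L1 where L1: "L1 \<ge> 0" "\<And>z w. z \<in> S \<Longrightarrow> w \<in> S \<Longrightarrow>
      norm (2 *\<^sub>R (a (fst z) *v snd z) - 2 *\<^sub>R (a (fst w) *v snd w)) \<le> L1 * dist z w" by auto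
  have "bounded_lipschitz S (\<lambda>z. force (fst z) (snd z) $ i)" for i
    unfolding force_def vec_lambda_beta
    by (intro bounded_lipschitz_mult bounded_lipschitz_sum \<xi> bounded_lipschitz_fst[OF coeff_deriv_lipschitz] subset_UNIV)
  from bounded_lipschitz_vec[of S "\<lambda>z. force (fst z) (snd z)", OF this]
  obtain L2 where L2: "L2 \<ge> 0" "\<And>z w. z \<in> S \<Longrightarrow> w \<in> S \<Longrightarrow>
      norm (force (fst z) (snd z) - force (fst w) (snd w)) \<le> L2 * dist z w" by auto
  show ?thesis
  proof (intro exI[of _ "L1 + L2"] conjI allI impI)
    fix z w :: "'n phase" assume "norm (snd z) \<le> M" "norm (snd w) \<le> M"
    then have zw: "z \<in> S" "w \<in> S" by (auto simp: S_def)
    have "norm (ham_field z - ham_field w)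
      \<le> norm (2 *\<^sub>R (a (fst z) *v snd z) - 2 *\<^sub>R (a (fst w) *v snd w))
        + norm (- force (fst z) (snd z) - (- force (fst w) (snd w)))"
      unfolding ham_field_def diff_Pair by (rule norm_Pair_le)
    then show "norm (ham_field z - ham_field w) \<le> (L1 + L2) * norm (z - w)"
      using L1(2)[OF zw] L2(2)[OF zw] by (simp add: dist_norm norm_minus_commute algebra_simps)
  qed (use L1 L2 in auto)
qed

section \<open>The Hamiltonian flow\<close>

definition solution :: "(real \<Rightarrow> 'n phase) \<Rightarrow> bool" where
  "solution Z \<longleftrightarrow> (\<forall>s. (Z has_vector_derivative ham_field (Z s)) (at s))"

definition \<Phi> :: "real \<Rightarrow> 'n phase \<Rightarrow> 'n phase" where
  "\<Phi> s z = (X s (fst z) (snd z), \<Xi> s (fst z) (snd z))"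

lemma \<Phi>_0: "\<Phi> 0 z = z"
  using flow by (simp add: \<Phi>_def hamiltonian_flow_def)

lemma solution_\<Phi>: "solution (\<lambda>s. \<Phi> s z)"
  unfolding solution_def
proof
  fix s
  have "((\<lambda>s. X s (fst z) (snd z)) has_vector_derivative 2 *\<^sub>R (a (X s (fst z) (snd z)) *v \<Xi> s (fst z) (snd z))) (at s)"
    by (rule has_vector_derivative_vec)
      (use flow in \<open>simp add: hamiltonian_flow_def matrix_vector_mult_def\<close>)
  moreover have "((\<lambda>s. \<Xi> s (fst z) (snd z)) has_vector_derivative - force (X s (fst z) (snd z)) (\<Xi> s (fst z) (snd z))) (at s)"
    by (rule has_vector_derivative_vec)
      (use flow in \<open>simp add: hamiltonian_flow_def force_def\<close>)
  ultimately show "((\<lambda>s. \<Phi> s z) has_vector_derivative ham_field (\<Phi> s z)) (at s)"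
    unfolding \<Phi>_def ham_field_def fst_conv snd_conv by (rule has_vector_derivative_Pair)
qed

lemma solution_deriv:
  assumes "solution Z"
  shows "((\<lambda>s. fst (Z s)) has_vector_derivative 2 *\<^sub>R (a (fst (Z s)) *v snd (Z s))) (at s)"
    and "((\<lambda>s. snd (Z s)) has_vector_derivative - force (fst (Z s)) (snd (Z s))) (at s)"
  using assms bounded_linear.has_vector_derivative[OF bounded_linear_fst, of Z "ham_field (Z s)"]
    bounded_linear.has_vector_derivative[OF bounded_linear_snd, of Z "ham_field (Z s)"]
  unfolding solution_def ham_field_def by auto

definition energy :: "'n phase \<Rightarrow> real" where
  "energy z = (\<Sum>j\<in>UNIV. \<Sum>k\<in>UNIV. a (fst z) $ j $ k * snd z $ j * snd z $ k)"

lemma energy_has_derivative: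
  "(energy has_derivative (\<lambda>v. fst v \<bullet> force (fst z) (snd z) + 2 * ((a (fst z) *v snd z) \<bullet> snd v))) (at z)"
proof -
  let ?x = "fst z" and ?\<xi> = "snd z"
  let ?a = "a ?x" and ?f = "force ?x ?\<xi>"
  let ?d = "\<lambda>v j k. dir_deriv (fst v) (\<lambda>x. a x $ j $ k) ?x"
  have da: "((\<lambda>z. a (fst z) $ j $ k) has_derivative (\<lambda>v. ?d v j k)) (at z)" for j k
    by (rule has_derivative_compose[OF has_derivative_fst[OF has_derivative_ident]
          has_derivative_dir_deriv[OF coeff_differentiable]])
  have d\<xi>: "((\<lambda>z. snd z $ j) has_derivative (\<lambda>v. snd v $ j)) (at z)" for j
    by (rule bounded_linear.has_derivative[OF bounded_linear_vec_nth has_derivative_snd[OF has_derivative_ident]])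
  have D: "(energy has_derivative (\<lambda>v. \<Sum>j\<in>UNIV. \<Sum>k\<in>UNIV. ?a $ j $ k * ?\<xi> $ j * snd v $ k
      + (?a $ j $ k * snd v $ j + ?d v j k * ?\<xi> $ j) * ?\<xi> $ k)) (at z)"
    unfolding energy_def[abs_def] by (intro has_derivative_sum has_derivative_mult da d\<xi>)
  have "(\<Sum>j\<in>UNIV. \<Sum>k\<in>UNIV. ?a $ j $ k * ?\<xi> $ j * snd v $ k
      + (?a $ j $ k * snd v $ j + ?d v j k * ?\<xi> $ j) * ?\<xi> $ k)
      = fst v \<bullet> ?f + 2 * ((?a *v ?\<xi>) \<bullet> snd v)" for v
  proof -
    have "(\<Sum>j\<in>UNIV. \<Sum>k\<in>UNIV. ?d v j k * ?\<xi> $ j * ?\<xi> $ k) = fst v \<bullet> ?f"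
    proof -
      have "(\<Sum>j\<in>UNIV. \<Sum>k\<in>UNIV. ?d v j k * ?\<xi> $ j * ?\<xi> $ k)
        = (\<Sum>j\<in>UNIV. \<Sum>i\<in>UNIV. \<Sum>k\<in>UNIV. fst v $ i * (dir_deriv (axis i 1) (\<lambda>x. a x $ j $ k) ?x * ?\<xi> $ j * ?\<xi> $ k))"
        unfolding coeff_dir_deriv[of "fst v"] sum_distrib_right by (subst sum.swap) (simp only: mult.assoc)
      also have "\<dots> = (\<Sum>i\<in>UNIV. fst v $ i * ?f $ i)"
        by (subst sum.swap) (simp only: force_def vec_lambda_beta sum_distrib_left)
      finally show ?thesis by (simp add: inner_vec_def)
    qed
    moreover have "(\<Sum>j\<in>UNIV. \<Sum>k\<in>UNIV. ?a $ j $ k * snd v $ j * ?\<xi> $ k) = (?a *v ?\<xi>) \<bullet> snd v"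
      by (simp add: inner_vec_def matrix_vector_mult_def sum_distrib_left sum_distrib_right mult_ac)
    moreover have "(\<Sum>j\<in>UNIV. \<Sum>k\<in>UNIV. ?a $ j $ k * ?\<xi> $ j * snd v $ k) = (?a *v ?\<xi>) \<bullet> snd v"
    proof -
      have sym: "?a $ j $ k = ?a $ k $ j" for j k
        using symmetric unfolding coeffs_symmetric_def transpose_def by (metis vec_lambda_beta)
      show ?thesis
        by (subst sum.swap, subst sym)
          (simp add: inner_vec_def matrix_vector_mult_def sum_distrib_left sum_distrib_right mult_ac)
    qed
    ultimately show ?thesis by (simp add: distrib_right sum.distrib)
  qed
  with D show ?thesis by simp
qed

lemma energy_conserved:
  assumes "solution Z"
  shows "energy (Z t) = energy (Z 0)"
proof -
  have "((\<lambda>s. energy (Z s)) has_real_derivative 0) (at s)" for s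
  proof -
    have Z: "(Z has_derivative (\<lambda>h. h *\<^sub>R ham_field (Z s))) (at s)"
      using assms by (simp add: solution_def has_vector_derivative_def)
    have "((\<lambda>s. energy (Z s)) has_derivative (\<lambda>h. 0)) (at s)"
      using has_derivative_compose[OF Z energy_has_derivative]
      by (simp add: ham_field_def inner_commute)
    then show ?thesis by (simp add: has_field_derivative_def lambda_zero)
  qed
  then show ?thesis using DERIV_const_ratio_const[of t 0 "\<lambda>s. energy (Z s)" 0] by (cases "t = 0") auto
qed

lemma energy_bounds: "inverse C * (norm (snd z))\<^sup>2 \<le> energy z" "energy z \<le> C * (norm (snd z))\<^sup>2"
  using elliptic unfolding coeffs_elliptic_def energy_def by auto

lemma momentum_bounds:
  assumes "solution Z"
  shows "norm (snd (Z t)) \<le> C * norm (snd (Z s))"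
proof -
  have "inverse C * (norm (snd (Z t)))\<^sup>2 \<le> C * (norm (snd (Z s)))\<^sup>2"
    using energy_bounds(1)[of "Z t"] energy_bounds(2)[of "Z s"] energy_conserved[OF assms, of t]
      energy_conserved[OF assms, of s] by linarith
  then have "(norm (snd (Z t)))\<^sup>2 \<le> (C * norm (snd (Z s)))\<^sup>2"
    using C_pos by (simp add: field_simps power2_eq_square)
  then show ?thesis by (rule power2_le_imp_le) (use C_pos in auto)
qed

text \<open>
  Gronwall's argument: conservation of energy keeps both solutions in a region where the field has
  Lipschitz constant \<open>L\<close>, so the squared distance times \<open>exp (- 2 L t)\<close> decreases.  It yields uniqueness,
  hence the group and scaling laws of the flow, and also its continuous dependence on the initial data.
\<close>

lemma flow_lipschitz:
  "\<exists>L\<ge>0. \<forall>Z W t. solution Z \<longrightarrow> solution W \<longrightarrow> norm (snd (Z 0)) \<le> M \<longrightarrow> norm (snd (W 0)) \<le> M \<longrightarrow>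
     t \<ge> 0 \<longrightarrow> norm (Z t - W t) \<le> exp (L * t) * norm (Z 0 - W 0)"
proof -
  obtain L where L: "L \<ge> 0" "\<And>z w. norm (snd z) \<le> C * M \<Longrightarrow> norm (snd w) \<le> C * M \<Longrightarrow>
     norm (ham_field z - ham_field w) \<le> L * norm (z - w)"
    using ham_field_lipschitz[of "C * M"] by blast
  show ?thesis
  proof (intro exI[of _ L] conjI allI impI L(1))
    fix Z W :: "real \<Rightarrow> 'n phase" and t :: real
    assume Z: "solution Z" and W: "solution W" and M: "norm (snd (Z 0)) \<le> M" "norm (snd (W 0)) \<le> M" and t: "t \<ge> 0"
    have bound: "norm (ham_field (Z s) - ham_field (W s)) \<le> L * norm (Z s - W s)" for s
    proof (rule L(2))
      show "norm (snd (Z s)) \<le> C * M" "norm (snd (W s)) \<le> C * M"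
        using momentum_bounds[OF Z, of s 0] momentum_bounds[OF W, of s 0] M C_pos
        by (meson less_imp_le mult_left_mono order_trans)+
    qed
    let ?u = "\<lambda>s. (Z s - W s) \<bullet> (Z s - W s) * exp (- (2 * L * s))"
    have "?u t \<le> ?u 0"
    proof (rule DERIV_nonpos_imp_nonincreasing[OF t])
      fix s
      let ?d = "Z s - W s" and ?d' = "ham_field (Z s) - ham_field (W s)"
      have dv: "((\<lambda>s. Z s - W s) has_vector_derivative ?d') (at s)"
        using Z W unfolding solution_def by (intro has_vector_derivative_diff) auto
      have "((\<lambda>s. (Z s - W s) \<bullet> (Z s - W s)) has_real_derivative 2 * (?d \<bullet> ?d')) (at s)"
        using bounded_bilinear.has_vector_derivative[OF bounded_bilinear_inner dv dv]
        by (simp add: has_real_derivative_iff_has_vector_derivative inner_commute)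
      then have D: "(?u has_real_derivative 2 * (?d \<bullet> ?d') * exp (- (2 * L * s)) + (?d \<bullet> ?d) * (exp (- (2 * L * s)) * (- (2 * L)))) (at s)"
        by (auto intro!: derivative_eq_intros)
      have eq: "2 * (?d \<bullet> ?d') * exp (- (2 * L * s)) + (?d \<bullet> ?d) * (exp (- (2 * L * s)) * (- (2 * L)))
         = 2 * exp (- (2 * L * s)) * (?d \<bullet> ?d' - L * (?d \<bullet> ?d))" by (simp add: algebra_simps)
      have "?d \<bullet> ?d' \<le> L * (?d \<bullet> ?d)"
      proof -
        have "?d \<bullet> ?d' \<le> norm ?d * norm ?d'" by (rule norm_cauchy_schwarz)
        also have "\<dots> \<le> norm ?d * (L * norm ?d)" by (intro mult_left_mono bound) auto
        finally show ?thesis by (simp add: power2_norm_eq_inner[symmetric] power2_eq_square mult_ac)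
      qed
      then have "2 * exp (- (2 * L * s)) * (?d \<bullet> ?d' - L * (?d \<bullet> ?d)) \<le> 0"
        by (intro mult_nonneg_nonpos) auto
      then show "\<exists>y. (?u has_real_derivative y) (at s) \<and> y \<le> 0"
        using D unfolding eq by blast
    qed
    then have "(norm (Z t - W t))\<^sup>2 * exp (- (2 * L * t)) \<le> (norm (Z 0 - W 0))\<^sup>2"
      by (simp add: power2_norm_eq_inner)
    moreover have "exp (- (2 * L * t)) = 1 / (exp (L * t))\<^sup>2"
      using exp_double[of "L * t"] by (simp add: mult.assoc exp_minus inverse_eq_divide)
    ultimately have "(norm (Z t - W t))\<^sup>2 / (exp (L * t))\<^sup>2 \<le> (norm (Z 0 - W 0))\<^sup>2" by simp
    then have "(norm (Z t - W t))\<^sup>2 \<le> (norm (Z 0 - W 0))\<^sup>2 * (exp (L * t))\<^sup>2"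
      by (simp add: pos_divide_le_eq)
    then have "(norm (Z t - W t))\<^sup>2 \<le> (exp (L * t) * norm (Z 0 - W 0))\<^sup>2"
      by (simp add: power_mult_distrib mult.commute)
    then show "norm (Z t - W t) \<le> exp (L * t) * norm (Z 0 - W 0)"
      by (rule power2_le_imp_le) simp
  qed
qed

lemma solution_unique:
  assumes "solution Z" "t \<ge> 0"
  shows "Z t = \<Phi> t (Z 0)"
proof -
  obtain L where "\<forall>Z' W t. solution Z' \<longrightarrow> solution W \<longrightarrow> norm (snd (Z' 0)) \<le> norm (snd (Z 0)) \<longrightarrow>
     norm (snd (W 0)) \<le> norm (snd (Z 0)) \<longrightarrow> t \<ge> 0 \<longrightarrow> norm (Z' t - W t) \<le> exp (L * t) * norm (Z' 0 - W 0)"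
    using flow_lipschitz by blast
  from this[rule_format, OF assms(1) solution_\<Phi>[of "Z 0"] _ _ assms(2)]
  have "norm (Z t - \<Phi> t (Z 0)) \<le> exp (L * t) * norm (Z 0 - \<Phi> 0 (Z 0))"
    by (simp add: \<Phi>_0)
  then show ?thesis by (simp add: \<Phi>_0)
qed

lemma \<Phi>_add: "s \<ge> 0 \<Longrightarrow> \<Phi> (s + t) z = \<Phi> s (\<Phi> t z)"
proof -
  assume s: "s \<ge> 0"
  have "solution (\<lambda>s. \<Phi> (s + t) z)"
    unfolding solution_def
  proof
    fix s
    have "((\<lambda>s. \<Phi> s z) has_vector_derivative ham_field (\<Phi> (s + t) z)) (at (s + t))"
      using solution_\<Phi>[of z] by (simp add: solution_def)
    then have "((\<lambda>s. \<Phi> s z) \<circ> (\<lambda>s. s + t) has_vector_derivative 1 *\<^sub>R ham_field (\<Phi> (s + t) z)) (at s)"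
      by (intro vector_diff_chain_at) (auto intro!: derivative_eq_intros)
    then show "((\<lambda>s. \<Phi> (s + t) z) has_vector_derivative ham_field (\<Phi> (s + t) z)) (at s)"
      by (simp add: o_def)
  qed
  from solution_unique[OF this s] show ?thesis by simp
qed

lemma force_scale: "force x (c *\<^sub>R \<xi>) = c\<^sup>2 *\<^sub>R force x \<xi>"
  by (simp add: force_def vec_eq_iff sum_distrib_left power2_eq_square mult_ac)

text \<open>
  As \<open>h\<close> is homogeneous of degree \<open>2\<close> in \<open>\<xi>\<close>, multiplying the momentum by \<open>c\<close> only changes the speed
  on the ray.
\<close>

lemma \<Phi>_scale:
  assumes "t \<ge> 0"
  shows "\<Phi> t (x, c *\<^sub>R \<xi>) = (fst (\<Phi> (c * t) (x, \<xi>)), c *\<^sub>R snd (\<Phi> (c * t) (x, \<xi>)))"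
proof -
  let ?Z = "\<lambda>s. (fst (\<Phi> (c * s) (x, \<xi>)), c *\<^sub>R snd (\<Phi> (c * s) (x, \<xi>)))"
  have "solution ?Z"
    unfolding solution_def
  proof
    fix s
    have c: "((*) c has_vector_derivative c) (at s)"
      by (auto intro!: derivative_eq_intros simp: has_real_derivative_iff_has_vector_derivative[symmetric])
    note d = solution_deriv[OF solution_\<Phi>[of "(x, \<xi>)"], of "c * s"]
    have d1: "((\<lambda>s. fst (\<Phi> (c * s) (x, \<xi>))) has_vector_derivative
        c *\<^sub>R (2 *\<^sub>R (a (fst (\<Phi> (c * s) (x, \<xi>))) *v snd (\<Phi> (c * s) (x, \<xi>))))) (at s)"
      using vector_diff_chain_at[OF c d(1)] by (simp add: o_def)
    have d2: "((\<lambda>s. c *\<^sub>R snd (\<Phi> (c * s) (x, \<xi>))) has_vector_derivative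
        c *\<^sub>R (c *\<^sub>R (- force (fst (\<Phi> (c * s) (x, \<xi>))) (snd (\<Phi> (c * s) (x, \<xi>)))))) (at s)"
      using bounded_linear.has_vector_derivative[OF bounded_linear_scaleR_right vector_diff_chain_at[OF c d(2)], of c]
      by (simp add: o_def)
    show "(?Z has_vector_derivative ham_field (?Z s)) (at s)"
      using has_vector_derivative_Pair[OF d1 d2]
      by (simp add: ham_field_def force_scale matrix_vector_mult_scaleR power2_eq_square mult.commute)
  qed
  from solution_unique[OF this assms] show ?thesis by (simp add: \<Phi>_0)
qed
lemma momentum_range:
  assumes "m \<le> norm (snd z)" "norm (snd z) \<le> M"
  shows "m / C \<le> norm (snd (\<Phi> s z))" "norm (snd (\<Phi> s z)) \<le> C * M"
proof -
  note Z = solution_\<Phi>[of z]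
  have "norm (snd z) \<le> C * norm (snd (\<Phi> s z))" using momentum_bounds[OF Z, of 0 s] by (simp add: \<Phi>_0)
  then have "m \<le> C * norm (snd (\<Phi> s z))" using assms by linarith
  then show "m / C \<le> norm (snd (\<Phi> s z))" using C_pos by (simp add: field_simps)
  have "norm (snd (\<Phi> s z)) \<le> C * norm (snd z)" using momentum_bounds[OF Z, of s 0] by (simp add: \<Phi>_0)
  also have "\<dots> \<le> C * M" using assms C_pos by (intro mult_left_mono) auto
  finally show "norm (snd (\<Phi> s z)) \<le> C * M" .
qed

text \<open>
  Bounds up to second order in time that are uniform for bounded momenta; the field is Lipschitz and therefore
  varies by \<open>O(h)\<close> along the flow up to time \<open>h\<close>.
\<close>

lemma flow_second_order:
  "\<exists>B K. B \<ge> 0 \<and> K \<ge> 0 \<and> (\<forall>z h. norm (snd z) \<le> 2 \<longrightarrow> h \<ge> 0 \<longrightarrow>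
     norm (ham_field z) \<le> B \<and> norm (\<Phi> h z - z) \<le> B * h \<and>
     norm (\<Phi> h z - z - h *\<^sub>R ham_field z) \<le> K * h\<^sup>2)"
proof -
  define M where "M = max 2 (C * 2)"
  define B where "B = 2 * growth * M + growth * M\<^sup>2"
  have M0: "M \<ge> 0" by (simp add: M_def)
  have B0: "B \<ge> 0" using M0 growth_bounds(1) by (simp add: B_def)
  have B: "norm (ham_field z) \<le> B" if "norm (snd z) \<le> M" for z
  proof -
    have "norm (ham_field z) \<le> 2 * growth * norm (snd z) + growth * (norm (snd z))\<^sup>2" by (rule norm_ham_field_le)
    also have "\<dots> \<le> B" unfolding B_def
      by (intro add_mono mult_left_mono power_mono that) (use growth_bounds(1) in auto)
    finally show ?thesis .
  qed
  obtain L where L: "L \<ge> 0" "\<And>z w. norm (snd z) \<le> M \<Longrightarrow> norm (snd w) \<le> M \<Longrightarrow>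
     norm (ham_field z - ham_field w) \<le> L * norm (z - w)"
    using ham_field_lipschitz[of M] by blast
  show ?thesis
  proof (rule exI[of _ B], rule exI[of _ "L * B"], intro conjI allI impI B0)
    show "0 \<le> L * B" using L B0 by simp
    fix z :: "'n phase" and h :: real assume z: "norm (snd z) \<le> 2" and h: "h \<ge> 0"
    show "norm (ham_field z) \<le> B" using z by (intro B) (simp add: M_def)
    have mom: "norm (snd (\<Phi> s z)) \<le> M" for s
      using momentum_range(2)[OF order_refl z, of s] by (simp add: M_def)
    have der: "((\<lambda>s. \<Phi> s z) has_derivative (\<lambda>t. t *\<^sub>R ham_field (\<Phi> s z))) (at s within S)" for s S
      using solution_\<Phi>[of z] unfolding solution_def has_vector_derivative_def
      by (blast intro: has_derivative_at_withinI)
    have speed: "norm (\<Phi> s z - z) \<le> B * s" if "s \<ge> 0" for s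
    proof -
      have "norm (\<Phi> s z - \<Phi> 0 z) \<le> B * norm (s - 0)"
      proof (rule differentiable_bound[OF convex_UNIV der])
        show "onorm (\<lambda>t. t *\<^sub>R ham_field (\<Phi> s z)) \<le> B" for s
          by (rule onorm_bound[OF B0]) (simp add: mult.commute[of B] mult_left_mono B[OF mom])
      qed auto
      then show ?thesis using that by (simp add: \<Phi>_0)
    qed
    show "norm (\<Phi> h z - z) \<le> B * h" by (rule speed[OF h])
    let ?g = "\<lambda>s. \<Phi> s z - s *\<^sub>R ham_field z"
    have "norm (?g h - ?g 0) \<le> (L * B * h) * norm (h - 0)"
    proof (rule differentiable_bound[of "{0..h}" ?g "\<lambda>s t. t *\<^sub>R (ham_field (\<Phi> s z) - ham_field z)"])
      fix s assume s: "s \<in> {0..h}"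
      show "(?g has_derivative (\<lambda>t. t *\<^sub>R (ham_field (\<Phi> s z) - ham_field z))) (at s within {0..h})"
        using der[of s "{0..h}"] by (auto intro!: derivative_eq_intros simp: scaleR_diff_right)
      have "norm (ham_field (\<Phi> s z) - ham_field z) \<le> L * norm (\<Phi> s z - z)"
        by (rule L(2)[OF mom]) (use z in \<open>simp add: M_def\<close>)
      also have "\<dots> \<le> L * (B * h)"
        using speed[of s] s B0 L(1) by (intro mult_left_mono order_trans[OF speed mult_left_mono]) auto
      finally have le: "norm (ham_field (\<Phi> s z) - ham_field z) \<le> L * B * h" by (simp add: mult.assoc)
      show "onorm (\<lambda>t. t *\<^sub>R (ham_field (\<Phi> s z) - ham_field z)) \<le> L * B * h"
        by (rule onorm_bound) (use L B0 h le in \<open>simp_all add: mult.commute[of _ "\<bar>_\<bar>"] mult_left_mono\<close>)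
    qed (use h in auto)
    then show "norm (\<Phi> h z - z - h *\<^sub>R ham_field z) \<le> L * B * h\<^sup>2"
      using h by (simp add: \<Phi>_0 power2_eq_square algebra_simps)
  qed
qed

section \<open>Nontrapping rays leave every ball in uniform time\<close>

definition virial :: "'n phase \<Rightarrow> real" where "virial z = fst z \<bullet> snd z"

text \<open>
  Beyond this radius the perturbation of the flat metric is too weak to bend rays back.
\<close>

definition free_radius :: real where "free_radius = max 1 (C * growth)"

lemma abs_virial_le: "\<bar>virial z\<bar> \<le> norm (fst z) * norm (snd z)"
  unfolding virial_def by (rule Cauchy_Schwarz_ineq2)

lemma metric_inner: "snd z \<bullet> (a (fst z) *v snd z) = energy z"
  by (simp add: energy_def inner_vec_def matrix_vector_mult_def sum_distrib_right sum_distrib_left mult_ac)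

lemma virial_deriv:
  assumes "solution Z"
  shows "((\<lambda>s. virial (Z s)) has_real_derivative
     (2 * energy (Z s) - fst (Z s) \<bullet> force (fst (Z s)) (snd (Z s)))) (at s)"
  using bounded_bilinear.has_vector_derivative[OF bounded_bilinear_inner solution_deriv[OF assms], of s]
  by (simp add: has_real_derivative_iff_has_vector_derivative virial_def metric_inner inner_commute)

text \<open>
  The derivative of \<open>x \<bullet> \<xi>\<close> along the flow is \<open>2 h - x \<bullet> \<nabla>\<^sub>x h\<close>.  By ellipticity \<open>h \<ge> \<bar>\<xi>\<bar>\<^sup>2 / C\<close>, and the
  second term is \<open>O(\<bar>\<xi>\<bar>\<^sup>2 / \<bar>x\<bar>)\<close> because \<open>\<nabla>a\<close> decays quadratically.
\<close>

lemma virial_deriv_lower: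
  assumes "norm (fst z) \<ge> free_radius"
  shows "2 * energy z - fst z \<bullet> force (fst z) (snd z) \<ge> (norm (snd z))\<^sup>2 / C"
proof -
  let ?x = "norm (fst z)" and ?J = "jb (fst z)" and ?\<xi> = "(norm (snd z))\<^sup>2"
  have x: "?x \<ge> 1" "?x \<ge> C * growth" using assms by (auto simp: free_radius_def)
  have "\<bar>fst z \<bullet> force (fst z) (snd z)\<bar> \<le> ?x * (growth / ?J\<^sup>2 * ?\<xi>)"
    by (rule order_trans[OF Cauchy_Schwarz_ineq2 mult_left_mono[OF norm_force_le]]) simp
  also have "\<dots> \<le> ?x * (growth / ?x\<^sup>2 * ?\<xi>)"
  proof (intro mult_left_mono mult_right_mono divide_left_mono power_mono norm_le_jb)
    have "?x > 0" using x(1) by linarith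
    then show "0 < ?J\<^sup>2 * ?x\<^sup>2" using jb_gt0[of "fst z"] by (intro mult_pos_pos zero_less_power)
  qed (use growth_bounds(1) in auto)
  also have "\<dots> = growth / ?x * ?\<xi>" using x by (simp add: power2_eq_square)
  also have "\<dots> \<le> (1 / C) * ?\<xi>"
  proof (intro mult_right_mono)
    have "?x > 0" using x(1) by linarith
    then show "growth / ?x \<le> 1 / C"
      using x(2) C_pos by (intro mult_imp_le_div_pos) (simp_all add: pos_divide_le_eq mult.commute)
  qed simp
  finally have "\<bar>fst z \<bullet> force (fst z) (snd z)\<bar> \<le> (1 / C) * ?\<xi>" .
  moreover have "energy z \<ge> (1 / C) * ?\<xi>" using energy_bounds(1)[of z] by (simp add: inverse_eq_divide)
  ultimately show ?thesis by (simp add: abs_le_iff)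
qed

lemma solution_continuous: "solution Z \<Longrightarrow> continuous_on UNIV Z"
  unfolding solution_def continuous_on_eq_continuous_at[OF open_UNIV]
  by (blast intro: has_vector_derivative_continuous)

lemma virial_growth:
  assumes Z: "solution Z" and "s \<le> t" and far: "\<And>u. s < u \<Longrightarrow> u < t \<Longrightarrow> norm (fst (Z u)) \<ge> free_radius"
    and m: "\<And>u. (norm (snd (Z u)))\<^sup>2 / C \<ge> m"
  shows "virial (Z t) \<ge> virial (Z s) + (t - s) * m"
proof (cases "s = t")
  case False
  then have "s < t" using assms by simp
  then obtain u where u: "s < u" "u < t" and
    eq: "virial (Z t) - virial (Z s) = (t - s) * (2 * energy (Z u) - fst (Z u) \<bullet> force (fst (Z u)) (snd (Z u)))"
    using MVT2[of s t "\<lambda>s. virial (Z s)", OF _ virial_deriv[OF Z]] by blast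
  have "m \<le> 2 * energy (Z u) - fst (Z u) \<bullet> force (fst (Z u)) (snd (Z u))"
    using virial_deriv_lower[OF far[OF u]] m[of u] by linarith
  then have "(t - s) * m \<le> virial (Z t) - virial (Z s)"
    unfolding eq using \<open>s < t\<close> by (intro mult_left_mono) auto
  then show ?thesis by linarith
qed simp

text \<open>
  Inside the ball of radius \<open>R\<close> the virial is at most \<open>R M\<close>, and outside it cannot decrease.  A ray on
  which it exceeds \<open>R M\<close> could only come back to the ball with a virial above \<open>R M\<close>.
\<close>

lemma outgoing_stays_out:
  assumes Z: "solution Z" and M: "\<And>s. norm (snd (Z s)) \<le> M" and R: "R \<ge> free_radius"
    and out: "virial (Z t\<^sub>0) > R * M" and "t\<^sub>0 \<le> t"
  shows "norm (fst (Z t)) > R"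
proof (rule ccontr)
  assume "\<not> norm (fst (Z t)) > R"
  define S where "S = {s \<in> {t\<^sub>0..t}. norm (fst (Z s)) \<le> R}"
  have "continuous_on UNIV (\<lambda>s. norm (fst (Z s)))"
    using solution_continuous[OF Z] by (intro continuous_intros)
  then have "closed ({t\<^sub>0..t} \<inter> {s. norm (fst (Z s)) \<le> R})"
    by (intro closed_Int closed_Collect_le continuous_on_const closed_atLeastAtMost)
  moreover have "S = {t\<^sub>0..t} \<inter> {s. norm (fst (Z s)) \<le> R}" by (auto simp: S_def)
  ultimately have "closed S" by simp
  moreover have t: "t \<in> S" using \<open>\<not> _\<close> \<open>t\<^sub>0 \<le> t\<close> by (auto simp: S_def)
  moreover have bdd: "bdd_below S" by (auto simp: S_def)
  ultimately have "Inf S \<in> S" using closed_contains_Inf by blast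
  then have *: "t\<^sub>0 \<le> Inf S" "norm (fst (Z (Inf S))) \<le> R" by (auto simp: S_def)
  have "norm (fst (Z u)) \<ge> free_radius" if "t\<^sub>0 < u" "u < Inf S" for u
  proof -
    have "u \<notin> S" using that bdd cInf_lower by (meson leD)
    moreover have "u \<le> t" using that cInf_lower[OF t bdd] by linarith
    ultimately show ?thesis using that R by (auto simp: S_def)
  qed
  then have "virial (Z (Inf S)) \<ge> virial (Z t\<^sub>0) + (Inf S - t\<^sub>0) * 0"
    by (rule virial_growth[OF Z *(1)]) (use C_pos in auto)
  moreover have "virial (Z (Inf S)) \<le> R * M"
  proof -
    have "virial (Z (Inf S)) \<le> norm (fst (Z (Inf S))) * norm (snd (Z (Inf S)))"
      using abs_virial_le by (meson abs_le_D1)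
    also have "\<dots> \<le> R * M" using R by (intro mult_mono *(2) M) (auto simp: free_radius_def)
    finally show ?thesis .
  qed
  ultimately show False using out by simp
qed

lemma position_speed:
  assumes Z: "solution Z" and M: "\<And>s. norm (snd (Z s)) \<le> M" and "s \<le> t"
  shows "norm (fst (Z t) - fst (Z s)) \<le> (2 * growth * M) * (t - s)"
proof -
  have "norm (fst (Z t) - fst (Z s)) \<le> (2 * growth * M) * norm (t - s)"
  proof (rule differentiable_bound[of UNIV _ "\<lambda>u h. h *\<^sub>R (2 *\<^sub>R (a (fst (Z u)) *v snd (Z u)))"])
    show "((\<lambda>s. fst (Z s)) has_derivative (\<lambda>h. h *\<^sub>R 2 *\<^sub>R (a (fst (Z u)) *v snd (Z u)))) (at u within UNIV)" for u
      using solution_deriv(1)[OF Z] by (simp add: has_vector_derivative_def)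
    show "onorm (\<lambda>h. h *\<^sub>R 2 *\<^sub>R (a (fst (Z u)) *v snd (Z u))) \<le> 2 * growth * M" for u
    proof (rule onorm_bound)
      show "0 \<le> 2 * growth * M" using growth_bounds(1) order_trans[OF norm_ge_zero M[of 0]] by simp
      have "norm (a (fst (Z u)) *v snd (Z u)) \<le> growth * M"
        using order_trans[OF norm_metric_le mult_left_mono[OF M]] growth_bounds(1) by simp
      then show "norm (h *\<^sub>R 2 *\<^sub>R (a (fst (Z u)) *v snd (Z u))) \<le> 2 * growth * M * norm h" for h :: real
        using mult_left_mono[of "norm (a (fst (Z u)) *v snd (Z u))" "growth * M" "2 * \<bar>h\<bar>"]
        by (simp add: abs_mult mult_ac)
    qed
  qed auto
  then show ?thesis using \<open>s \<le> t\<close> by simp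
qed

text \<open>
  Being unbounded, the ray has to travel far from the last point in a large ball.  At bounded speed this takes
  a long time, during which the virial grows at a rate bounded below.
\<close>

lemma becomes_outgoing:
  assumes "snd z \<noteq> 0"
  shows "\<exists>t\<ge>0. virial (\<Phi> t z) > K"
proof -
  note Z = solution_\<Phi>[of z]
  define M where "M = C * norm (snd z)"
  define m where "m = (norm (snd z) / C)\<^sup>2 / C"
  have M: "norm (snd (\<Phi> s z)) \<le> M" for s
    using momentum_bounds[OF Z, of s 0] by (simp add: M_def \<Phi>_0)
  have m0: "m > 0" using assms C_pos by (simp add: m_def)
  have m: "(norm (snd (\<Phi> s z)))\<^sup>2 / C \<ge> m" for s
  proof -
    have "norm (snd z) / C \<le> norm (snd (\<Phi> s z))"
      using momentum_bounds[OF Z, of 0 s] C_pos by (simp add: \<Phi>_0 field_simps)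
    then show ?thesis unfolding m_def using C_pos by (intro divide_right_mono power_mono) auto
  qed
  define R where "R = max free_radius (norm (fst z))"
  \<comment> \<open>After this time the virial has grown from at least \<open>- R M\<close> to more than \<open>K\<close>.\<close>
  define \<tau> where "\<tau> = (\<bar>K\<bar> + R * M) / m + 1"
  have R: "R \<ge> 1" by (auto simp: R_def free_radius_def)
  have M0: "M > 0" using assms C_pos by (simp add: M_def)
  have \<tau>: "\<tau> > 0" using R M0 m0 by (auto simp: \<tau>_def intro!: add_nonneg_pos)
  have "\<not> bounded {fst (\<Phi> s z) | s. s > 0}"
    using nontrapping assms unfolding nontrapping_def \<Phi>_def by auto
  then obtain t where t: "t > 0" "norm (fst (\<Phi> t z)) > R + 2 * growth * M * \<tau>"
    unfolding bounded_iff by (auto simp: not_le)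
  define S where "S = {s \<in> {0..t}. norm (fst (\<Phi> s z)) \<le> R}"
  have "continuous_on UNIV (\<lambda>s. norm (fst (\<Phi> s z)))"
    using solution_continuous[OF Z] by (intro continuous_intros)
  then have "closed ({0..t} \<inter> {s. norm (fst (\<Phi> s z)) \<le> R})"
    by (intro closed_Int closed_Collect_le continuous_on_const closed_atLeastAtMost)
  moreover have "S = {0..t} \<inter> {s. norm (fst (\<Phi> s z)) \<le> R}" by (auto simp: S_def)
  ultimately have "closed S" by simp
  moreover have 0: "0 \<in> S" using t by (auto simp: S_def R_def \<Phi>_0)
  moreover have bdd: "bdd_above S" by (auto simp: S_def)
  ultimately have "Sup S \<in> S" using closed_contains_Sup by blast
  then have *: "0 \<le> Sup S" "Sup S \<le> t" "norm (fst (\<Phi> (Sup S) z)) \<le> R" by (auto simp: S_def)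
  have far: "norm (fst (\<Phi> u z)) \<ge> free_radius" if "Sup S < u" "u < t" for u
  proof -
    have "u \<notin> S" using that bdd cSup_upper by (meson leD)
    then show ?thesis using that * by (auto simp: S_def R_def)
  qed
  have "R + 2 * growth * M * \<tau> < R + 2 * growth * M * (t - Sup S)"
    using position_speed[OF Z M *(2)] t(2) *(3) norm_triangle_ineq2[of "fst (\<Phi> t z)" "fst (\<Phi> (Sup S) z)"]
    by linarith
  then have "(2 * growth * M) * \<tau> < (2 * growth * M) * (t - Sup S)" by linarith
  moreover have "2 * growth * M > 0" using growth_bounds(1) M0 by simp
  ultimately have "\<tau> < t - Sup S" using mult_less_cancel_left_pos by blast
  then have "\<tau> * m \<le> (t - Sup S) * m" using m0 by (intro mult_right_mono) auto
  moreover have "\<tau> * m = \<bar>K\<bar> + R * M + m" using m0 by (simp add: \<tau>_def field_simps)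
  moreover have "virial (\<Phi> t z) \<ge> virial (\<Phi> (Sup S) z) + (t - Sup S) * m"
    by (rule virial_growth[OF Z *(2) far m])
  moreover have "\<bar>virial (\<Phi> (Sup S) z)\<bar> \<le> R * M"
    by (rule order_trans[OF abs_virial_le mult_mono]) (use * M R in auto)
  ultimately have "virial (\<Phi> t z) > K" using m0 by linarith
  then show ?thesis using t by (intro exI[of _ t]) auto
qed

lemma \<Phi>_continuous: "t \<ge> 0 \<Longrightarrow> continuous_on UNIV (\<Phi> t)"
  unfolding continuous_on_iff
proof (intro ballI allI impI)
  fix z :: "'n phase" and e :: real assume t: "t \<ge> 0" and e: "e > 0"
  obtain L where L: "\<forall>Z W t. solution Z \<longrightarrow> solution W \<longrightarrow> norm (snd (Z 0)) \<le> norm (snd z) + 1 \<longrightarrow>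
     norm (snd (W 0)) \<le> norm (snd z) + 1 \<longrightarrow> t \<ge> 0 \<longrightarrow> norm (Z t - W t) \<le> exp (L * t) * norm (Z 0 - W 0)"
    using flow_lipschitz[of "norm (snd z) + 1"] by blast
  define d where "d = min 1 (e / exp (L * t))"
  show "\<exists>d>0. \<forall>w\<in>UNIV. dist w z < d \<longrightarrow> dist (\<Phi> t w) (\<Phi> t z) < e"
  proof (intro exI[of _ d] conjI ballI impI)
    show "d > 0" using e by (simp add: d_def)
    fix w assume w: "dist w z < d"
    have "norm (snd w) \<le> norm (snd z) + norm (snd w - snd z)" by (metis add.commute diff_add_cancel norm_triangle_ineq)
    also have "norm (snd w - snd z) \<le> 1"
      using dist_snd_le[of w z] w by (simp add: d_def dist_norm)
    finally have "norm (snd w) \<le> norm (snd z) + 1" by simp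
    then have "norm (\<Phi> t w - \<Phi> t z) \<le> exp (L * t) * norm (w - z)"
      using L[rule_format, OF solution_\<Phi>[of w] solution_\<Phi>[of z] _ _ t] by (simp add: \<Phi>_0)
    also have "\<dots> < exp (L * t) * (e / exp (L * t))"
      using w by (intro mult_strict_left_mono) (auto simp: d_def dist_norm)
    finally show "dist (\<Phi> t w) (\<Phi> t z) < e" by (simp add: dist_norm)
  qed
qed

text \<open>
  The virial reaches a value from which the ray does not return at some time depending on the initial point,
  which is an open condition on that point; compactness makes the time uniform.
\<close>

lemma escape_time:
  assumes m: "m > 0" and R: "R \<ge> free_radius"
  shows "\<exists>T\<ge>0. \<forall>z t. norm (fst z) \<le> R \<longrightarrow> m \<le> norm (snd z) \<longrightarrow> norm (snd z) \<le> M \<longrightarrow> T \<le> t \<longrightarrow>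
    norm (fst (\<Phi> t z)) > R"
proof -
  define K :: "'n phase set" where "K = cball 0 R \<times> (cball 0 M - ball 0 m)"
  have "compact K" unfolding K_def by (intro compact_Times compact_diff) auto
  define U where "U = (\<lambda>t. {z. virial (\<Phi> t z) > R * (C * M)})"
  have "open (U t)" if "t \<in> {0..}" for t
  proof -
    have "continuous_on UNIV (\<lambda>z. virial (\<Phi> t z))"
      unfolding virial_def using \<Phi>_continuous[of t] that by (intro continuous_intros) auto
    then show ?thesis unfolding U_def by (intro open_Collect_less continuous_on_const)
  qed
  moreover have "K \<subseteq> (\<Union>t\<in>{0..}. U t)"
  proof
    fix z assume "z \<in> K"
    then have "snd z \<noteq> 0" using m by (auto simp: K_def)
    then obtain t where "t \<ge> 0" "virial (\<Phi> t z) > R * (C * M)" using becomes_outgoing by blast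
    then show "z \<in> (\<Union>t\<in>{0..}. U t)" unfolding U_def by (intro UN_I[of t]) auto
  qed
  ultimately obtain I where I: "I \<subseteq> {0..}" "finite I" "K \<subseteq> (\<Union>t\<in>I. U t)"
    by (rule compactE_image[OF \<open>compact K\<close>])
  show ?thesis
  proof (intro exI[of _ "Max (insert 0 I)"] conjI allI impI)
    show "Max (insert 0 I) \<ge> 0" using I by auto
    fix z :: "'n phase" and t assume z: "norm (fst z) \<le> R" "m \<le> norm (snd z)" "norm (snd z) \<le> M" and t: "Max (insert 0 I) \<le> t"
    have "z \<in> K" using z by (auto simp: K_def mem_Times_iff)
    then obtain t0 where t0: "t0 \<in> I" "virial (\<Phi> t0 z) > R * (C * M)" using I by (auto simp: U_def)
    have "norm (snd (\<Phi> s z)) \<le> C * M" for s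
      by (rule momentum_range(2)[OF order_refl z(3)])
    moreover have "t0 \<le> t"
      by (rule order_trans[OF Max_ge t]) (use t0(1) I(2) in auto)
    ultimately show "norm (fst (\<Phi> t z)) > R"
      using outgoing_stays_out[OF solution_\<Phi>[of z] _ R t0(2)] by blast
  qed
qed

section \<open>A Lipschitz escape function from passage times\<close>

text \<open>
  The factor \<open>\<bar>\<xi>\<bar>\<close> makes \<open>passage\<close> homogeneous of degree \<open>0\<close> in \<open>\<xi>\<close>, up to the rescaling of its
  time horizon.
\<close>

definition weight :: "real \<Rightarrow> 'n phase \<Rightarrow> real" where
  "weight R z = cutoff R 1 (fst z) * norm (snd z)"

definition passage :: "real \<Rightarrow> real \<Rightarrow> 'n phase \<Rightarrow> real" where
  "passage R T z = integral {0..T} (\<lambda>s. weight R (\<Phi> s z))"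

lemma weight_range: "0 \<le> weight R z" "weight R z \<le> norm (snd z)"
  using cutoff_range[of R 1 "fst z"] by (auto simp: weight_def mult_left_le_one_le)

lemma weight_outside: "norm (fst z) \<ge> R + 1 \<Longrightarrow> weight R z = 0"
  by (simp add: weight_def cutoff_outside)

lemma weight_continuous: "continuous_on S (\<lambda>s. weight R (\<Phi> s z))"
proof -
  have c: "continuous_on S (\<lambda>s. \<Phi> s z)"
    by (rule continuous_on_subset[OF solution_continuous[OF solution_\<Phi>]]) simp
  show ?thesis unfolding weight_def by (intro continuous_on_cutoff continuous_intros c) simp
qed

lemma weight_integrable: "(\<lambda>s. weight R (\<Phi> s z)) integrable_on {c..d}"
  by (rule integrable_continuous_interval[OF weight_continuous])

text \<open>
  Only the time after the first entry into the ball of radius \<open>R + 1\<close> contributes, and after that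
  entry the ray leaves the ball for good within a uniform time.  Thus the bound does not depend on how far
  away the ray starts, which is essential for the later choice of scales.
\<close>

lemma passage_bounded:
  assumes R: "R \<ge> free_radius"
  shows "\<exists>B\<ge>0. \<forall>T z. T \<ge> 0 \<longrightarrow> 1/2 \<le> norm (snd z) \<longrightarrow> norm (snd z) \<le> 2 \<longrightarrow>
     0 \<le> passage R T z \<and> passage R T z \<le> B"
proof -
  define m where "m = (1/2) / C"
  have m: "m > 0" using C_pos by (simp add: m_def)
  have R': "R + 1 \<ge> free_radius" using R by simp
  obtain E where E: "E \<ge> 0" "\<And>z t. norm (fst z) \<le> R + 1 \<Longrightarrow> m \<le> norm (snd z) \<Longrightarrow> norm (snd z) \<le> C * 2 \<Longrightarrow>
      E \<le> t \<Longrightarrow> norm (fst (\<Phi> t z)) > R + 1"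
    using escape_time[OF m R', of "C * 2"] by blast
  show ?thesis
  proof (intro exI[of _ "C * 2 * E"] conjI allI impI)
    show "0 \<le> C * 2 * E" using C_pos E by simp
    fix T :: real and z :: "'n phase" assume T: "T \<ge> 0" and z: "1/2 \<le> norm (snd z)" "norm (snd z) \<le> 2"
    show "0 \<le> passage R T z" unfolding passage_def
      by (rule integral_nonneg[OF weight_integrable]) (simp add: weight_range)
    define S where "S = {s \<in> {0..T}. norm (fst (\<Phi> s z)) \<le> R + 1}"
    show "passage R T z \<le> C * 2 * E"
    proof (cases "S = {}")
      case True
      have "weight R (\<Phi> s z) = 0" if "s \<in> {0..T}" for s
      proof (rule weight_outside)
        have "s \<notin> S" using True by simp
        then show "norm (fst (\<Phi> s z)) \<ge> R + 1" using that by (simp add: S_def)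
      qed
      then have "passage R T z = integral {0..T} (\<lambda>s. 0)" unfolding passage_def by (intro integral_cong) auto
      then show ?thesis using C_pos E by simp
    next
      case False
      have "continuous_on UNIV (\<lambda>s. norm (fst (\<Phi> s z)))"
        by (intro continuous_intros solution_continuous solution_\<Phi>)
      then have "closed ({0..T} \<inter> {s. norm (fst (\<Phi> s z)) \<le> R + 1})"
        by (intro closed_Int closed_Collect_le continuous_on_const closed_atLeastAtMost)
      moreover have "S = {0..T} \<inter> {s. norm (fst (\<Phi> s z)) \<le> R + 1}" by (auto simp: S_def)
      ultimately have "closed S" by simp
      moreover have bdd: "bdd_below S" by (auto simp: S_def)
      ultimately have "Inf S \<in> S" using closed_contains_Inf False by blast
      then have t0: "0 \<le> Inf S" "Inf S \<le> T" "norm (fst (\<Phi> (Inf S) z)) \<le> R + 1" by (auto simp: S_def)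
      \<comment> \<open>The integral is split at the entry time \<open>Inf S\<close> and at the time when the ray has left for good.\<close>
      define T' where "T' = max T (Inf S + E)"
      have before: "weight R (\<Phi> s z) = 0" if "s \<in> {0..Inf S} - {Inf S}" for s
      proof -
        have "s \<notin> S" using that cInf_lower[OF _ bdd, of s] by auto
        then have "norm (fst (\<Phi> s z)) \<ge> R + 1" using that t0(2) by (auto simp: S_def)
        then show ?thesis by (rule weight_outside)
      qed
      have after: "weight R (\<Phi> s z) = 0" if "s \<ge> Inf S + E" for s
      proof -
        have "norm (fst (\<Phi> (s - Inf S) (\<Phi> (Inf S) z))) > R + 1"
          using momentum_range[OF z, of "Inf S"] t0(3) that by (intro E(2)) (auto simp: m_def)
        then show ?thesis using \<Phi>_add[of "s - Inf S" "Inf S" z] that E(1) by (intro weight_outside) auto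
      qed
      have "passage R T z \<le> integral {0..T'} (\<lambda>s. weight R (\<Phi> s z))"
        unfolding passage_def by (intro integral_subset_le weight_integrable) (auto simp: T'_def weight_range)
      also have "\<dots> = integral {0..Inf S} (\<lambda>s. weight R (\<Phi> s z)) + integral {Inf S..Inf S + E} (\<lambda>s. weight R (\<Phi> s z))
          + integral {Inf S + E..T'} (\<lambda>s. weight R (\<Phi> s z))"
        using t0 E by (simp add: Henstock_Kurzweil_Integration.integral_combine weight_integrable T'_def)
      also have "integral {0..Inf S} (\<lambda>s. weight R (\<Phi> s z)) = integral {0..Inf S} (\<lambda>s. 0)"
        by (rule integral_spike[of "{Inf S}"]) (use before in auto)
      also have "integral {Inf S + E..T'} (\<lambda>s. weight R (\<Phi> s z)) = integral {Inf S + E..T'} (\<lambda>s. 0)"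
        by (rule integral_cong) (use after in auto)
      also have "integral {Inf S..Inf S + E} (\<lambda>s. weight R (\<Phi> s z)) \<le> (C * 2) * (Inf S + E - Inf S)"
      proof -
        have "norm (weight R (\<Phi> s z)) \<le> C * 2" for s
          using weight_range[of R "\<Phi> s z"] momentum_range(2)[OF z, of s] by simp
        then have "norm (integral {Inf S..Inf S + E} (\<lambda>s. weight R (\<Phi> s z))) \<le> (C * 2) * (Inf S + E - Inf S)"
          by (intro integral_bound weight_continuous) (use E in auto)
        then show ?thesis by simp
      qed
      finally show ?thesis by simp
    qed
  qed
qed

text \<open>
  The constant is exponential in the time horizon.  This is harmless because the width of the mollifier is
  chosen last.
\<close>

lemma passage_lipschitz:
  assumes T: "T \<ge> 0"
  shows "\<exists>L\<ge>0. \<forall>z w. norm (snd z) \<le> 2 \<longrightarrow> norm (snd w) \<le> 2 \<longrightarrow>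
    \<bar>passage R T z - passage R T w\<bar> \<le> L * norm (z - w)"
proof -
  define S :: "'n phase set" where "S = {z. norm (snd z) \<le> C * 2}"
  have "bounded_lipschitz S (\<lambda>z. norm (snd z))"
  proof (rule bounded_lipschitzI)
    show "\<bar>norm (snd z)\<bar> \<le> C * 2" if "z \<in> S" for z using that by (simp add: S_def)
    show "\<bar>norm (snd z) - norm (snd w)\<bar> \<le> 1 * dist z w" for z w :: "'n phase"
      using norm_triangle_ineq3[of "snd z" "snd w"] dist_snd_le[of z w] by (simp add: dist_norm)
  qed
  then have "bounded_lipschitz S (weight R)"
    unfolding weight_def by (intro bounded_lipschitz_mult bounded_lipschitz_fst[OF bounded_lipschitz_cutoff] subset_UNIV) simp
  then obtain K where K: "K \<ge> 0" "\<forall>z\<in>S. \<forall>w\<in>S. \<bar>weight R z - weight R w\<bar> \<le> K * dist z w"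
    unfolding bounded_lipschitz_def by blast
  obtain L where L0: "L \<ge> 0" and L: "\<forall>Z W t. solution Z \<longrightarrow> solution W \<longrightarrow> norm (snd (Z 0)) \<le> 2 \<longrightarrow>
     norm (snd (W 0)) \<le> 2 \<longrightarrow> t \<ge> 0 \<longrightarrow> norm (Z t - W t) \<le> exp (L * t) * norm (Z 0 - W 0)"
    using flow_lipschitz[of 2] by blast
  show ?thesis
  proof (intro exI[of _ "K * exp (L * T) * T"] conjI allI impI)
    show "0 \<le> K * exp (L * T) * T" using K T by simp
    fix z w :: "'n phase" assume z: "norm (snd z) \<le> 2" and w: "norm (snd w) \<le> 2"
    have "passage R T z - passage R T w = integral {0..T} (\<lambda>s. weight R (\<Phi> s z) - weight R (\<Phi> s w))"
      unfolding passage_def by (intro Henstock_Kurzweil_Integration.integral_diff[symmetric] weight_integrable)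
    also have "norm \<dots> \<le> (K * (exp (L * T) * norm (z - w))) * (T - 0)"
    proof (rule integral_bound[OF T])
      show "continuous_on {0..T} (\<lambda>s. weight R (\<Phi> s z) - weight R (\<Phi> s w))"
        by (intro continuous_on_diff weight_continuous)
      fix s assume s: "s \<in> {0..T}"
      have "\<Phi> s z \<in> S" "\<Phi> s w \<in> S"
        using momentum_range(2)[OF order_refl z, of s] momentum_range(2)[OF order_refl w, of s] by (auto simp: S_def)
      then have "norm (weight R (\<Phi> s z) - weight R (\<Phi> s w)) \<le> K * norm (\<Phi> s z - \<Phi> s w)"
        using K(2) by (simp add: dist_norm)
      also have "norm (\<Phi> s z - \<Phi> s w) \<le> exp (L * s) * norm (z - w)"
        using L[rule_format, OF solution_\<Phi>[of z] solution_\<Phi>[of w], of s] z w s by (simp add: \<Phi>_0)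
      also have "\<dots> \<le> exp (L * T) * norm (z - w)"
        using s L0 by (intro mult_right_mono) (auto simp: mult_left_mono)
      finally show "norm (weight R (\<Phi> s z) - weight R (\<Phi> s w)) \<le> K * (exp (L * T) * norm (z - w))"
        using K(1) by (simp add: mult_left_mono)
    qed
    finally show "\<bar>passage R T z - passage R T w\<bar> \<le> (K * exp (L * T) * T) * norm (z - w)"
      by (simp add: mult_ac)
  qed
qed

lemma passage_shift:
  assumes "T \<ge> 0" "h \<ge> 0"
  shows "passage R T (\<Phi> h z) = passage R (T + h) z - passage R h z"
proof -
  have "passage R T (\<Phi> h z) = integral {0..T} (\<lambda>s. weight R (\<Phi> (s + h) z))"
    unfolding passage_def by (rule integral_cong) (simp add: \<Phi>_add)
  also have "\<dots> = integral {h - h..(T + h) - h} (\<lambda>s. weight R (\<Phi> (s + h) z))" by simp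
  also have "\<dots> = integral {h..T + h} (\<lambda>s. weight R (\<Phi> s z))"
    by (rule integral_shift_real_ivl)
  also have "\<dots> = passage R (T + h) z - passage R h z"
    using Henstock_Kurzweil_Integration.integral_combine[of 0 h "T + h" "\<lambda>s. weight R (\<Phi> s z)"] assms
    by (simp add: passage_def weight_integrable)
  finally show ?thesis .
qed

lemma passage_scale:
  assumes "T \<ge> 0" "c > 0"
  shows "passage R T (fst z, c *\<^sub>R snd z) = passage R (c * T) z"
proof -
  have "((\<lambda>s. weight R (\<Phi> s z)) has_integral passage R (c * T) z) (cbox 0 (c * T))"
    using integrable_integral[OF weight_integrable] by (simp add: passage_def)
  from has_integral_mult_right[OF has_integral_affinity'[OF this assms(2), of 0], of c]
  have "((\<lambda>s. c * weight R (\<Phi> (c * s) z)) has_integral passage R (c * T) z) {0..T}"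
    using assms(2) by (simp add: mult.assoc[symmetric])
  moreover have "c * weight R (\<Phi> (c * s) z) = weight R (\<Phi> s (fst z, c *\<^sub>R snd z))" if "s \<in> {0..T}" for s
    using \<Phi>_scale[of s "fst z" c "snd z"] that assms by (simp add: weight_def)
  ultimately have "((\<lambda>s. weight R (\<Phi> s (fst z, c *\<^sub>R snd z))) has_integral passage R (c * T) z) {0..T}"
    by (rule has_integral_eq[rotated])
  then show ?thesis by (simp add: passage_def integral_unique)
qed

lemma passage_stabilises:
  assumes D: "D \<ge> R + 1" "D \<ge> free_radius"
  shows "\<exists>T\<^sub>0\<ge>0. \<forall>z T. norm (fst z) \<le> D \<longrightarrow> 1/2 \<le> norm (snd z) \<longrightarrow> norm (snd z) \<le> 2 \<longrightarrow> T \<ge> T\<^sub>0 \<longrightarrow>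
     passage R T z = passage R T\<^sub>0 z"
proof -
  obtain E where E: "E \<ge> 0" "\<And>z t. norm (fst z) \<le> D \<Longrightarrow> 1/2 \<le> norm (snd z) \<Longrightarrow> norm (snd z) \<le> 2 \<Longrightarrow>
      E \<le> t \<Longrightarrow> norm (fst (\<Phi> t z)) > D"
    using escape_time[of "1/2" D 2] D(2) by auto
  show ?thesis
  proof (intro exI[of _ E] conjI allI impI E(1))
    fix z :: "'n phase" and T assume z: "norm (fst z) \<le> D" "1/2 \<le> norm (snd z)" "norm (snd z) \<le> 2" and T: "T \<ge> E"
    have "passage R T z = passage R E z + integral {E..T} (\<lambda>s. weight R (\<Phi> s z))"
      unfolding passage_def using E(1) T
      by (intro Henstock_Kurzweil_Integration.integral_combine[symmetric] weight_integrable) auto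
    also have "integral {E..T} (\<lambda>s. weight R (\<Phi> s z)) = integral {E..T} (\<lambda>s. 0)"
    proof (rule integral_cong)
      fix s assume "s \<in> {E..T}"
      then have "norm (fst (\<Phi> s z)) > D" by (intro E(2) z) auto
      then show "weight R (\<Phi> s z) = 0" using D(1) by (intro weight_outside) simp
    qed
    finally show "passage R T z = passage R E z" by simp
  qed
qed

text \<open>
  The function \<open>r\<close> is minus the passage integral up to a time after which all rays from the ball of radius
  \<open>D\<close> have gone.  There the integral does not change if the time horizon is doubled or halved, so it is exactly
  homogeneous of degree \<open>0\<close>, and moving the initial point along its ray for time \<open>h\<close> removes \<open>passage R h z\<close> from
  it.  The bound \<open>B\<close> is independent of \<open>D\<close>, the Lipschitz constant is not.
\<close>

lemma escape_function:
  assumes R: "R \<ge> free_radius"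
  shows "\<exists>B\<ge>0. \<forall>D. \<exists>r \<Lambda>. \<Lambda> \<ge> 0 \<and>
    (\<forall>z. 1/2 \<le> norm (snd z) \<longrightarrow> norm (snd z) \<le> 2 \<longrightarrow> \<bar>r z\<bar> \<le> B) \<and>
    (\<forall>z w. norm (snd z) \<le> 2 \<longrightarrow> norm (snd w) \<le> 2 \<longrightarrow> \<bar>r z - r w\<bar> \<le> \<Lambda> * norm (z - w)) \<and>
    (\<forall>z h c. norm (fst z) \<le> D \<longrightarrow> 1/2 \<le> norm (snd z) \<longrightarrow> norm (snd z) \<le> 2 \<longrightarrow> h \<ge> 0 \<longrightarrow> c \<ge> 1/2 \<longrightarrow>
       r (fst (\<Phi> h z), c *\<^sub>R snd (\<Phi> h z)) = r z + passage R h z)"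
proof -
  obtain B where B: "B \<ge> 0" "\<And>T z. T \<ge> 0 \<Longrightarrow> 1/2 \<le> norm (snd z) \<Longrightarrow> norm (snd z) \<le> 2 \<Longrightarrow>
     0 \<le> passage R T z \<and> passage R T z \<le> B"
    using passage_bounded[OF R] by blast
  show ?thesis
  proof (intro exI[of _ B] conjI allI B(1))
    fix D :: real
    \<comment> \<open>Outside the ball of radius \<open>D'\<close> the weight vanishes.\<close>
    define D' where "D' = max D (R + 1)"
    have D': "D' \<ge> R + 1" "D' \<ge> free_radius" using R by (auto simp: D'_def)
    obtain T where T: "T \<ge> 0" "\<And>z t. norm (fst z) \<le> D' \<Longrightarrow> 1/2 \<le> norm (snd z) \<Longrightarrow> norm (snd z) \<le> 2 \<Longrightarrow> t \<ge> T \<Longrightarrow>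
        passage R t z = passage R T z"
      using passage_stabilises[OF D'] by blast
    obtain \<Lambda> where \<Lambda>: "\<Lambda> \<ge> 0" "\<And>z w. norm (snd z) \<le> 2 \<Longrightarrow> norm (snd w) \<le> 2 \<Longrightarrow>
        \<bar>passage R (2 * T) z - passage R (2 * T) w\<bar> \<le> \<Lambda> * norm (z - w)"
      using passage_lipschitz[of "2 * T" R] T(1) by auto
    show "\<exists>r \<Lambda>. \<Lambda> \<ge> 0 \<and>
      (\<forall>z. 1/2 \<le> norm (snd z) \<longrightarrow> norm (snd z) \<le> 2 \<longrightarrow> \<bar>r z\<bar> \<le> B) \<and>
      (\<forall>z w. norm (snd z) \<le> 2 \<longrightarrow> norm (snd w) \<le> 2 \<longrightarrow> \<bar>r z - r w\<bar> \<le> \<Lambda> * norm (z - w)) \<and>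
      (\<forall>z h c. norm (fst z) \<le> D \<longrightarrow> 1/2 \<le> norm (snd z) \<longrightarrow> norm (snd z) \<le> 2 \<longrightarrow> h \<ge> 0 \<longrightarrow> c \<ge> 1/2 \<longrightarrow>
       r (fst (\<Phi> h z), c *\<^sub>R snd (\<Phi> h z)) = r z + passage R h z)"
    proof (intro exI[of _ "\<lambda>z. - passage R (2 * T) z"] exI[of _ \<Lambda>] conjI allI impI \<Lambda>(1))
      fix z :: "'n phase"
      show "\<bar>- passage R (2 * T) z\<bar> \<le> B" if "1/2 \<le> norm (snd z)" "norm (snd z) \<le> 2"
        using B(2)[of "2 * T" z] that T(1) by auto
      show "\<bar>- passage R (2 * T) z - - passage R (2 * T) w\<bar> \<le> \<Lambda> * norm (z - w)"
        if "norm (snd z) \<le> 2" "norm (snd w) \<le> 2" for w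
        using \<Lambda>(2)[OF that] by linarith
      fix h c :: real
      assume z: "norm (fst z) \<le> D" "1/2 \<le> norm (snd z)" "norm (snd z) \<le> 2" and h: "h \<ge> 0" and c: "c \<ge> 1/2"
      have z': "norm (fst z) \<le> D'" using z(1) by (simp add: D'_def)
      have "passage R (2 * T) (fst (\<Phi> h z), c *\<^sub>R snd (\<Phi> h z)) = passage R (c * (2 * T) + h) z - passage R h z"
        using passage_scale[of "2 * T" c R "\<Phi> h z"] passage_shift[of "c * (2 * T)" h R z] T(1) h c by simp
      also have "passage R (c * (2 * T) + h) z = passage R T z"
      proof (rule T(2)[OF z' z(2,3)])
        have "1/2 * (2 * T) \<le> c * (2 * T)" using c T(1) by (intro mult_right_mono) auto
        then show "c * (2 * T) + h \<ge> T" using h by simp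
      qed
      also have "passage R T z = passage R (2 * T) z" by (rule T(2)[OF z' z(2,3), symmetric]) (use T(1) in simp)
      finally show "- passage R (2 * T) (fst (\<Phi> h z), c *\<^sub>R snd (\<Phi> h z)) = - passage R (2 * T) z + passage R h z" by simp
    qed
  qed
qed

section \<open>Smoothing the escape function on the compactified fibre\<close>

text \<open>
  Rate at which the projection of the flow to the ball of the variable \<open>\<eta>\<close> must rescale the momentum;
  \<open>sphere_field\<close> is the Hamiltonian field after that projection and a change of time.
\<close>

definition stretch :: "'n phase \<Rightarrow> real" where
  "stretch z = snd z \<bullet> force (fst z) (snd z)"

definition sphere_field :: "'n phase \<Rightarrow> 'n phase" where
  "sphere_field z = ham_field z + (0, stretch z *\<^sub>R snd z)"

lemma abs_stretch_le: "norm (snd z) \<le> 1 \<Longrightarrow> \<bar>stretch z\<bar> \<le> growth"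
proof -
  assume 1: "norm (snd z) \<le> 1"
  have "\<bar>stretch z\<bar> \<le> norm (snd z) * norm (force (fst z) (snd z))"
    unfolding stretch_def by (rule Cauchy_Schwarz_ineq2)
  also have "\<dots> \<le> 1 * (growth * 1\<^sup>2)"
    by (intro mult_mono 1 order_trans[OF norm_force_le' mult_left_mono] power_mono)
      (use growth_bounds(1) in auto)
  finally show ?thesis by simp
qed

definition annulus :: "'n phase set" where
  "annulus = {z. 1/2 \<le> norm (snd z) \<and> norm (snd z) \<le> 2}"

text \<open>
  The displacement \<open>d\<close> of \<open>y\<close> is imitated, up to an error \<open>E\<close>, by following the ray of \<open>y\<close> for time \<open>h\<close>
  and rescaling the momentum by \<open>c\<close>, an operation under which the change of the escape function is known.
  The remaining conditions confine all points involved to the region where the escape function is controlled.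
\<close>

definition shadowed :: "real \<Rightarrow> real \<Rightarrow> real \<Rightarrow> real \<Rightarrow> 'n phase \<Rightarrow> 'n phase \<Rightarrow> bool" where
  "shadowed V E c h y d \<longleftrightarrow>
     (let w = (fst (\<Phi> h y), c *\<^sub>R snd (\<Phi> h y)) in c \<ge> 1/2 \<and> y \<in> annulus \<and> y + d \<in> annulus \<and> w \<in> annulus \<and>
       norm (w - (y + d)) \<le> E \<and> norm (fst d) \<le> 1/8 \<and>
       (\<forall>s. 0 \<le> s \<longrightarrow> s \<le> h \<longrightarrow> norm (fst (\<Phi> s y) - fst y) \<le> min (1/8) (V * h) \<and> 1/2 \<le> norm (snd (\<Phi> s y))))"

text \<open>
  The fields \<open>sphere_field\<close> and \<open>ham_field\<close> differ by the multiple \<open>stretch z\<close> of the momentum, which the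
  rescaling by \<open>c = 1 + h * stretch z\<close> reproduces up to \<open>O(h\<^sup>2)\<close>.  The term \<open>L * \<epsilon>\<close> arises because
  the displacement of \<open>z - u\<close> uses the field at \<open>z\<close>: under the mollifier, the direction is the same at all points.
\<close>

lemma flow_shadows_sphere_field:
  "\<exists>h\<^sub>0 V K L. h\<^sub>0 > 0 \<and> V \<ge> 0 \<and> K \<ge> 0 \<and> L \<ge> 0 \<and>
    (\<forall>z u h \<epsilon>. 3/4 \<le> norm (snd z) \<longrightarrow> norm (snd z) \<le> 1 \<longrightarrow> norm u \<le> \<epsilon> \<longrightarrow> \<epsilon> \<le> 1/8 \<longrightarrow> 0 < h \<longrightarrow> h < h\<^sub>0 \<longrightarrow>
      (\<exists>c. shadowed V (K * h\<^sup>2 + h * (L * \<epsilon>)) c h (z - u) (h *\<^sub>R sphere_field z)))"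
proof -
  obtain V K1 where V0: "V \<ge> 0" and K1: "K1 \<ge> 0" and
    VK: "\<forall>z h. norm (snd z) \<le> 2 \<longrightarrow> h \<ge> 0 \<longrightarrow>
     norm (ham_field z) \<le> V \<and> norm (\<Phi> h z - z) \<le> V * h \<and>
     norm (\<Phi> h z - z - h *\<^sub>R ham_field z) \<le> K1 * h\<^sup>2"
    using flow_second_order by blast
  have VK1: "norm (ham_field z) \<le> V" if "norm (snd z) \<le> 2" for z
    using VK[rule_format, OF that order_refl] by (rule conjunct1)
  have VK2: "norm (\<Phi> h z - z) \<le> V * h" and VK3: "norm (\<Phi> h z - z - h *\<^sub>R ham_field z) \<le> K1 * h\<^sup>2"
    if "norm (snd z) \<le> 2" "h \<ge> 0" for z h
    using VK[rule_format, OF that] by (blast dest: conjunct2)+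
  obtain L where L0: "L \<ge> 0" and L: "\<forall>z w. norm (snd z) \<le> 2 \<longrightarrow> norm (snd w) \<le> 2 \<longrightarrow>
     norm (ham_field z - ham_field w) \<le> L * norm (z - w)"
    using ham_field_lipschitz[of 2] by blast
  define g where "g = growth"
  have g: "g \<ge> 1" using growth_bounds(1) by (simp add: g_def)
  \<comment> \<open>Steps shorter than \<open>h\<^sub>0\<close> move every point involved by at most \<open>1/16\<close>, and \<open>u\<close> moves \<open>z\<close> by at most
    \<open>1/8\<close>, so that all of them stay in the annulus.\<close>
  define h\<^sub>0 where "h\<^sub>0 = 1 / (16 * (V + g + 1))"
  have h0: "h\<^sub>0 > 0" using V0 g by (simp add: h\<^sub>0_def)
  have h0_le: "h * (V + g) \<le> 1/16" if "0 < h" "h < h\<^sub>0" for h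
  proof -
    have "h * (16 * (V + g + 1)) \<le> 1" using that V0 g by (simp add: h\<^sub>0_def pos_less_divide_eq)
    then show ?thesis using that by (simp add: algebra_simps)
  qed
  have Kg: "K1 + g * V \<ge> 0" "L + g \<ge> 0" using K1 L0 V0 g by auto
  show ?thesis
  proof (rule exI[of _ h\<^sub>0], rule exI[of _ V], rule exI[of _ "K1 + g * V"], rule exI[of _ "L + g"],
      intro conjI allI impI h0 V0 Kg)
    fix z u :: "'n phase" and h \<epsilon> :: real
    assume z: "3/4 \<le> norm (snd z)" "norm (snd z) \<le> 1" and u: "norm u \<le> \<epsilon>" and \<epsilon>: "\<epsilon> \<le> 1/8" and h: "0 < h" "h < h\<^sub>0"
    define y where "y = z - u"
    define y' where "y' = z + h *\<^sub>R sphere_field z - u"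
    have sz: "\<bar>stretch z\<bar> \<le> g" unfolding g_def by (rule abs_stretch_le[OF z(2)])
    have hV: "h * V \<le> 1/16" "h * g \<le> 1/16" "0 \<le> h * V" "0 \<le> h * g"
      using h0_le[OF h] h V0 g mult_nonneg_nonneg[of h V] mult_nonneg_nonneg[of h g]
      by (auto simp: distrib_left simp del: mult_nonneg_nonneg)
    have uu: "norm (fst u) \<le> 1/8" "norm (snd u) \<le> 1/8" "norm (snd u) \<le> \<epsilon>"
      using u \<epsilon> norm_fst_le[of "fst u" "snd u"] norm_snd_le[of "snd u" "fst u"] by (auto simp: prod.collapse)
    have y_snd: "5/8 \<le> norm (snd y)" "norm (snd y) \<le> 9/8"
      using z uu(2) norm_triangle_ineq2[of "snd z" "snd u"] norm_triangle_ineq4[of "snd z" "snd u"]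
      by (auto simp: y_def)
    have move: "norm (fst (\<Phi> s y) - fst y) \<le> V * h" "norm (snd (\<Phi> s y) - snd y) \<le> V * h"
      if "0 \<le> s" "s \<le> h" for s
    proof -
      have "norm (\<Phi> s y - y) \<le> V * s" using y_snd that by (intro VK2) simp_all
      also have "\<dots> \<le> V * h" using that V0 by (intro mult_left_mono)
      finally show "norm (fst (\<Phi> s y) - fst y) \<le> V * h" "norm (snd (\<Phi> s y) - snd y) \<le> V * h"
        using dist_fst_le[of "\<Phi> s y" y] dist_snd_le[of "\<Phi> s y" y] by (auto simp: dist_norm)
    qed
    have \<Phi>_snd: "9/16 \<le> norm (snd (\<Phi> s y))" "norm (snd (\<Phi> s y)) \<le> 19/16" if "0 \<le> s" "s \<le> h" for s
      using move(2)[OF that] y_snd norm_triangle_ineq2[of "snd y" "snd (\<Phi> s y)"] hV(1)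
        norm_triangle_ineq2[of "snd (\<Phi> s y)" "snd y"] by (auto simp: norm_minus_commute mult.commute)
    define c where "c = 1 + h * stretch z"
    have hs: "\<bar>h * stretch z\<bar> \<le> h * g" using sz h by (simp add: abs_mult)
    have c: "15/16 \<le> c" "c \<le> 17/16" using hs hV by (auto simp: c_def abs_le_iff)
    define w where "w = (fst (\<Phi> h y), c *\<^sub>R snd (\<Phi> h y))"
    have "w \<in> annulus"
    proof -
      have eq: "norm (snd w) = c * norm (snd (\<Phi> h y))" using c by (simp add: w_def)
      have "15/16 * (9/16) \<le> c * norm (snd (\<Phi> h y))" "c * norm (snd (\<Phi> h y)) \<le> 17/16 * (19/16)"
        by (intro mult_mono c \<Phi>_snd; use h c in simp)+
      then show ?thesis unfolding annulus_def mem_Collect_eq eq by simp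
    qed
    moreover have "y \<in> annulus" using y_snd by (simp add: annulus_def)
    moreover have dy: "norm (y' - y) \<le> 1/16"
    proof -
      have "norm (sphere_field z) \<le> norm (ham_field z) + norm (0::real^'n, stretch z *\<^sub>R snd z)"
        unfolding sphere_field_def by (rule norm_triangle_ineq)
      moreover have "norm (ham_field z) \<le> V" using z(2) by (intro VK1) simp
      moreover have "\<bar>stretch z\<bar> * norm (snd z) \<le> g * 1"
        by (rule mult_mono[OF sz z(2)]) (use g in auto)
      then have "norm (0::real^'n, stretch z *\<^sub>R snd z) \<le> g" by (simp add: norm_Pair)
      ultimately have "norm (sphere_field z) \<le> V + g" by simp
      then have "norm (h *\<^sub>R sphere_field z) \<le> h * (V + g)" using h by simp
      then show ?thesis using h0_le[OF h] by (simp add: y'_def y_def)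
    qed
    then have dy': "norm (fst y' - fst y) \<le> 1/16" "norm (snd y' - snd y) \<le> 1/16"
      using dist_fst_le[of y' y] dist_snd_le[of y' y] by (auto simp: dist_norm)
    have "y' \<in> annulus"
      using dy'(2) y_snd norm_triangle_ineq2[of "snd y" "snd y'"] norm_triangle_ineq2[of "snd y'" "snd y"]
      by (auto simp: annulus_def norm_minus_commute)
    moreover have "norm (w - y') \<le> (K1 + g * V) * h\<^sup>2 + h * ((L + g) * \<epsilon>)"
    proof -
      have wy_eq: "w - y' = (\<Phi> h y - y - h *\<^sub>R ham_field y) + h *\<^sub>R (ham_field y - ham_field z)
          + (0, (h * stretch z) *\<^sub>R (snd (\<Phi> h y) - snd y)) + (0, (h * stretch z) *\<^sub>R (snd y - snd z))"
        by (rule prod_eqI) (simp_all add: w_def y'_def y_def c_def sphere_field_def algebra_simps)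
      have "norm (w - y') \<le> norm (\<Phi> h y - y - h *\<^sub>R ham_field y) + norm (h *\<^sub>R (ham_field y - ham_field z))
          + norm (0::real^'n, (h * stretch z) *\<^sub>R (snd (\<Phi> h y) - snd y)) + norm (0::real^'n, (h * stretch z) *\<^sub>R (snd y - snd z))"
        unfolding wy_eq by (intro norm_triangle_mono order_refl)
      also have "\<dots> \<le> K1 * h\<^sup>2 + h * (L * \<epsilon>) + (h * g) * (V * h) + (h * g) * \<epsilon>"
      proof (intro add_mono)
        show "norm (\<Phi> h y - y - h *\<^sub>R ham_field y) \<le> K1 * h\<^sup>2" using y_snd h by (intro VK3) simp_all
        have "norm (ham_field y - ham_field z) \<le> L * norm (y - z)"
          by (rule L[rule_format]) (use y_snd z in simp_all)
        also have "\<dots> \<le> L * \<epsilon>" using u L0 by (intro mult_left_mono) (auto simp: y_def)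
        finally show "norm (h *\<^sub>R (ham_field y - ham_field z)) \<le> h * (L * \<epsilon>)" using h by simp
        show "norm (0::real^'n, (h * stretch z) *\<^sub>R (snd (\<Phi> h y) - snd y)) \<le> (h * g) * (V * h)"
          using mult_mono[OF hs move(2)[of h]] hV h by (simp add: norm_Pair)
        show "norm (0::real^'n, (h * stretch z) *\<^sub>R (snd y - snd z)) \<le> (h * g) * \<epsilon>"
          using mult_mono[OF hs, of "norm (snd y - snd z)" \<epsilon>] uu(3) hV by (simp add: norm_Pair y_def)
      qed
      also have "\<dots> = (K1 + g * V) * h\<^sup>2 + h * ((L + g) * \<epsilon>)" by (simp add: power2_eq_square algebra_simps)
      finally show ?thesis .
    qed
    moreover have "norm (fst (\<Phi> s y) - fst y) \<le> min (1/8) (V * h) \<and> 1/2 \<le> norm (snd (\<Phi> s y))" if "0 \<le> s" "s \<le> h" for s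
      using \<Phi>_snd(1)[OF that] move(1)[OF that] hV(1) by (auto simp: mult.commute)
    moreover have "y' = y + h *\<^sub>R sphere_field z" by (simp add: y_def y'_def)
    ultimately have "shadowed V ((K1 + g * V) * h\<^sup>2 + h * ((L + g) * \<epsilon>)) c h y (h *\<^sub>R sphere_field z)"
      using dy'(1) c unfolding shadowed_def Let_def w_def[symmetric] by simp
    then show "\<exists>c. shadowed V ((K1 + g * V) * h\<^sup>2 + h * ((L + g) * \<epsilon>)) c h (z - u) (h *\<^sub>R sphere_field z)"
      unfolding y_def by blast
  qed
qed

text \<open>
  The mollifier needs an integrable function on the whole space, so the product is set to \<open>0\<close> outside the annulus.
  It is discontinuous there, but only its values in the annulus enter the estimates.
\<close>

lemma cutoff_of_lipschitz:
  assumes \<rho>: "\<rho> \<ge> 1" and B0: "B \<ge> 0" and \<Lambda>0: "\<Lambda> \<ge> 0"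
    and rB: "\<And>z. z \<in> annulus \<Longrightarrow> \<bar>r z\<bar> \<le> B"
    and rL: "\<And>z w. z \<in> annulus \<Longrightarrow> w \<in> annulus \<Longrightarrow> \<bar>r z - r w\<bar> \<le> \<Lambda> * norm (z - w)"
  shows "\<exists>f \<Lambda>\<^sub>1. \<Lambda>\<^sub>1 \<ge> 0 \<and> integrable lborel f \<and> (\<forall>z\<in>annulus. f z = cutoff \<rho> \<rho> (fst z) * r z) \<and>
    (\<forall>z\<in>annulus. \<forall>w\<in>annulus. \<bar>f z - f w\<bar> \<le> \<Lambda>\<^sub>1 * norm (z - w))"
proof -
  define A where "A = annulus \<inter> cball 0 (2 * \<rho>) \<times> UNIV"
  define f where "f = (\<lambda>z. indicator A z *\<^sub>R (cutoff \<rho> \<rho> (fst z) * r z))"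
  have f_eq: "f z = cutoff \<rho> \<rho> (fst z) * r z" if "z \<in> annulus" for z
    using that cutoff_outside[of \<rho> \<rho> "fst z"] \<rho> by (auto simp: f_def A_def indicator_def mem_Times_iff)
  have "A = cball 0 (2 * \<rho>) \<times> (cball 0 2 - ball 0 (1/2))"
    by (auto simp: A_def annulus_def)
  then have "compact A" by (simp add: compact_Times compact_diff)
  moreover have "\<Lambda>-lipschitz_on annulus r"
    by (rule lipschitz_onI) (use rL \<Lambda>0 in \<open>auto simp: dist_norm\<close>)
  then have "continuous_on A r"
    by (rule continuous_on_subset[OF lipschitz_on_continuous_on]) (auto simp: A_def)
  ultimately have "integrable lborel f"
    unfolding f_def using \<rho>
    by (intro borel_integrable_compact continuous_on_mult continuous_on_cutoff continuous_on_fst continuous_on_id) auto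
  moreover have "\<bar>f z - f w\<bar> \<le> (B / \<rho> + \<Lambda>) * norm (z - w)" if z: "z \<in> annulus" and w: "w \<in> annulus" for z w
  proof -
    let ?c = "\<lambda>z::'n phase. cutoff \<rho> \<rho> (fst z)"
    have "\<bar>f z - f w\<bar> = \<bar>(?c z - ?c w) * r z + ?c w * (r z - r w)\<bar>"
      by (simp add: f_eq[OF z] f_eq[OF w] algebra_simps)
    also have "\<dots> \<le> \<bar>?c z - ?c w\<bar> * \<bar>r z\<bar> + ?c w * \<bar>r z - r w\<bar>"
      by (rule order_trans[OF abs_triangle_ineq]) (simp add: abs_mult cutoff_range)
    also have "\<dots> \<le> (norm (z - w) / \<rho>) * B + 1 * (\<Lambda> * norm (z - w))"
    proof (intro add_mono mult_mono rB[OF z] rL z w cutoff_range)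
      have "norm (fst z - fst w) / \<rho> \<le> norm (z - w) / \<rho>"
        using dist_fst_le[of z w] \<rho> by (intro divide_right_mono) (auto simp: dist_norm)
      then show "\<bar>?c z - ?c w\<bar> \<le> norm (z - w) / \<rho>"
        using cutoff_lipschitz[of \<rho> \<rho> "fst z" "fst w"] \<rho> by linarith
    qed (use \<rho> in auto)
    finally show ?thesis by (simp add: algebra_simps)
  qed
  moreover have "B / \<rho> + \<Lambda> \<ge> 0" using B0 \<rho> \<Lambda>0 by simp
  ultimately show ?thesis using f_eq by blast
qed

text \<open>
  The escape function is cut off between \<open>\<bar>x\<bar> = \<rho>\<close> and \<open>\<bar>x\<bar> = 2 \<rho>\<close> and then mollified.
  Where the cutoff varies, the loss is the speed times \<open>1 / \<rho>\<close> times the bound of the escape function, which is the term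
  \<open>K / \<rho>\<close> with \<open>K\<close> independent of \<open>\<rho>\<close>.
  The term \<open>\<delta>\<close> pays for the variation of the field over the support of the mollifier.
\<close>

lemma smooth_escape_function:
  assumes R: "R \<ge> free_radius"
  shows "\<exists>K\<ge>0. \<forall>\<rho> \<delta>. \<rho> \<ge> R + 1 \<longrightarrow> \<delta> > 0 \<longrightarrow> (\<exists>F. (\<forall>k. bounded_Ck k F) \<and>
     (\<forall>z. 3/4 \<le> norm (snd z) \<longrightarrow> norm (snd z) \<le> 1 \<longrightarrow>
        (norm (fst z) \<le> R \<longrightarrow> dir_deriv (sphere_field z) F z \<ge> 1/4 - K / \<rho> - \<delta>) \<and>
        dir_deriv (sphere_field z) F z \<ge> - K / \<rho> - \<delta> \<and>
        (norm (fst z) \<ge> 2 * \<rho> + 1 \<longrightarrow> dir_deriv (sphere_field z) F z \<ge> 0)))"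
proof -
  obtain B where B0: "B \<ge> 0" and B: "\<forall>D. \<exists>r \<Lambda>. \<Lambda> \<ge> 0 \<and>
    (\<forall>z. 1/2 \<le> norm (snd z) \<longrightarrow> norm (snd z) \<le> 2 \<longrightarrow> \<bar>r z\<bar> \<le> B) \<and>
    (\<forall>z w. norm (snd z) \<le> 2 \<longrightarrow> norm (snd w) \<le> 2 \<longrightarrow> \<bar>r z - r w\<bar> \<le> \<Lambda> * norm (z - w)) \<and>
    (\<forall>z h c. norm (fst z) \<le> D \<longrightarrow> 1/2 \<le> norm (snd z) \<longrightarrow> norm (snd z) \<le> 2 \<longrightarrow> h \<ge> 0 \<longrightarrow> c \<ge> 1/2 \<longrightarrow>
       r (fst (\<Phi> h z), c *\<^sub>R snd (\<Phi> h z)) = r z + passage R h z)"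
    using escape_function[OF R] by blast
  obtain h\<^sub>0 V K L where h0: "h\<^sub>0 > 0" and V0: "V \<ge> 0" and K0: "K \<ge> 0" and L0: "L \<ge> 0" and
    step: "\<forall>z u h \<epsilon>. 3/4 \<le> norm (snd z) \<longrightarrow> norm (snd z) \<le> 1 \<longrightarrow> norm u \<le> \<epsilon> \<longrightarrow> \<epsilon> \<le> 1/8 \<longrightarrow> 0 < h \<longrightarrow> h < h\<^sub>0 \<longrightarrow>
      (\<exists>c. shadowed V (K * h\<^sup>2 + h * (L * \<epsilon>)) c h (z - u) (h *\<^sub>R sphere_field z))"
    using flow_shadows_sphere_field by (elim exE conjE) (rule that)
  show ?thesis
  proof (intro exI[of _ "V * B"] conjI allI impI)
    show "0 \<le> V * B" using V0 B0 by simp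
    fix \<rho> \<delta> :: real assume \<rho>: "\<rho> \<ge> R + 1" and \<delta>: "\<delta> > 0"
    have \<rho>1: "\<rho> \<ge> 1" using R \<rho> by (auto simp: free_radius_def)
    obtain r \<Lambda> where \<Lambda>0: "\<Lambda> \<ge> 0"
      and rB: "\<And>z. z \<in> annulus \<Longrightarrow> \<bar>r z\<bar> \<le> B"
      and rL: "\<And>z w. z \<in> annulus \<Longrightarrow> w \<in> annulus \<Longrightarrow> \<bar>r z - r w\<bar> \<le> \<Lambda> * norm (z - w)"
      and r\<Phi>: "\<And>z h c. norm (fst z) \<le> 2 * \<rho> + 1 \<Longrightarrow> z \<in> annulus \<Longrightarrow> h \<ge> 0 \<Longrightarrow> c \<ge> 1/2 \<Longrightarrow>
         r (fst (\<Phi> h z), c *\<^sub>R snd (\<Phi> h z)) = r z + passage R h z"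
      using B[rule_format, of "2 * \<rho> + 1"] unfolding annulus_def mem_Collect_eq by blast
    obtain f \<Lambda>\<^sub>1 where \<Lambda>1: "\<Lambda>\<^sub>1 \<ge> 0" and f_int: "integrable lborel f"
      and f_eq: "\<And>z. z \<in> annulus \<Longrightarrow> f z = cutoff \<rho> \<rho> (fst z) * r z"
      and f_lip: "\<And>z w. z \<in> annulus \<Longrightarrow> w \<in> annulus \<Longrightarrow> \<bar>f z - f w\<bar> \<le> \<Lambda>\<^sub>1 * norm (z - w)"
      using cutoff_of_lipschitz[OF \<rho>1 B0 \<Lambda>0 rB rL] by blast
    \<comment> \<open>A mollifier this narrow loses at most \<open>\<delta>\<close> and keeps \<open>\<bar>\<eta>\<bar>\<close> within \<open>[5/8, 9/8]\<close>.\<close>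
    define \<epsilon> where "\<epsilon> = min (1/8) (\<delta> / (\<Lambda>\<^sub>1 * L + 1))"
    have den: "\<Lambda>\<^sub>1 * L + 1 > 0" using \<Lambda>1 L0 by (intro add_nonneg_pos mult_nonneg_nonneg) auto
    have \<epsilon>0: "\<epsilon> > 0" using divide_pos_pos[OF \<delta> den] by (simp add: \<epsilon>_def)
    have \<epsilon>8: "\<epsilon> \<le> 1/8" unfolding \<epsilon>_def by (rule min.cobounded1)
    have \<epsilon>\<delta>: "\<Lambda>\<^sub>1 * (L * \<epsilon>) \<le> \<delta>"
    proof -
      have "\<epsilon> \<le> \<delta> / (\<Lambda>\<^sub>1 * L + 1)" unfolding \<epsilon>_def by (rule min.cobounded2)
      then have "\<epsilon> * (\<Lambda>\<^sub>1 * L + 1) \<le> \<delta>" using den by (simp only: pos_le_divide_eq)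
      then show ?thesis using \<epsilon>0 by (simp add: algebra_simps)
    qed
    obtain F where F: "\<And>k. bounded_Ck k F"
      and F_ge: "\<And>z v G K h\<^sub>0. h\<^sub>0 > 0 \<Longrightarrow>
      (\<And>h u. 0 < h \<Longrightarrow> h < h\<^sub>0 \<Longrightarrow> norm u \<le> \<epsilon> \<Longrightarrow> f (z + h *\<^sub>R v - u) - f (z - u) \<ge> h * G - K * h\<^sup>2) \<Longrightarrow>
      dir_deriv v F z \<ge> G"
      using mollification[OF f_int \<epsilon>0] by metis
    {
      fix z u :: "'n phase" and h :: real
      assume z: "3/4 \<le> norm (snd z)" "norm (snd z) \<le> 1" and h: "0 < h" "h < h\<^sub>0" and u: "norm u \<le> \<epsilon>"
      define y where "y = z - u"
      define y' where "y' = z + h *\<^sub>R sphere_field z - u"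
      have y': "y' = y + h *\<^sub>R sphere_field z" by (simp add: y_def y'_def)
      obtain c where st: "shadowed V (K * h\<^sup>2 + h * (L * \<epsilon>)) c h y (h *\<^sub>R sphere_field z)"
        using step[rule_format, OF z u \<epsilon>8 h] unfolding y_def by blast
      define w where "w = (fst (\<Phi> h y), c *\<^sub>R snd (\<Phi> h y))"
      have c: "c \<ge> 1/2" and ann: "y \<in> annulus" "y' \<in> annulus" "w \<in> annulus"
        and wy': "norm (w - y') \<le> K * h\<^sup>2 + h * (L * \<epsilon>)" and d: "norm (fst (h *\<^sub>R sphere_field z)) \<le> 1/8"
        using st unfolding shadowed_def Let_def w_def[symmetric] y'[symmetric] by blast+
      have ray': "norm (fst (\<Phi> s y) - fst y) \<le> min (1/8) (V * h) \<and> 1/2 \<le> norm (snd (\<Phi> s y))"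
        if "0 \<le> s" "s \<le> h" for s using st that unfolding shadowed_def Let_def by blast
      have "norm (fst u) \<le> 1/8" using u \<epsilon>8 norm_fst_le[of "fst u" "snd u"] by simp
      then have uz: "norm (fst y - fst z) \<le> 1/8" by (simp add: y_def)
      have ray: "norm (fst (\<Phi> s y) - fst z) \<le> 1/4" "1/2 \<le> norm (snd (\<Phi> s y))" "norm (fst (\<Phi> s y) - fst y) \<le> V * h"
        if "0 \<le> s" "s \<le> h" for s
        using ray'[OF that] uz norm_triangle_ineq[of "fst (\<Phi> s y) - fst y" "fst y - fst z"] by auto
      have y'_fst: "norm (fst y' - fst z) \<le> 1/4"
        using d uz norm_triangle_ineq[of "fst (h *\<^sub>R sphere_field z)" "fst y - fst z"] by (simp add: y' algebra_simps)
      have y_fst: "norm (fst y - fst z) \<le> 1/4" using ray(1)[of 0] h by (simp add: \<Phi>_0)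
      have "f y' \<ge> f w - \<Lambda>\<^sub>1 * norm (w - y')" using f_lip[OF ann(3,2)] by linarith
      moreover have "\<Lambda>\<^sub>1 * norm (w - y') \<le> \<Lambda>\<^sub>1 * (K * h\<^sup>2 + h * (L * \<epsilon>))"
        by (rule mult_left_mono[OF wy' \<Lambda>1])
      moreover have "\<Lambda>\<^sub>1 * (K * h\<^sup>2 + h * (L * \<epsilon>)) = (\<Lambda>\<^sub>1 * K) * h\<^sup>2 + h * (\<Lambda>\<^sub>1 * (L * \<epsilon>))"
        by (simp add: algebra_simps)
      moreover have "h * (\<Lambda>\<^sub>1 * (L * \<epsilon>)) \<le> h * \<delta>" using \<epsilon>\<delta> h by (intro mult_left_mono) auto
      ultimately have fy'w: "f y' \<ge> f w - (\<Lambda>\<^sub>1 * K) * h\<^sup>2 - h * \<delta>" by linarith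
      \<comment> \<open>From \<open>y\<close> to \<open>w\<close> the escape function \<open>r\<close> grows by the passage integral; the variation of the cutoff
        costs the distance travelled times \<open>B / \<rho>\<close>.\<close>
      have incr: "f w - f y \<ge> cutoff \<rho> \<rho> (fst w) * passage R h y - h * (V * B / \<rho>)"
        if "norm (fst y) \<le> 2 * \<rho> + 1"
      proof -
        have "f w - f y = cutoff \<rho> \<rho> (fst w) * passage R h y + (cutoff \<rho> \<rho> (fst w) - cutoff \<rho> \<rho> (fst y)) * r y"
          using f_eq[OF ann(3)] f_eq[OF ann(1)] r\<Phi>[OF that ann(1), of h c] h c by (simp add: w_def algebra_simps)
        moreover have "\<bar>(cutoff \<rho> \<rho> (fst w) - cutoff \<rho> \<rho> (fst y)) * r y\<bar> \<le> (V * h / \<rho>) * B"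
          unfolding abs_mult
        proof (intro mult_mono rB[OF ann(1)])
          have "norm (fst w - fst y) / \<rho> \<le> V * h / \<rho>"
            using ray(3)[of h] h \<rho>1 by (intro divide_right_mono) (auto simp: w_def)
          then show "\<bar>cutoff \<rho> \<rho> (fst w) - cutoff \<rho> \<rho> (fst y)\<bar> \<le> V * h / \<rho>"
            using cutoff_lipschitz[of \<rho> \<rho> "fst w" "fst y"] \<rho>1 by linarith
        qed (use V0 h \<rho>1 in auto)
        ultimately show ?thesis by (simp add: abs_le_iff algebra_simps)
      qed
      have passage0: "passage R h y \<ge> 0" unfolding passage_def
        by (rule integral_nonneg[OF weight_integrable]) (simp add: weight_range)
      have KK: "0 \<le> (\<Lambda>\<^sub>1 * K) * h\<^sup>2" using \<Lambda>1 K0 by simp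
      have VB: "0 \<le> h * (V * B / \<rho>)" "0 \<le> h * \<delta>" using h V0 B0 \<rho>1 \<delta> by auto
      have zero: "f y' = 0" "f y = 0" if "norm (fst z) \<ge> 2 * \<rho> + 1/2"
      proof -
        have "norm (fst y') \<ge> \<rho> + \<rho>" "norm (fst y) \<ge> \<rho> + \<rho>"
          using that y'_fst y_fst norm_triangle_ineq2[of "fst z" "fst y'"] norm_triangle_ineq2[of "fst z" "fst y"]
          by (auto simp: norm_minus_commute)
        then show "f y' = 0" "f y = 0" using cutoff_outside[of \<rho> \<rho> "fst y"] cutoff_outside[of \<rho> \<rho> "fst y'"] \<rho>1
          by (auto simp: f_eq[OF ann(1)] f_eq[OF ann(2)])
      qed
      have gen: "f y' - f y \<ge> h * (- (V * B) / \<rho> - \<delta>) - (\<Lambda>\<^sub>1 * K) * h\<^sup>2"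
      proof (cases "norm (fst z) \<le> 2 * \<rho> + 1/2")
        case True
        then have "norm (fst y) \<le> 2 * \<rho> + 1" using y_fst norm_triangle_ineq2[of "fst y" "fst z"] by simp
        moreover have "0 \<le> cutoff \<rho> \<rho> (fst w) * passage R h y" using passage0 cutoff_range(1) by (intro mult_nonneg_nonneg)
        ultimately show ?thesis using incr fy'w by (simp add: algebra_simps)
      next
        case False
        then have "f y' = 0" "f y = 0" using zero by auto
        then show ?thesis using KK VB by (simp add: algebra_simps)
      qed
      have near: "f y' - f y \<ge> h * (1/4 - V * B / \<rho> - \<delta>) - (\<Lambda>\<^sub>1 * K) * h\<^sup>2" if zR: "norm (fst z) \<le> R"
      proof -
        have fst\<Phi>: "norm (fst (\<Phi> s y)) \<le> R + 1/4" if "0 \<le> s" "s \<le> h" for s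
          using ray(1)[OF that] zR norm_triangle_ineq2[of "fst (\<Phi> s y)" "fst z"] by simp
        have "h * (1/4) = integral {0..h} (\<lambda>s. 1/4)" using h by simp
        also have "\<dots> \<le> passage R h y" unfolding passage_def
        proof (rule integral_le[OF _ weight_integrable])
          fix s assume s: "s \<in> {0..h}"
          have "1/2 \<le> cutoff R 1 (fst (\<Phi> s y))" using fst\<Phi>[of s] s by (simp add: cutoff_def)
          then have "1/2 * (1/2) \<le> weight R (\<Phi> s y)" unfolding weight_def
            using ray(2)[of s] s by (intro mult_mono) auto
          then show "1/4 \<le> weight R (\<Phi> s y)" by simp
        qed (simp add: integrable_const_ivl)
        finally have "h * (1/4) \<le> passage R h y" .
        moreover have "cutoff \<rho> \<rho> (fst w) = 1" using fst\<Phi>[of h] h \<rho> \<rho>1 by (intro cutoff_inside) (auto simp: w_def)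
        moreover have "norm (fst y) \<le> 2 * \<rho> + 1" using fst\<Phi>[of 0] h \<rho> \<rho>1 by (simp add: \<Phi>_0)
        ultimately show ?thesis using incr fy'w by (simp add: algebra_simps)
      qed
      \<comment> \<open>Beyond \<open>2 \<rho> + 1\<close> the function vanishes near \<open>z\<close>.\<close>
      have far: "f y' - f y \<ge> h * 0 - 0 * h\<^sup>2" if "norm (fst z) \<ge> 2 * \<rho> + 1"
        using zero that by simp
      note gen[unfolded y_def y'_def] near[unfolded y_def y'_def] far[unfolded y_def y'_def]
    } note local_est = this
    show "\<exists>F. (\<forall>k. bounded_Ck k F) \<and>
     (\<forall>z. 3/4 \<le> norm (snd z) \<longrightarrow> norm (snd z) \<le> 1 \<longrightarrow>
        (norm (fst z) \<le> R \<longrightarrow> dir_deriv (sphere_field z) F z \<ge> 1/4 - V * B / \<rho> - \<delta>) \<and>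
        dir_deriv (sphere_field z) F z \<ge> - (V * B) / \<rho> - \<delta> \<and>
        (norm (fst z) \<ge> 2 * \<rho> + 1 \<longrightarrow> dir_deriv (sphere_field z) F z \<ge> 0))"
    proof (intro exI[of _ F] conjI allI impI F)
      fix z :: "'n phase" assume z: "3/4 \<le> norm (snd z)" "norm (snd z) \<le> 1"
      show "dir_deriv (sphere_field z) F z \<ge> 1/4 - V * B / \<rho> - \<delta>" if "norm (fst z) \<le> R"
        by (rule F_ge[OF h0 local_est(2)[OF z _ _ _ that]])
      show "dir_deriv (sphere_field z) F z \<ge> - (V * B) / \<rho> - \<delta>"
        by (rule F_ge[OF h0 local_est(1)[OF z]])
      show "dir_deriv (sphere_field z) F z \<ge> 0" if "norm (fst z) \<ge> 2 * \<rho> + 1"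
        by (rule F_ge[OF h0 local_est(3)[OF z _ _ _ that]])
    qed
  qed
qed

section \<open>Poisson brackets with the Hamiltonian\<close>

lemma ham_eq_energy: "ham a = energy"
  by (auto simp: ham_def energy_def)

lemma poisson_eq:
  assumes "p differentiable (at z)"
  shows "poisson (ham a) p z = dir_deriv (ham_field z) p z"
proof -
  have x: "dir_deriv (ex i) (ham a) z = force (fst z) (snd z) $ i" for i
    unfolding ham_eq_energy by (subst dir_deriv_eq[OF energy_has_derivative]) (simp add: ex_def inner_axis')
  have \<xi>: "dir_deriv (e\<xi> i) (ham a) z = (2 *\<^sub>R (a (fst z) *v snd z)) $ i" for i
    unfolding ham_eq_energy by (subst dir_deriv_eq[OF energy_has_derivative]) (simp add: e\<xi>_def inner_axis)
  have lin: "linear (\<lambda>v. dir_deriv v p z)" by (rule dir_deriv_linear[OF assms])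
  have basis: "(\<Sum>i\<in>UNIV. u $ i *\<^sub>R axis i 1) = u" for u :: "real ^ 'n"
    using basis_expansion[of u] by (simp add: scalar_mult_eq_scaleR)
  have expand: "(\<Sum>i\<in>UNIV. u $ i *\<^sub>R ex i + w $ i *\<^sub>R e\<xi> i) = (u, w)" for u w :: "real ^ 'n"
    by (rule prod_eqI)
      (simp_all add: fst_sum snd_sum ex_def e\<xi>_def basis)
  have "dir_deriv (\<Sum>i\<in>UNIV. u $ i *\<^sub>R ex i + w $ i *\<^sub>R e\<xi> i) p z
      = (\<Sum>i\<in>UNIV. u $ i * dir_deriv (ex i) p z + w $ i * dir_deriv (e\<xi> i) p z)" for u w :: "real ^ 'n"
    by (simp only: linear_sum[OF lin] linear_add[OF lin] linear_scale[OF lin] real_scaleR_def)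
  then have "dir_deriv (ham_field z) p z = (\<Sum>i\<in>UNIV. (2 *\<^sub>R (a (fst z) *v snd z)) $ i * dir_deriv (ex i) p z
      + (- force (fst z) (snd z)) $ i * dir_deriv (e\<xi> i) p z)"
    unfolding expand ham_field_def .
  then show ?thesis unfolding poisson_def x \<xi> by simp
qed

text \<open>
  The differential of \<open>compactify\<close> maps the Hamiltonian field to \<open>\<langle>\<xi>\<rangle>\<close> times \<open>sphere_field\<close>, since
  \<open>h\<close> is quadratic in \<open>\<xi>\<close>.
\<close>

lemma poisson_compactify:
  assumes P: "P differentiable (at (compactify z))"
  shows "poisson (ham a) (\<lambda>z. P (compactify z)) z = jb (snd z) * dir_deriv (sphere_field (compactify z)) P (compactify z)"
proof -
  let ?\<eta> = "snd (compactify z)" and ?J = "jb (snd z)"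
  have J: "?J > 0" by (rule jb_gt0)
  have \<xi>: "snd z = ?J *\<^sub>R ?\<eta>" using J by (simp add: compactify_def)
  have x: "fst (compactify z) = fst z" by (simp add: compactify_def)
  have comp: "((\<lambda>z. P (compactify z)) has_derivative (\<lambda>v. dir_deriv (d_compactify z v) P (compactify z))) (at z)"
    by (rule has_derivative_compose[OF compactify_has_derivative has_derivative_dir_deriv[OF P]])
  have "d_compactify z (ham_field z) = ?J *\<^sub>R sphere_field (compactify z)"
  proof (rule prod_eqI)
    have "a (fst z) *v snd z = ?J *\<^sub>R (a (fst z) *v ?\<eta>)"
      by (subst \<xi>) (simp add: matrix_vector_mult_scaleR)
    then show "fst (d_compactify z (ham_field z)) = fst (?J *\<^sub>R sphere_field (compactify z))"
      by (simp add: d_compactify_def ham_field_def sphere_field_def x)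
    have f: "force (fst z) (snd z) = ?J\<^sup>2 *\<^sub>R force (fst z) ?\<eta>"
      by (subst \<xi>) (simp add: force_scale)
    have "snd (d_compactify z (ham_field z)) = (1 / ?J) *\<^sub>R (- (?J\<^sup>2 *\<^sub>R force (fst z) ?\<eta>)
        + (?\<eta> \<bullet> (?J\<^sup>2 *\<^sub>R force (fst z) ?\<eta>)) *\<^sub>R ?\<eta>)"
      unfolding d_compactify_def ham_field_def snd_conv f by simp
    also have "\<dots> = ((1 / ?J) * ?J\<^sup>2) *\<^sub>R (- force (fst z) ?\<eta> + (?\<eta> \<bullet> force (fst z) ?\<eta>) *\<^sub>R ?\<eta>)"
      by (simp add: algebra_simps)
    also have "(1 / ?J) * ?J\<^sup>2 = ?J" using J by (simp add: power2_eq_square)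
    finally show "snd (d_compactify z (ham_field z)) = snd (?J *\<^sub>R sphere_field (compactify z))"
      by (simp add: sphere_field_def stretch_def ham_field_def x)
  qed
  moreover have "(\<lambda>z. P (compactify z)) differentiable (at z)"
    using comp unfolding differentiable_def by blast
  ultimately show ?thesis
    using poisson_eq[of "\<lambda>z. P (compactify z)" z] dir_deriv_eq[OF comp, of "ham_field z"]
      linear_scale[OF dir_deriv_linear[OF P], of ?J "sphere_field (compactify z)"] by simp
qed

lemma poisson_symbol_bounded:
  fixes p :: "'i \<Rightarrow> 'n phase \<Rightarrow> real"
  assumes p: "phase_symbols (Suc 0) 0 p"
  shows "\<exists>K. \<forall>i z. norm (snd z) \<le> 2 \<longrightarrow> \<bar>poisson (ham a) (p i) z\<bar> \<le> K"
proof -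
  have d: "p i differentiable (at z)" for i z by (rule symbols_differentiable[OF p])
  obtain M where M0: "M \<ge> 0" and
    Mw: "\<forall>b\<in>Basis. \<forall>i z. \<bar>dir_deriv b (p i) z\<bar> \<le> M * jb (snd z) powr (0 - norm (snd b))"
    using symbols_dir_deriv_bound[OF p] by blast
  have M: "\<bar>dir_deriv b (p i) z\<bar> \<le> M" if "b \<in> Basis" for b i z
  proof -
    have "jb (snd z) powr (0 - norm (snd b)) \<le> jb (snd z) powr 0"
      using jb_ge1[of "snd z"] by (intro powr_mono) auto
    then have "jb (snd z) powr (0 - norm (snd b)) \<le> 1" using jb_gt0[of "snd z"] by simp
    then have "M * jb (snd z) powr (0 - norm (snd b)) \<le> M * 1" using M0 by (intro mult_left_mono)
    then show ?thesis using Mw[rule_format, OF that, of i z] by linarith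
  qed
  have "\<bar>poisson (ham a) (p i) z\<bar> \<le> real DIM('n phase) * M * (8 * growth)" if "norm (snd z) \<le> 2" for i z
  proof -
    have "norm (ham_field z) \<le> 2 * growth * norm (snd z) + growth * (norm (snd z))\<^sup>2" by (rule norm_ham_field_le)
    also have "\<dots> \<le> 2 * growth * 2 + growth * 2\<^sup>2"
      by (intro add_mono mult_left_mono power_mono that) (use growth_bounds(1) in auto)
    finally have "norm (ham_field z) \<le> 8 * growth" by simp
    then have "real DIM('n phase) * M * norm (ham_field z) \<le> real DIM('n phase) * M * (8 * growth)"
      using M0 by (intro mult_left_mono) auto
    moreover have "\<bar>dir_deriv (ham_field z) (p i) z\<bar> \<le> real DIM('n phase) * M * norm (ham_field z)"
      by (rule abs_dir_deriv_le[OF d M])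
    ultimately show ?thesis unfolding poisson_eq[OF d] by linarith
  qed
  then show ?thesis by blast
qed

section \<open>Combination of the escape functions\<close>

text \<open>
  Splits \<open>sphere_field\<close> into the field of straight rays and a remainder of size \<open>O(\<langle>x\<rangle>\<^sup>-\<^sup>2)\<close> coming from
  \<open>A - I\<close> and \<open>\<nabla>a\<close>.
\<close>

lemma radial_growth:
  assumes r: "r \<ge> 0" and 1: "norm (snd z) \<le> 1"
  shows "dir_deriv (sphere_field z) (radial r c) z \<ge>
    r * (norm (snd z))\<^sup>2 / (jb (r *\<^sub>R (fst z - c)))\<^sup>2
    - (6 * r + 2 * norm (r *\<^sub>R (fst z - c))) * growth / (jb (r *\<^sub>R (fst z - c)) * (jb (fst z))\<^sup>2)"
proof -
  define J where "J = jb (r *\<^sub>R (fst z - c))"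
  define Y where "Y = norm (r *\<^sub>R (fst z - c))"
  define j where "j = growth / (jb (fst z))\<^sup>2"
  have J: "J > 0" unfolding J_def by (rule jb_gt0)
  have j: "j \<ge> 0" using growth_bounds(1) by (simp add: j_def)
  define v where "v = (2 *\<^sub>R (a (fst z) *v snd z - snd z), - force (fst z) (snd z) + stretch z *\<^sub>R snd z)"
  have "sphere_field z = (2 *\<^sub>R snd z, 0) + v"
    by (simp add: sphere_field_def ham_field_def v_def algebra_simps)
  then have "dir_deriv (sphere_field z) (radial r c) z = d_radial r c z (2 *\<^sub>R snd z, 0) + d_radial r c z v"
    by (simp add: dir_deriv_eq[OF radial_has_derivative] linear_add[OF d_radial_linear])
  moreover have "d_radial r c z (2 *\<^sub>R snd z, 0) \<ge> r * (norm (snd z))\<^sup>2 / J\<^sup>2"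
    unfolding J_def by (rule d_radial_straight[OF r])
  moreover have "\<bar>d_radial r c z v\<bar> \<le> (6 * r + 2 * Y) * growth / (J * (jb (fst z))\<^sup>2)"
  proof -
    have "norm (a (fst z) *v snd z - snd z) \<le> j * norm (snd z)" unfolding j_def by (rule norm_metric_diff_le)
    also have "\<dots> \<le> j * 1" using 1 j by (intro mult_left_mono)
    finally have v1: "norm (fst v) \<le> 2 * j" by (simp add: v_def)
    have F: "norm (force (fst z) (snd z)) \<le> j"
    proof -
      have "norm (force (fst z) (snd z)) \<le> j * (norm (snd z))\<^sup>2" unfolding j_def by (rule norm_force_le)
      also have "\<dots> \<le> j * 1\<^sup>2" using 1 j by (intro mult_left_mono power_mono) auto
      finally show ?thesis by simp
    qed
    have "\<bar>stretch z\<bar> \<le> norm (snd z) * norm (force (fst z) (snd z))"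
      unfolding stretch_def by (rule Cauchy_Schwarz_ineq2)
    also have "\<dots> \<le> 1 * j" by (intro mult_mono 1 F) auto
    finally have "\<bar>stretch z\<bar> * norm (snd z) \<le> j * 1" using 1 j by (intro mult_mono) auto
    then have v2: "norm (snd v) \<le> 2 * j"
      using F norm_triangle_ineq[of "- force (fst z) (snd z)" "stretch z *\<^sub>R snd z"] by (simp add: v_def)
    have "\<bar>d_radial r c z v\<bar> \<le> (3 * r * norm (fst v) + Y * norm (snd v)) / J"
      unfolding J_def Y_def by (rule abs_d_radial_le[OF r 1])
    also have "\<dots> \<le> (3 * r * (2 * j) + Y * (2 * j)) / J"
      using v1 v2 r J by (intro divide_right_mono add_mono mult_left_mono) (auto simp: Y_def)
    also have "\<dots> = (6 * r + 2 * Y) * growth / (J * (jb (fst z))\<^sup>2)"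
      by (simp add: j_def algebra_simps add_divide_distrib)
    finally show ?thesis .
  qed
  ultimately show ?thesis unfolding J_def Y_def by (simp add: abs_le_iff)
qed

lemma radial_growth_unit:
  assumes "norm (snd z) \<le> 1"
  shows "dir_deriv (sphere_field z) (radial 1 c) z \<ge>
    (norm (snd z))\<^sup>2 / (jb (fst z - c))\<^sup>2 - 8 * growth / (jb (fst z))\<^sup>2"
proof -
  define J where "J = jb (fst z - c)"
  have J: "J \<ge> 1" unfolding J_def by (rule jb_ge1)
  have "6 + 2 * norm (fst z - c) \<le> 8 * J" using norm_le_jb[of "fst z - c"] J by (simp add: J_def)
  then have "(6 + 2 * norm (fst z - c)) * (growth / (J * (jb (fst z))\<^sup>2)) \<le> (8 * J) * (growth / (J * (jb (fst z))\<^sup>2))"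
    using J growth_bounds(1) by (intro mult_right_mono) auto
  also have "\<dots> = 8 * growth / (jb (fst z))\<^sup>2" using J by simp
  finally show ?thesis using radial_growth[of 1 z c] assms by (simp add: J_def)
qed

text \<open>
  At scale \<open>\<rho>\<close>, with \<open>J\<^sup>2 = 1 + \<bar>x\<bar>\<^sup>2 / \<rho>\<^sup>2\<close>, the gain is of order \<open>1 / (\<rho> J\<^sup>2)\<close> and the error of order
  \<open>1 / (\<rho> J \<langle>x\<rangle>)\<close>.  As \<open>J / \<langle>x\<rangle>\<close> is small once both \<open>\<bar>x\<bar>\<close> and \<open>\<rho>\<close> are large, the gain dominates beyond a radius
  that does not depend on \<open>\<rho>\<close>.
\<close>

lemma radial_growth_wide:
  assumes \<rho>: "\<rho> \<ge> 1" "\<rho> \<ge> 64 * growth" and \<eta>: "3/4 \<le> norm (snd z)" "norm (snd z) \<le> 1"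
  shows "dir_deriv (sphere_field z) (radial (1 / \<rho>) 0) z \<ge> - 8 * growth / \<rho>"
    and "norm (fst z) \<ge> 64 * growth \<Longrightarrow>
      dir_deriv (sphere_field z) (radial (1 / \<rho>) 0) z \<ge> 1 / (4 * \<rho> * (1 + (norm (fst z) / \<rho>)\<^sup>2))"
proof -
  define X where "X = norm (fst z)"
  define J where "J = jb ((1 / \<rho>) *\<^sub>R fst z)"
  define j where "j = jb (fst z)"
  define N where "N = (norm (snd z))\<^sup>2"
  let ?D = "dir_deriv (sphere_field z) (radial (1 / \<rho>) 0) z"
  have J1: "J \<ge> 1" and j1: "j \<ge> 1" unfolding J_def j_def by (rule jb_ge1)+
  have Xj: "X \<le> j" unfolding X_def j_def by (rule norm_le_jb)
  have J2: "J\<^sup>2 = 1 + (X / \<rho>)\<^sup>2" unfolding J_def jb_square X_def using \<rho>(1) by simp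
  have N: "N \<ge> 1/2"
  proof -
    have "(3/4)\<^sup>2 \<le> N" unfolding N_def by (intro power_mono \<eta>) simp
    then show ?thesis by (simp add: power2_eq_square)
  qed
  have low: "?D \<ge> (1/\<rho>) * N / J\<^sup>2 - (6 * (1/\<rho>) + 2 * (X / \<rho>)) * growth / (J * j\<^sup>2)"
    using radial_growth[of "1/\<rho>" z 0] \<rho>(1) \<eta>(2) by (simp add: N_def J_def j_def X_def)
  have err: "(6 * (1/\<rho>) + 2 * (X / \<rho>)) * growth / (J * j\<^sup>2) \<le> 8 * growth / (\<rho> * J * j)"
  proof -
    have "6 + 2 * X \<le> 8 * j" using Xj j1 by linarith
    then have "(6 + 2 * X) * (growth / (\<rho> * J * j\<^sup>2)) \<le> (8 * j) * (growth / (\<rho> * J * j\<^sup>2))"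
      using J1 j1 \<rho>(1) growth_bounds(1) by (intro mult_right_mono) auto
    also have "\<dots> = 8 * growth / (\<rho> * J * j)" using j1 by (simp add: power2_eq_square)
    also have "(6 + 2 * X) * (growth / (\<rho> * J * j\<^sup>2)) = (6 * (1/\<rho>) + 2 * (X / \<rho>)) * growth / (J * j\<^sup>2)"
    proof -
      have "6 * (1/\<rho>) + 2 * (X / \<rho>) = (6 + 2 * X) / \<rho>" by (simp add: add_divide_distrib)
      then show ?thesis by (simp add: mult_ac)
    qed
    finally show ?thesis .
  qed
  show "?D \<ge> - 8 * growth / \<rho>"
  proof -
    have "\<rho> * 1 * 1 \<le> \<rho> * J * j" by (intro mult_mono) (use \<rho>(1) J1 j1 in auto)
    then have "8 * growth / (\<rho> * J * j) \<le> 8 * growth / \<rho>"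
      using \<rho>(1) growth_bounds(1) by (intro frac_le) auto
    moreover have "(1/\<rho>) * N / J\<^sup>2 \<ge> 0" using \<rho>(1) N by simp
    ultimately show ?thesis using low err by linarith
  qed
  assume far: "norm (fst z) \<ge> 64 * growth"
  have "J \<le> 1 + X / \<rho>"
    by (rule power2_le_imp_le) (use J2 \<rho>(1) in \<open>auto simp: X_def power2_eq_square algebra_simps\<close>)
  then have "32 * growth * J \<le> 32 * growth * (1 + X / \<rho>)" using growth_bounds(1) by (intro mult_left_mono) auto
  also have "\<dots> \<le> j"
  proof -
    have "growth / \<rho> \<le> 1 / 64" using \<rho> by (simp add: pos_divide_le_eq)
    then have "X * (growth / \<rho>) \<le> X * (1 / 64)" by (intro mult_left_mono) (auto simp: X_def)
    moreover have "X \<ge> 64 * growth" using far by (simp add: X_def)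
    moreover have "32 * growth * (1 + X / \<rho>) = 32 * growth + 32 * (X * (growth / \<rho>))" by (simp add: algebra_simps)
    ultimately show ?thesis using Xj by linarith
  qed
  finally have key: "32 * growth * J \<le> j" .
  have "8 * growth / (\<rho> * J * j) \<le> 1 / (4 * \<rho> * J\<^sup>2)"
  proof -
    have "(32 * growth * J) * (1 / (4 * \<rho> * J\<^sup>2 * j)) \<le> j * (1 / (4 * \<rho> * J\<^sup>2 * j))"
      using key \<rho>(1) J1 j1 by (intro mult_right_mono) auto
    then show ?thesis using \<rho>(1) J1 j1 by (simp add: power2_eq_square mult_ac)
  qed
  moreover have "(1/\<rho>) * N / J\<^sup>2 \<ge> 1 / (2 * \<rho> * J\<^sup>2)"
  proof -
    have "(1/2) * (1 / (\<rho> * J\<^sup>2)) \<le> N * (1 / (\<rho> * J\<^sup>2))" using N \<rho>(1) by (intro mult_right_mono) auto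
    then show ?thesis by simp
  qed
  moreover have "1 / (2 * \<rho> * J\<^sup>2) - 1 / (4 * \<rho> * J\<^sup>2) = 1 / (4 * \<rho> * J\<^sup>2)" by (simp add: field_simps)
  ultimately have "?D \<ge> 1 / (4 * \<rho> * J\<^sup>2)" using low err by linarith
  then show "?D \<ge> 1 / (4 * \<rho> * (1 + (norm (fst z) / \<rho>)\<^sup>2))" unfolding J2 X_def .
qed

text \<open>
  The mollified escape function gains \<open>1/4\<close> for \<open>\<bar>x\<bar> \<le> R\<close> and loses at most \<open>(K + 1) / \<rho>\<close>,
  and that only for \<open>\<bar>x\<bar> \<le> 2 \<rho> + 1\<close>.  There the stretched radial function gains at least
  \<open>1 / (40 \<rho>)\<close>, and the factor \<open>A = 80 (K + 1)\<close> makes this twice the loss.  The condition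
  on \<open>\<rho>\<close> makes the losses of both parts for \<open>\<bar>x\<bar> \<le> R\<close> at most half of \<open>1/4\<close>.
\<close>

lemma global_escape_function:
  "\<exists>P c. c > 0 \<and> (\<forall>z. P differentiable (at z)) \<and>
     (\<forall>k. phase_symbols k 0 (\<lambda>(i::real^'n) z. P (compactify z))) \<and>
     (\<forall>z. 3/4 \<le> norm (snd z) \<longrightarrow> norm (snd z) \<le> 1 \<longrightarrow>
        dir_deriv (sphere_field z) P z \<ge> c / (jb (fst z))\<^sup>2)"
proof -
  define R where "R = max free_radius (64 * growth)"
  have R: "R \<ge> free_radius" "R \<ge> 64 * growth" "R \<ge> 1" by (auto simp: R_def free_radius_def)
  obtain K where K: "K \<ge> 0" and F_ex: "\<forall>\<rho> \<delta>. \<rho> \<ge> R + 1 \<longrightarrow> \<delta> > 0 \<longrightarrow> (\<exists>F. (\<forall>k. bounded_Ck k F) \<and>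
     (\<forall>z. 3/4 \<le> norm (snd z) \<longrightarrow> norm (snd z) \<le> 1 \<longrightarrow>
        (norm (fst z) \<le> R \<longrightarrow> dir_deriv (sphere_field z) F z \<ge> 1/4 - K / \<rho> - \<delta>) \<and>
        dir_deriv (sphere_field z) F z \<ge> - K / \<rho> - \<delta> \<and>
        (norm (fst z) \<ge> 2 * \<rho> + 1 \<longrightarrow> dir_deriv (sphere_field z) F z \<ge> 0)))"
    using smooth_escape_function[OF R(1)] by blast
  define A where "A = 80 * (K + 1)"
  define \<rho> where "\<rho> = max (R + 1) (8 * (K + 1 + 8 * growth * A))"
  have A: "A > 0" using K by (simp add: A_def)
  have \<rho>: "\<rho> \<ge> R + 1" "\<rho> \<ge> 1" "\<rho> \<ge> 64 * growth" "8 * (K + 1 + 8 * growth * A) \<le> \<rho>"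
    using R by (auto simp: \<rho>_def)
  obtain F where F: "\<And>k. bounded_Ck k F" and F_all: "\<forall>z. 3/4 \<le> norm (snd z) \<longrightarrow> norm (snd z) \<le> 1 \<longrightarrow>
        (norm (fst z) \<le> R \<longrightarrow> dir_deriv (sphere_field z) F z \<ge> 1/4 - K / \<rho> - 1 / \<rho>) \<and>
        dir_deriv (sphere_field z) F z \<ge> - K / \<rho> - 1 / \<rho> \<and>
        (norm (fst z) \<ge> 2 * \<rho> + 1 \<longrightarrow> dir_deriv (sphere_field z) F z \<ge> 0)"
  proof -
    have "1 / \<rho> > 0" using \<rho>(2) by simp
    from F_ex[rule_format, OF \<rho>(1) this] show ?thesis using that by blast
  qed
  have F1: "\<And>z. 3/4 \<le> norm (snd z) \<Longrightarrow> norm (snd z) \<le> 1 \<Longrightarrow> norm (fst z) \<le> R \<Longrightarrow>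
        dir_deriv (sphere_field z) F z \<ge> 1/4 - K / \<rho> - 1 / \<rho>"
    and F2: "\<And>z. 3/4 \<le> norm (snd z) \<Longrightarrow> norm (snd z) \<le> 1 \<Longrightarrow> dir_deriv (sphere_field z) F z \<ge> - K / \<rho> - 1 / \<rho>"
    and F3: "\<And>z. 3/4 \<le> norm (snd z) \<Longrightarrow> norm (snd z) \<le> 1 \<Longrightarrow> norm (fst z) \<ge> 2 * \<rho> + 1 \<Longrightarrow>
        dir_deriv (sphere_field z) F z \<ge> 0"
    using F_all by blast+
  define P where "P = (\<lambda>z. F z + A * radial (1 / \<rho>) 0 z)"
  have F_diff: "F differentiable (at z)" for z using F[of "Suc 0"] by (rule symbols_differentiable)
  have dP: "(P has_derivative (\<lambda>v. dir_deriv v F z + A * d_radial (1 / \<rho>) 0 z v)) (at z)" for z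
    unfolding P_def
    by (intro has_derivative_add has_derivative_dir_deriv[OF F_diff] has_derivative_mult_right radial_has_derivative)
  have DP: "dir_deriv v P z = dir_deriv v F z + A * dir_deriv v (radial (1 / \<rho>) 0) z" for v z
    by (simp add: dir_deriv_eq[OF dP] dir_deriv_eq[OF radial_has_derivative])
  define c where "c = min (1/8) (A / (8 * \<rho>))"
  show ?thesis
  proof (intro exI[of _ P] exI[of _ c] conjI allI impI)
    show "c > 0" using A \<rho>(2) by (simp add: c_def)
    show "P differentiable (at z)" for z using dP unfolding differentiable_def by blast
    fix k
    have "phase_symbols k 0 (\<lambda>(i::real^'n) z. radial (1 / \<rho>) 0 (compactify z))"
      using symbols_reindex[OF radial_symbols, of k "1 / \<rho>" "\<lambda>_. 0"] .
    then show "phase_symbols k 0 (\<lambda>(i::real^'n) z. P (compactify z))"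
      unfolding P_def by (intro symbols_add[OF compactify_symbols[OF F]] symbols_cmult jb_gt0)
  next
    fix z :: "'n phase" assume \<eta>: "3/4 \<le> norm (snd z)" "norm (snd z) \<le> 1"
    let ?F = "dir_deriv (sphere_field z) F z" and ?q = "dir_deriv (sphere_field z) (radial (1 / \<rho>) 0) z"
    have j: "(jb (fst z))\<^sup>2 \<ge> 1" using jb_ge1 by (rule one_le_power)
    show "dir_deriv (sphere_field z) P z \<ge> c / (jb (fst z))\<^sup>2"
    proof (cases "norm (fst z) \<le> R")
      case True
      have "A * ?q \<ge> A * (- 8 * growth / \<rho>)"
        using A by (intro mult_left_mono radial_growth_wide(1) \<rho> \<eta>) auto
      moreover have "K / \<rho> + 1 / \<rho> + A * (8 * growth / \<rho>) \<le> 1 / 8"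
      proof -
        have "(K + 1 + 8 * growth * A) / \<rho> \<le> 1 / 8" using \<rho>(2,4) by (simp add: pos_divide_le_eq)
        then show ?thesis by (simp add: add_divide_distrib mult_ac)
      qed
      ultimately have "?F + A * ?q \<ge> 1 / 8" using F1[OF \<eta> True] by simp
      moreover have "c / (jb (fst z))\<^sup>2 \<le> 1 / 8"
      proof -
        have "c / (jb (fst z))\<^sup>2 \<le> (1/8) / 1" using j by (intro frac_le) (auto simp: c_def)
        then show ?thesis by simp
      qed
      ultimately show ?thesis unfolding DP by linarith
    next
      case False
      define S where "S = 1 + (norm (fst z) / \<rho>)\<^sup>2"
      have S1: "S \<ge> 1" by (simp add: S_def)
      have "?q \<ge> 1 / (4 * \<rho> * S)"
        unfolding S_def using False R by (intro radial_growth_wide(2) \<rho> \<eta>) auto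
      then have q: "A * ?q \<ge> A * (1 / (4 * \<rho> * S))" using A by (intro mult_left_mono) auto
      have half: "A * (1 / (4 * \<rho> * S)) = A / (8 * \<rho> * S) + A / (8 * \<rho> * S)" by (simp add: field_simps)
      have "?F \<ge> - (A / (8 * \<rho> * S))"
      proof (cases "norm (fst z) \<ge> 2 * \<rho> + 1")
        case True
        have "A / (8 * \<rho> * S) \<ge> 0" using A \<rho>(2) S1 by simp
        then show ?thesis using F3[OF \<eta> True] by linarith
      next
        case False
        then have "norm (fst z) / \<rho> \<le> 3" using \<rho>(2) by (simp add: pos_divide_le_eq)
        then have "(norm (fst z) / \<rho>)\<^sup>2 \<le> 3\<^sup>2" using \<rho>(2) by (intro power_mono) auto
        then have "S \<le> 10" by (simp add: S_def)
        then have "8 * \<rho> * S \<le> 8 * \<rho> * 10" using \<rho>(2) by (intro mult_left_mono) auto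
        then have "A / (8 * \<rho> * 10) \<le> A / (8 * \<rho> * S)"
          using A \<rho>(2) S1 by (intro divide_left_mono) auto
        moreover have "A / (8 * \<rho> * 10) = K / \<rho> + 1 / \<rho>" by (simp add: A_def add_divide_distrib)
        ultimately show ?thesis using F2[OF \<eta>] by simp
      qed
      then have "?F + A * ?q \<ge> A / (8 * \<rho> * S)" using q half by linarith
      moreover have "A / (8 * \<rho> * S) \<ge> c / (jb (fst z))\<^sup>2"
      proof -
        have "(norm (fst z) / \<rho>)\<^sup>2 \<le> (norm (fst z))\<^sup>2"
          using \<rho>(2) by (intro power_mono) (auto simp: pos_divide_le_eq mult_le_cancel_left1)
        then have "S \<le> (jb (fst z))\<^sup>2" by (simp add: S_def jb_square)
        then have "c / (jb (fst z))\<^sup>2 \<le> (A / (8 * \<rho>)) / S"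
          using S1 A \<rho>(2) by (intro frac_le) (auto simp: c_def)
        then show ?thesis by simp
      qed
      ultimately show ?thesis unfolding DP by linarith
    qed
  qed
qed

text \<open>
  The multiple \<open>M\<close> of the global escape function cancels the error \<open>8 growth / \<langle>x\<rangle>\<^sup>2\<close> of the radial function
  centered at \<open>c\<close>, whatever \<open>c\<close> is.  For \<open>\<bar>\<xi>\<bar> > 2\<close> one has \<open>\<bar>\<eta>\<bar> \<ge> 3/4\<close>; the remaining \<open>\<xi>\<close> are absorbed by the
  constant \<open>C\<^sub>2\<close>.
\<close>

lemma uniform_escape_symbols:
  "\<exists>C\<^sub>1 C\<^sub>2. C\<^sub>1 > 0 \<and> (\<exists>p :: real ^ 'n \<Rightarrow> 'n phase \<Rightarrow> real. (\<forall>k. phase_symbols k 0 p) \<and>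
     (\<forall>c x \<xi>. poisson (ham a) (p c) (x, \<xi>) \<ge> C\<^sub>1 * norm \<xi> / (jb (x - c))\<^sup>2 - C\<^sub>2))"
proof -
  obtain P e where e: "e > 0" and P_diff: "\<And>z. P differentiable (at z)"
    and P_sym: "\<And>k. phase_symbols k 0 (\<lambda>(i::real^'n) z. P (compactify z))"
    and P_ge: "\<And>z. 3/4 \<le> norm (snd z) \<Longrightarrow> norm (snd z) \<le> 1 \<Longrightarrow> dir_deriv (sphere_field z) P z \<ge> e / (jb (fst z))\<^sup>2"
    using global_escape_function by blast
  define M where "M = 8 * growth / e"
  have M: "M \<ge> 0" "M * e = 8 * growth" using e growth_bounds(1) by (auto simp: M_def)
  define Q where "Q = (\<lambda>c z. radial 1 c z + M * P z)"
  define p where "p = (\<lambda>c z. Q c (compactify z))"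
  have p_sym: "phase_symbols k 0 p" for k
    unfolding p_def Q_def by (intro symbols_add symbols_cmult radial_symbols P_sym) (rule jb_gt0)
  have dQ: "(Q c has_derivative (\<lambda>v. d_radial 1 c z v + M * dir_deriv v P z)) (at z)" for c z
    unfolding Q_def
    by (intro has_derivative_add radial_has_derivative has_derivative_mult_right has_derivative_dir_deriv[OF P_diff])
  have Q_diff: "Q c differentiable (at z)" for c z using dQ unfolding differentiable_def by blast
  have DQ: "dir_deriv v (Q c) z = dir_deriv v (radial 1 c) z + M * dir_deriv v P z" for v c z
    by (simp add: dir_deriv_eq[OF dQ] dir_deriv_eq[OF radial_has_derivative])
  obtain K where K: "\<And>c z. norm (snd z) \<le> 2 \<Longrightarrow> \<bar>poisson (ham a) (p c) z\<bar> \<le> K"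
    using poisson_symbol_bounded[OF p_sym] by blast
  have K0: "K \<ge> 0" using order_trans[OF abs_ge_zero K[of 0]] by simp
  have "poisson (ham a) (p c) (x, \<xi>) \<ge> (1/2) * norm \<xi> / (jb (x - c))\<^sup>2 - (1 + K)" for c x \<xi>
  proof (cases "norm \<xi> \<le> 2")
    case True
    have "(jb (x - c))\<^sup>2 \<ge> 1" using jb_ge1 by (rule one_le_power)
    then have "(1/2) * norm \<xi> / (jb (x - c))\<^sup>2 \<le> 1 / 1" using True by (intro frac_le) auto
    then show ?thesis using K[of "(x, \<xi>)" c] True by (simp add: abs_le_iff)
  next
    case False
    define J where "J = jb \<xi>"
    let ?z = "compactify (x, \<xi>)"
    have J: "J > 0" unfolding J_def by (rule jb_gt0)
    have \<eta>: "norm (snd ?z) = norm \<xi> / J" using J by (simp add: compactify_def J_def)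
    have x: "fst ?z = x" by (simp add: compactify_def)
    have le1: "norm (snd ?z) \<le> 1" unfolding \<eta> J_def by (rule norm_div_jb)
    have ge: "3/4 \<le> norm (snd ?z)"
    proof -
      have "2\<^sup>2 \<le> (norm \<xi>)\<^sup>2" using False by (intro power_mono) auto
      moreover have "J\<^sup>2 = 1 + (norm \<xi>)\<^sup>2" unfolding J_def by (rule jb_square)
      moreover have "(4/3 * norm \<xi>)\<^sup>2 = 16/9 * (norm \<xi>)\<^sup>2" unfolding power_mult_distrib by (simp add: power2_eq_square)
      ultimately have "J\<^sup>2 \<le> (4/3 * norm \<xi>)\<^sup>2" by simp
      then have "J \<le> 4/3 * norm \<xi>" by (rule power2_le_imp_le) simp
      then show ?thesis unfolding \<eta> using J by (simp add: pos_le_divide_eq)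
    qed
    have "dir_deriv (sphere_field ?z) (Q c) ?z \<ge>
       ((norm (snd ?z))\<^sup>2 / (jb (x - c))\<^sup>2 - 8 * growth / (jb x)\<^sup>2) + M * (e / (jb x)\<^sup>2)"
      unfolding DQ
      using add_mono[OF radial_growth_unit[OF le1, of c] mult_left_mono[OF P_ge[OF ge le1] M(1)]] by (simp add: x)
    also have "M * (e / (jb x)\<^sup>2) = 8 * growth / (jb x)\<^sup>2" using M(2) by simp
    finally have "dir_deriv (sphere_field ?z) (Q c) ?z \<ge> (norm (snd ?z))\<^sup>2 / (jb (x - c))\<^sup>2" by simp
    then have "J * dir_deriv (sphere_field ?z) (Q c) ?z \<ge> J * ((norm (snd ?z))\<^sup>2 / (jb (x - c))\<^sup>2)"
      using J by (intro mult_left_mono) auto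
    moreover have "poisson (ham a) (p c) (x, \<xi>) = J * dir_deriv (sphere_field ?z) (Q c) ?z"
      using poisson_compactify[OF Q_diff, of c "(x, \<xi>)"] by (simp add: p_def J_def)
    moreover have "J * ((norm (snd ?z))\<^sup>2 / (jb (x - c))\<^sup>2) \<ge> (1/2) * norm \<xi> / (jb (x - c))\<^sup>2"
    proof -
      have "J * (norm (snd ?z))\<^sup>2 = norm (snd ?z) * norm \<xi>" unfolding \<eta> using J by (simp add: power2_eq_square)
      also have "\<dots> \<ge> (1/2) * norm \<xi>" using ge by (intro mult_right_mono) auto
      finally have "(1/2) * norm \<xi> / (jb (x - c))\<^sup>2 \<le> J * (norm (snd ?z))\<^sup>2 / (jb (x - c))\<^sup>2"
        by (intro divide_right_mono) auto
      then show ?thesis by simp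
    qed
    ultimately show ?thesis using K0 by linarith
  qed
  then show ?thesis using p_sym by (intro exI[of _ "1/2"] exI[of _ "1 + K"] conjI exI[of _ p]) auto
qed

end

theorem lemma2p2:
  "\<exists>N::nat. \<forall>(C::real) (a :: real ^ 'n \<Rightarrow> real ^ 'n ^ 'n) X \<Xi>.
     C > 0 \<longrightarrow>
     coeffs_regular N C a \<longrightarrow>
     coeffs_symmetric a \<longrightarrow>
     coeffs_elliptic C a \<longrightarrow>
     coeffs_asymp_flat C a \<longrightarrow>
     hamiltonian_flow a X \<Xi> \<longrightarrow>
     nontrapping X \<longrightarrow>
     (\<exists>(C\<^sub>1::real) (C\<^sub>2::real) (K :: 'n list \<Rightarrow> 'n list \<Rightarrow> real).
        C\<^sub>1 > 0 \<and>
        (\<forall>\<mu> :: int ^ 'n. \<exists>p \<in> symbol_class 0.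
           (\<forall>\<alpha> \<beta>. symbol_seminorm 0 \<alpha> \<beta> p \<le> K \<alpha> \<beta>) \<and>
           (\<forall>x \<xi>. poisson (ham a) p (x, \<xi>)
                    \<ge> C\<^sub>1 * norm \<xi> / (jb (x - cube_center \<mu>))\<^sup>2 - C\<^sub>2)))"
proof (rule exI[of _ 2], intro allI impI)
  fix C :: real and a :: "real ^ 'n \<Rightarrow> real ^ 'n ^ 'n" and X \<Xi>
  assume "C > 0" "coeffs_regular 2 C a" "coeffs_symmetric a" "coeffs_elliptic C a"
    "coeffs_asymp_flat C a" "hamiltonian_flow a X \<Xi>" "nontrapping X"
  then interpret nontrapping_metric a C X \<Xi> by unfold_locales
  obtain C\<^sub>1 C\<^sub>2 and p :: "real ^ 'n \<Rightarrow> 'n phase \<Rightarrow> real" where C1: "C\<^sub>1 > 0"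
    and p: "\<And>k. phase_symbols k 0 p"
    and H: "\<And>c x \<xi>. poisson (ham a) (p c) (x, \<xi>) \<ge> C\<^sub>1 * norm \<xi> / (jb (x - c))\<^sup>2 - C\<^sub>2"
    using uniform_escape_symbols by blast
  have "\<forall>\<alpha> \<beta>. \<exists>K. \<forall>c. symbol_seminorm 0 \<alpha> \<beta> (p c) \<le> K"
    using symbol_classI(2)[OF p] by blast
  then obtain K where K: "\<And>\<alpha> \<beta> c. symbol_seminorm 0 \<alpha> \<beta> (p c) \<le> K \<alpha> \<beta>" by metis
  show "\<exists>(C\<^sub>1::real) (C\<^sub>2::real) (K :: 'n list \<Rightarrow> 'n list \<Rightarrow> real).
        C\<^sub>1 > 0 \<and>
        (\<forall>\<mu> :: int ^ 'n. \<exists>p \<in> symbol_class 0.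
           (\<forall>\<alpha> \<beta>. symbol_seminorm 0 \<alpha> \<beta> p \<le> K \<alpha> \<beta>) \<and>
           (\<forall>x \<xi>. poisson (ham a) p (x, \<xi>)
                    \<ge> C\<^sub>1 * norm \<xi> / (jb (x - cube_center \<mu>))\<^sup>2 - C\<^sub>2))"
  proof (rule exI[of _ C\<^sub>1], rule exI[of _ C\<^sub>2], rule exI[of _ K], intro conjI allI C1)
    fix \<mu> :: "int ^ 'n"
    show "\<exists>p \<in> symbol_class 0. (\<forall>\<alpha> \<beta>. symbol_seminorm 0 \<alpha> \<beta> p \<le> K \<alpha> \<beta>) \<and>
       (\<forall>x \<xi>. poisson (ham a) p (x, \<xi>) \<ge> C\<^sub>1 * norm \<xi> / (jb (x - cube_center \<mu>))\<^sup>2 - C\<^sub>2)"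
      by (intro bexI[of _ "p (cube_center \<mu>)"] conjI allI K H symbol_classI(1)[OF p])
  qed
qed

end
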